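(* For every $0<\varepsilon\le1$ there exists a bandlimited orthogonal wavelet $\psi$ such that $$|\psi(x)|\le c\exp\left\{-\frac{c'\varepsilon|x|}{[\ln(e+|x|)]^{1+\varepsilon}}\right\},\qquad x\in\mathbb R,$$ where $c'>0$ is an absolute constant and $c$ depends only on $\varepsilon$. Furthermore, for each integer $\ell\ge1$ there exists a bandlimited orthogonal wavelet $\psi$ satisfying the same type of estimate with $[\ln(e+|x|)]^{1+\varepsilon}$ replaced by $$\prod_{i=1}^{\ell}\ln_i\big(\exp_i(1)+|x|\big)\cdot\big[\ln_{\ell+1}\big(\exp_{\ell+1}(1)+|x|\big)\big]^{1+\varepsilon}$$ (with constants possibly depending also on $\ell$).
   Context: A bandlimited orthogonal wavelet is a function $\psi\in L^2(\mathbb R)$ whose Fourier transform $\hat\psi$ is compactly supported and such that $\{2^{j/2}\psi(2^jx-k)\}_{j,k\in\mathbb Z}$ is an orthonormal basis of $L^2(\mathbb R)$. Here $\ln_i$ denotes the $i$-fold iterated natural logarithm and $\exp_i(1)$ the $i$-fold iterated exponential evaluated at $1$ (so $\exp_1(1)=e$, $\exp_2(1)=e^e$). *)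

theory Defs
  imports "HOL-Analysis.Analysis"
begin

definition L2 :: "(real \<Rightarrow> complex) \<Rightarrow> bool" where
  "L2 f \<longleftrightarrow> f \<in> borel_measurable lebesgue \<and> integrable lebesgue (\<lambda>x. (cmod (f x))^2)"

definition L2_inner :: "(real \<Rightarrow> complex) \<Rightarrow> (real \<Rightarrow> complex) \<Rightarrow> complex" where
  "L2_inner f g = (LINT x|lebesgue. f x * cnj (g x))"

definition fourier :: "(real \<Rightarrow> complex) \<Rightarrow> real \<Rightarrow> complex" where
  "fourier f \<xi> = (LINT x|lebesgue. f x * exp (- (2 * of_real pi * \<i> * of_real \<xi> * of_real x)))"

definition wavelet_system :: "(real \<Rightarrow> complex) \<Rightarrow> int \<Rightarrow> int \<Rightarrow> real \<Rightarrow> complex" where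
  "wavelet_system \<psi> j k x = of_real (2 powr (real_of_int j / 2)) * \<psi> (2 powr (real_of_int j) * x - real_of_int k)"

text \<open>Orthonormal basis of L^2(R): orthonormal and complete (only the zero element,
  up to null sets, is orthogonal to all members).\<close>
definition orthogonal_wavelet :: "(real \<Rightarrow> complex) \<Rightarrow> bool" where
  "orthogonal_wavelet \<psi> \<longleftrightarrow> L2 \<psi> \<and>
     (\<forall>j k j' k'. L2_inner (wavelet_system \<psi> j k) (wavelet_system \<psi> j' k')
                    = (if j = j' \<and> k = k' then 1 else 0)) \<and>
     (\<forall>f. L2 f \<and> (\<forall>j k. L2_inner f (wavelet_system \<psi> j k) = 0) \<longrightarrow> (AE x in lebesgue. f x = 0))"

definition bandlimited :: "(real \<Rightarrow> complex) \<Rightarrow> bool" where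
  "bandlimited \<psi> \<longleftrightarrow> integrable lebesgue \<psi> \<and> (\<exists>R. \<forall>\<xi>. \<bar>\<xi>\<bar> > R \<longrightarrow> fourier \<psi> \<xi> = 0)"

definition bandlimited_orthogonal_wavelet :: "(real \<Rightarrow> complex) \<Rightarrow> bool" where
  "bandlimited_orthogonal_wavelet \<psi> \<longleftrightarrow> bandlimited \<psi> \<and> orthogonal_wavelet \<psi>"

definition lnit :: "nat \<Rightarrow> real \<Rightarrow> real" where "lnit i = (ln ^^ i)"
definition expit :: "nat \<Rightarrow> real \<Rightarrow> real" where "expit i = (exp ^^ i)"

end

theory Submission
  imports Defs "HOL-Probability.Probability"
begin

text \<open>
  The wavelet is of Meyer type. Repeatedly averaging a trapezoid over intervals of half-lengths
  \<open>a\<^sub>k\<close> with a finite sum gives a compactly supported cutoff \<open>\<kappa>\<close> around \<open>[-1/2, 1/2]\<close> whose inverse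
  Fourier transform at \<open>x\<close> is bounded by \<open>\<Prod>\<^sub>k min 1 (1 / (2 pi a\<^sub>k |x|))\<close>. Taking \<open>a\<^sub>k\<close> of order
  \<open>\<epsilon> / (k \<Theta>(k))\<close>, which is summable with a sum bounded independently of \<open>\<epsilon>\<close>, about \<open>\<epsilon> |x| / \<Theta>(|x|)\<close>
  factors are below \<open>1/e\<close>.

  The bell \<open>b(u) = cos (pi/2 \<kappa>(u)) sin (pi/2 \<kappa>(u/2))\<close> is an entire function of cutoffs, so it inherits the
  decay: the functions whose transform is integrable against a submultiplicative weight form an algebra
  (Beurling), and \<open>exp (y / \<Theta>(y))\<close> is submultiplicative because \<open>\<Theta>\<close> is nondecreasing. The wavelet has Fourier
  transform \<open>cis (pi \<xi>) b(\<xi>)\<close>.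

  Orthonormality is Parseval's identity together with \<open>b(u)\<^sup>2 = p(u/2) - p(u)\<close> and the reflection symmetry of
  \<open>\<kappa>\<close>. For completeness, every test function with smooth frequency support away from 0 is a finite sum over
  scales of absolutely convergent wavelet series: the coefficients come from Poisson summation, and
  \<open>b(u) b(u + 1) = b(2u) b(2u + 2)\<close> makes the aliasing terms of neighbouring scales cancel. The test functions
  used are differences of dilated kernels, so a function orthogonal to all wavelets has vanishing mollifications.
\<close>

section \<open>Fourier inversion\<close>

text \<open>The rate has to be linear in \<epsilon> with an absolute constant. This is achieved by
  putting \<epsilon> into the averaging lengths: \<epsilon> / (k \<Theta>(k)) is compared with an
  increment of a negative power, with exponent -\<epsilon>, of an iterated logarithm, and
  differentiating that power yields exactly the factor \<epsilon>. The total length therefore fits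
  one budget for all \<epsilon>. Meyer's supports dictate the budget: the transition zone must lie
  in [1/3, 2/3] for bells two scales apart not to overlap. Of its half-width 1/6, one half goes to
  the trapezoid and one half to the averages.

  Composition with an entire function costs nothing in the exponent, only powers of 1 + |x| that
  make the convolution integrals converge. Fourth-power decay of the cutoff pays for this and still
  leaves an integrable wavelet.

  Every transform taken is that of an integrable function, and an arbitrary f in L2 is only paired
  with explicit functions. This shapes the completeness proof, which works on test functions and
  never on the transform of f.\<close>

text \<open>\<open>ift f\<close> is the inverse transform; the Fourier transform of \<open>f\<close> at \<open>\<xi>\<close> is \<open>ift f (- \<xi>)\<close>.\<close>

definition ift :: "(real \<Rightarrow> complex) \<Rightarrow> real \<Rightarrow> complex" where
  "ift f x = (LINT \<xi>|lborel. f \<xi> * cis (2 * pi * x * \<xi>))"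

lemma continuous_cis_compose [continuous_intros]:
  "continuous_on S g \<Longrightarrow> continuous_on S (\<lambda>x. cis (g x))"
  by (simp add: cis_conv_exp) (intro continuous_intros)

lemma borel_measurable_cis [measurable (raw)]:
  assumes "g \<in> borel_measurable M"
  shows "(\<lambda>x. cis (g x)) \<in> borel_measurable M"
proof -
  have "cis \<in> borel_measurable borel"
    using borel_measurable_continuous_onI[of cis] continuous_cis_compose[of UNIV "\<lambda>x. x"] by simp
  from measurable_compose[OF assms this] show ?thesis .
qed

lemma borel_measurable_cnj [measurable (raw)]:
  assumes "g \<in> borel_measurable M"
  shows "(\<lambda>x. cnj (g x)) \<in> borel_measurable M"
proof -
  have "cnj \<in> borel_measurable borel"
    by (intro borel_measurable_continuous_onI continuous_intros)
  from measurable_compose[OF assms this] show ?thesis .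
qed

lemma integrable_mult_cis:
  fixes f :: "'a \<Rightarrow> complex"
  assumes "integrable M f" "g \<in> borel_measurable M"
  shows "integrable M (\<lambda>x. f x * cis (g x))"
  by (rule Bochner_Integration.integrable_bound[OF assms(1)])
     (use assms in \<open>auto simp: norm_mult\<close>)

text \<open>A product majorant gives joint integrability outright. The interchanges in inversion,
  convolution and Parseval all have one, because \<open>cis\<close> has modulus one.\<close>

lemma (in pair_sigma_finite) integrable_tensor_bound:
  fixes F :: "'a \<Rightarrow> 'b \<Rightarrow> complex" and a :: "'a \<Rightarrow> real" and b :: "'b \<Rightarrow> real"
  assumes [measurable]: "(\<lambda>(x, y). F x y) \<in> borel_measurable (M1 \<Otimes>\<^sub>M M2)"
    and a: "integrable M1 a" and b: "integrable M2 b"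
    and le: "\<And>x y. cmod (F x y) \<le> a x * b y"
  shows "integrable (M1 \<Otimes>\<^sub>M M2) (\<lambda>(x, y). F x y)"
proof (rule Bochner_Integration.integrable_bound)
  have [measurable]: "a \<in> borel_measurable M1" "b \<in> borel_measurable M2" using a b by auto
  show "integrable (M1 \<Otimes>\<^sub>M M2) (\<lambda>(x, y). a x * b y)"
    by (rule Fubini_integrable) (use a b in \<open>auto simp: abs_mult\<close>)
  show "AE z in M1 \<Otimes>\<^sub>M M2. norm (case z of (x, y) \<Rightarrow> F x y) \<le> norm (case z of (x, y) \<Rightarrow> a x * b y)"
    using le by (auto intro!: AE_I2 order_trans[OF le])
qed measurable

lemma (in pair_sigma_finite) Fubini_tensor_bound:
  fixes F :: "'a \<Rightarrow> 'b \<Rightarrow> complex" and a :: "'a \<Rightarrow> real" and b :: "'b \<Rightarrow> real"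
  assumes "(\<lambda>(x, y). F x y) \<in> borel_measurable (M1 \<Otimes>\<^sub>M M2)"
    and "integrable M1 a" and "integrable M2 b"
    and "\<And>x y. cmod (F x y) \<le> a x * b y"
  shows "(LINT x|M1. LINT y|M2. F x y) = (LINT y|M2. LINT x|M1. F x y)"
  by (rule Fubini_integral[symmetric]) (rule integrable_tensor_bound[OF assms])

lemma norm_ift_le:
  assumes "integrable lborel f"
  shows "cmod (ift f x) \<le> (LINT \<xi>|lborel. cmod (f \<xi>))"
proof -
  have "cmod (ift f x) \<le> (LINT \<xi>|lborel. cmod (f \<xi> * cis (2 * pi * x * \<xi>)))"
    unfolding ift_def by (rule integral_norm_bound)
  thus ?thesis by (simp add: norm_mult)
qed

lemma ift_modulate: "ift (\<lambda>\<xi>. cis (2 * pi * c * \<xi>) * f \<xi>) x = ift f (x + c)"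
  unfolding ift_def
  by (rule Bochner_Integration.integral_cong) (simp_all add: cis_mult[symmetric] algebra_simps)

lemma ift_scale:
  assumes "s \<noteq> 0"
  shows "ift (\<lambda>\<xi>. f (s * \<xi>)) x = ift f (x / s) / of_real \<bar>s\<bar>"
proof -
  have "ift f (x / s) = \<bar>s\<bar> *\<^sub>R (LINT \<xi>|lborel. f (0 + s * \<xi>) * cis (2 * pi * (x / s) * (0 + s * \<xi>)))"
    unfolding ift_def by (rule lborel_integral_real_affine[OF assms])
  also have "\<dots> = \<bar>s\<bar> *\<^sub>R ift (\<lambda>\<xi>. f (s * \<xi>)) x"
    unfolding ift_def using assms by (simp add: mult.assoc)
  finally show ?thesis using assms by (simp add: scaleR_conv_of_real)
qed

lemma ift_cnj: "ift (\<lambda>\<xi>. cnj (f \<xi>)) x = cnj (ift f (- x))"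
  unfolding ift_def by (simp add: cis_cnj flip: Bochner_Integration.integral_cnj)

lemma ift_diff:
  assumes "integrable lborel f" "integrable lborel g"
  shows "ift (\<lambda>\<xi>. f \<xi> - g \<xi>) x = ift f x - ift g x"
  unfolding ift_def
  by (subst Bochner_Integration.integral_diff[symmetric])
     (use assms in \<open>auto intro!: integrable_mult_cis simp: algebra_simps\<close>)

lemma ift_sum:
  assumes "finite I" "\<And>i. i \<in> I \<Longrightarrow> integrable lborel (f i)"
  shows "ift (\<lambda>\<xi>. \<Sum>i\<in>I. f i \<xi>) x = (\<Sum>i\<in>I. ift (f i) x)"
  unfolding ift_def
  by (subst Bochner_Integration.integral_sum[symmetric])
     (use assms in \<open>auto intro!: integrable_mult_cis simp: sum_distrib_right\<close>)

lemma borel_measurable_ift [measurable]: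
  assumes [measurable]: "f \<in> borel_measurable borel"
  shows "ift f \<in> borel_measurable borel"
  unfolding ift_def[abs_def] by measurable

lemma integral_std_normal_cis:
  "(LINT x|lborel. std_normal_density x *\<^sub>R cis (t * x)) = of_real (exp (- t\<^sup>2 / 2))"
proof -
  have "char std_normal_distribution t = of_real (exp (- t\<^sup>2 / 2))"
    using char_std_normal_distribution by (simp add: fun_eq_iff)
  thus ?thesis
    unfolding char_def by (subst (asm) integral_density) (auto simp: cis_conv_exp)
qed

text \<open>The Gaussian is its own transform up to scale. The factor 2 pi \<sigma> is chosen so
  that the result is the density of a centred normal law with standard deviation \<sigma>, an
  approximate identity as \<sigma> tends to 0.\<close>

lemma gaussian_transform:
  assumes "\<sigma> > 0"
  shows "(LINT x|lborel. of_real (exp (- (2 * pi * \<sigma> * x)\<^sup>2 / 2)) * cis (2 * pi * x * u))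
           = of_real (std_normal_density (u / \<sigma>) / \<sigma>)"
proof -
  define c where "c = 1 / (2 * pi * \<sigma>)"
  have c: "c \<noteq> 0" "c > 0" using assms by (auto simp: c_def)
  have "(LINT x|lborel. of_real (exp (- (2 * pi * \<sigma> * x)\<^sup>2 / 2)) * cis (2 * pi * x * u)) =
     \<bar>c\<bar> *\<^sub>R (LINT x|lborel. of_real (exp (- (2 * pi * \<sigma> * (0 + c * x))\<^sup>2 / 2)) * cis (2 * pi * (0 + c * x) * u))"
    by (rule lborel_integral_real_affine[OF c(1)])
  also have "(LINT x|lborel. of_real (exp (- (2 * pi * \<sigma> * (0 + c * x))\<^sup>2 / 2)) * cis (2 * pi * (0 + c * x) * u))
     = (LINT x|lborel. of_real (sqrt (2 * pi)) * (std_normal_density x *\<^sub>R cis (u / \<sigma> * x)))"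
    by (rule Bochner_Integration.integral_cong)
       (use assms in \<open>simp_all add: c_def std_normal_density_def scaleR_conv_of_real field_simps\<close>)
  also have "\<dots> = of_real (sqrt (2 * pi)) * of_real (exp (- (u / \<sigma>)\<^sup>2 / 2))"
    by (subst integral_mult_right_zero) (simp only: integral_std_normal_cis)
  also have "\<bar>c\<bar> *\<^sub>R \<dots> = of_real (c * (sqrt (2 * pi) * exp (- (u / \<sigma>)\<^sup>2 / 2)))"
    using c by (simp add: scaleR_conv_of_real)
  also have "c * (sqrt (2 * pi) * exp (- (u / \<sigma>)\<^sup>2 / 2)) = std_normal_density (u / \<sigma>) / \<sigma>"
  proof -
    have "sqrt (2 * pi) * sqrt (2 * pi) = 2 * pi" by simp
    hence "sqrt (2 * pi) / (2 * pi) = 1 / sqrt (2 * pi)"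
      by (simp add: field_simps)
    thus ?thesis using assms unfolding c_def std_normal_density_def by (simp add: field_simps)
  qed
  finally show ?thesis .
qed

text \<open>Damping \<open>ift f\<close> by the Gaussian \<open>g \<sigma>\<close> makes Fubini
  legitimate and turns the double transform into the mean of f under a normal law centred at \<xi>.
  As \<sigma> tends to 0, the damped side converges with majorant |\<open>ift f\<close>|, and the
  mean converges because f is bounded and continuous.\<close>

lemma ift_inversion:
  fixes f :: "real \<Rightarrow> complex"
  assumes f: "integrable lborel f" and cont: "continuous_on UNIV f"
    and bd: "\<And>x. cmod (f x) \<le> B" and k: "integrable lborel (ift f)"
  shows "ift (ift f) (- \<xi>) = f \<xi>"
proof -
  have [measurable]: "f \<in> borel_measurable borel"
    using borel_measurable_continuous_onI[OF cont] .
  define g where "g \<sigma> x = exp (- (2 * pi * \<sigma> * x)\<^sup>2 / 2)" for \<sigma> x :: real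
  have [measurable]: "g \<sigma> \<in> borel_measurable borel" for \<sigma> unfolding g_def[abs_def] by measurable
  have g01: "0 \<le> g \<sigma> x" "g \<sigma> x \<le> 1" for \<sigma> x by (auto simp: g_def)
  have gint: "integrable lborel (g \<sigma>)" if "\<sigma> > 0" for \<sigma>
  proof -
    have "integrable lborel (\<lambda>x. sqrt (2 * pi) * std_normal_density (0 + (2 * pi * \<sigma>) * x))"
      using that by (intro integrable_mult_right lborel_integrable_real_affine) auto
    also have "(\<lambda>x. sqrt (2 * pi) * std_normal_density (0 + (2 * pi * \<sigma>) * x)) = g \<sigma>"
      by (auto simp: g_def std_normal_density_def)
    finally show ?thesis .
  qed
  have eq: "(LINT x|lborel. ift f x * (cis (2 * pi * (-\<xi>) * x) * of_real (g \<sigma> x)))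
      = (LINT y|lborel. std_normal_density y *\<^sub>R f (\<xi> + \<sigma> * y))" if s: "\<sigma> > 0" for \<sigma>
  proof -
    have c: "cis (2 * pi * x * \<eta>) * (cis (2 * pi * (-\<xi>) * x) * of_real (g \<sigma> x))
        = of_real (g \<sigma> x) * cis (2 * pi * x * (\<eta> - \<xi>))" for x \<eta>
      by (simp add: cis_mult mult.assoc[symmetric]) (simp add: algebra_simps)
    have "(LINT x|lborel. ift f x * (cis (2 * pi * (-\<xi>) * x) * of_real (g \<sigma> x)))
       = (LINT x|lborel. LINT \<eta>|lborel. f \<eta> * (of_real (g \<sigma> x) * cis (2 * pi * x * (\<eta> - \<xi>))))"
      unfolding ift_def by (simp only: integral_mult_left_zero[symmetric] mult.assoc[of "f _"] c)
    also have "\<dots> = (LINT \<eta>|lborel. LINT x|lborel. f \<eta> * (of_real (g \<sigma> x) * cis (2 * pi * x * (\<eta> - \<xi>))))"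
      by (rule lborel_pair.Fubini_tensor_bound[where a="g \<sigma>" and b="\<lambda>\<eta>. cmod (f \<eta>)"])
         (use gint[OF s] f g01 in \<open>auto simp: norm_mult mult.commute\<close>)
    also have "\<dots> = (LINT \<eta>|lborel. f \<eta> * of_real (std_normal_density ((\<eta> - \<xi>) / \<sigma>) / \<sigma>))"
      using gaussian_transform[OF s] by (simp add: g_def)
    also have "\<dots> = \<bar>\<sigma>\<bar> *\<^sub>R (LINT y|lborel. f (\<xi> + \<sigma> * y) * of_real (std_normal_density ((\<xi> + \<sigma> * y - \<xi>) / \<sigma>) / \<sigma>))"
      using s by (intro lborel_integral_real_affine) simp
    also have "\<dots> = (LINT y|lborel. std_normal_density y *\<^sub>R f (\<xi> + \<sigma> * y))"
      using s by (subst integral_scaleR_right[symmetric]) (simp add: scaleR_conv_of_real field_simps)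
    finally show ?thesis .
  qed
  define \<sigma> where "\<sigma> n = 1 / real (Suc n)" for n
  have s0: "\<sigma> n > 0" for n by (simp add: \<sigma>_def)
  have slim: "\<sigma> \<longlonglongrightarrow> 0" unfolding \<sigma>_def using LIMSEQ_Suc[OF lim_1_over_n] by simp
  have "(\<lambda>n. LINT x|lborel. ift f x * (cis (2 * pi * (-\<xi>) * x) * of_real (g (\<sigma> n) x)))
     \<longlonglongrightarrow> (LINT x|lborel. ift f x * cis (2 * pi * (-\<xi>) * x))"
  proof (rule integral_dominated_convergence[where w="\<lambda>x. cmod (ift f x)"])
    show "AE x in lborel. (\<lambda>n. ift f x * (cis (2 * pi * - \<xi> * x) * complex_of_real (g (\<sigma> n) x)))
       \<longlonglongrightarrow> ift f x * cis (2 * pi * - \<xi> * x)"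
    proof (intro AE_I2)
      fix x
      have "(\<lambda>n. g (\<sigma> n) x) \<longlonglongrightarrow> exp (- (2 * pi * 0 * x)\<^sup>2 / 2)"
        unfolding g_def by (intro tendsto_intros slim) auto
      hence "(\<lambda>n. ift f x * (cis (2 * pi * - \<xi> * x) * complex_of_real (g (\<sigma> n) x)))
         \<longlonglongrightarrow> ift f x * (cis (2 * pi * - \<xi> * x) * of_real 1)"
        by (intro tendsto_intros) simp
      thus "(\<lambda>n. ift f x * (cis (2 * pi * - \<xi> * x) * complex_of_real (g (\<sigma> n) x)))
         \<longlonglongrightarrow> ift f x * cis (2 * pi * - \<xi> * x)" by simp
    qed
    show "AE x in lborel. cmod (ift f x * (cis (2 * pi * - \<xi> * x) * complex_of_real (g (\<sigma> n) x))) \<le> cmod (ift f x)" for n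
      using g01 by (auto simp: norm_mult intro!: mult_left_le)
  qed (use k in auto)
  moreover have "(\<lambda>n. LINT y|lborel. std_normal_density y *\<^sub>R f (\<xi> + \<sigma> n * y))
     \<longlonglongrightarrow> (LINT y|lborel. std_normal_density y *\<^sub>R f \<xi>)"
  proof (rule integral_dominated_convergence[where w="\<lambda>y. B * std_normal_density y"])
    show "AE y in lborel. (\<lambda>n. std_normal_density y *\<^sub>R f (\<xi> + \<sigma> n * y)) \<longlonglongrightarrow> std_normal_density y *\<^sub>R f \<xi>"
    proof (intro AE_I2 tendsto_intros)
      fix y
      have "isCont f (\<xi> + 0 * y)" using cont by (simp add: continuous_on_eq_continuous_at)
      moreover have "(\<lambda>n. \<xi> + \<sigma> n * y) \<longlonglongrightarrow> \<xi> + 0 * y" by (intro tendsto_intros slim)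
      ultimately have "(\<lambda>n. f (\<xi> + \<sigma> n * y)) \<longlonglongrightarrow> f (\<xi> + 0 * y)" by (rule isCont_tendsto_compose)
      thus "(\<lambda>n. f (\<xi> + \<sigma> n * y)) \<longlonglongrightarrow> f \<xi>" by simp
    qed
    show "AE y in lborel. norm (std_normal_density y *\<^sub>R f (\<xi> + \<sigma> n * y)) \<le> B * std_normal_density y" for n
      using bd by (auto intro!: AE_I2 mult_right_mono simp: mult.commute[of "std_normal_density _"])
  qed auto
  moreover have "(LINT y|lborel. std_normal_density y *\<^sub>R f \<xi>) = f \<xi>"
    using integral_normal_moment_nz_1 by simp
  ultimately show ?thesis
    using eq[OF s0] LIMSEQ_unique unfolding ift_def[of "ift f"] by simp
qed

text \<open>Inversion is applied to F inside the \<xi>-integral. In later iterations F is the fixed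
  factor and G the product accumulated so far.\<close>

lemma ift_mult_convolution:
  assumes F: "integrable lborel F" "continuous_on UNIV F" "\<And>x. cmod (F x) \<le> B"
      "integrable lborel (ift F)"
    and G: "integrable lborel G"
  shows "ift (\<lambda>\<xi>. F \<xi> * G \<xi>) x = (LINT y|lborel. ift F y * ift G (x - y))"
proof -
  have [measurable]: "F \<in> borel_measurable borel" "G \<in> borel_measurable borel"
    using F(1) G by auto
  have c: "ift F y * (G \<xi> * cis (2 * pi * (x - y) * \<xi>))
      = ift F y * cis (2 * pi * (-\<xi>) * y) * (G \<xi> * cis (2 * pi * x * \<xi>))" for y \<xi>
    by (simp add: cis_mult algebra_simps cis_divide[symmetric])
  have "(LINT y|lborel. ift F y * ift G (x - y))
      = (LINT y|lborel. LINT \<xi>|lborel. ift F y * (G \<xi> * cis (2 * pi * (x - y) * \<xi>)))"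
    unfolding ift_def[of G] by (simp only: integral_mult_right_zero[symmetric])
  also have "\<dots> = (LINT \<xi>|lborel. LINT y|lborel. ift F y * (G \<xi> * cis (2 * pi * (x - y) * \<xi>)))"
    by (rule lborel_pair.Fubini_tensor_bound[where a="\<lambda>y. cmod (ift F y)" and b="\<lambda>\<xi>. cmod (G \<xi>)"])
       (use F G in \<open>auto simp: norm_mult\<close>)
  also have "\<dots> = (LINT \<xi>|lborel. ift (ift F) (-\<xi>) * (G \<xi> * cis (2 * pi * x * \<xi>)))"
    unfolding c integral_mult_left_zero ift_def[of "ift F"] ..
  also have "\<dots> = ift (\<lambda>\<xi>. F \<xi> * G \<xi>) x"
    by (simp only: ift_inversion[OF F]) (simp add: ift_def mult.assoc)
  finally show ?thesis ..
qed

text \<open>Both sides are iterated forms of one double integral. In this form the inner products of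
  wavelets move to the frequency side.\<close>

lemma ift_parseval:
  assumes u: "integrable lborel u" and V: "integrable lborel V"
  shows "(LINT x|lborel. u x * cnj (ift V x)) = (LINT \<xi>|lborel. ift u (- \<xi>) * cnj (V \<xi>))"
proof -
  have [measurable]: "u \<in> borel_measurable borel" "V \<in> borel_measurable borel"
    using u V by auto
  have c: "u x * cnj (V \<xi> * cis (2 * pi * x * \<xi>)) = u x * cis (2 * pi * (- \<xi>) * x) * cnj (V \<xi>)" for x \<xi>
    by (simp add: cis_cnj mult_ac)
  have "(LINT x|lborel. u x * cnj (ift V x))
      = (LINT x|lborel. LINT \<xi>|lborel. u x * cnj (V \<xi> * cis (2 * pi * x * \<xi>)))"
    unfolding ift_def by (simp only: integral_mult_right_zero[symmetric] Bochner_Integration.integral_cnj[symmetric])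
  also have "\<dots> = (LINT \<xi>|lborel. LINT x|lborel. u x * cnj (V \<xi> * cis (2 * pi * x * \<xi>)))"
    by (rule lborel_pair.Fubini_tensor_bound[where a="\<lambda>x. cmod (u x)" and b="\<lambda>\<xi>. cmod (V \<xi>)"])
       (use u V in \<open>auto simp: norm_mult\<close>)
  also have "\<dots> = (LINT \<xi>|lborel. ift u (- \<xi>) * cnj (V \<xi>))"
    unfolding c integral_mult_left_zero ift_def[of u] ..
  finally show ?thesis .
qed

lemma inverse_square_integrable: "integrable lborel (\<lambda>x::real. 1 / (1 + \<bar>x\<bar>)\<^sup>2)"
proof (rule Bochner_Integration.integrable_bound)
  show "integrable lborel (\<lambda>x::real. inverse (1 + x\<^sup>2))"
    using integrable_inverse_1_plus_square by (simp add: set_integrable_def)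
  show "AE x::real in lborel. norm (1 / (1 + \<bar>x\<bar>)\<^sup>2) \<le> norm (inverse (1 + x\<^sup>2))"
    by (auto intro!: AE_I2 divide_left_mono mult_pos_pos add_pos_nonneg simp: inverse_eq_divide power2_sum)
qed auto

section \<open>Compactly supported cutoffs\<close>

lemma integrable_compact_support:
  fixes f :: "real \<Rightarrow> 'b::{banach, second_countable_topology}"
  assumes [measurable]: "f \<in> borel_measurable borel"
    and bd: "\<And>x. norm (f x) \<le> B" and supp: "\<And>x. R < \<bar>x\<bar> \<Longrightarrow> f x = 0"
  shows "integrable lborel f"
proof (rule Bochner_Integration.integrable_bound)
  show "integrable lborel (\<lambda>x::real. B * indicator {-R..R} x)"
    by (intro integrable_mult_right integrable_real_indicator) (auto simp: emeasure_lborel_Icc_eq)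
  show "AE x in lborel. norm (f x) \<le> norm (B * indicator {-R..R} x)"
  proof (intro AE_I2)
    fix x show "norm (f x) \<le> norm (B * indicator {-R..R} x)"
      using bd[of x] supp[of x] order_trans[OF norm_ge_zero bd[of x]]
      by (cases "R < \<bar>x\<bar>") (auto simp: indicator_def)
  qed
qed simp

section \<open>Averages over symmetric intervals\<close>

definition U01 :: "real measure" where "U01 = uniform_measure lborel {0..1}"

text \<open>Convolution with the uniform law on [-a, a], folded onto t in [0, 1]. Folding keeps
  evenness and the reflection about 1/2 visible and makes the Fourier multiplier the real integral
  of cos (2 pi a x t).\<close>

definition avg :: "real \<Rightarrow> (real \<Rightarrow> real) \<Rightarrow> real \<Rightarrow> real" where
  "avg a f \<xi> = (LINT t|U01. (f (\<xi> + a * t) + f (\<xi> - a * t)) / 2)"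

text \<open>An even, 6-Lipschitz version of the indicator of \<open>[-1/2, 1/2]\<close> whose transition zones have
  half-width \<open>r\<close>; the last clause is the symmetry of the transition about \<open>1/2\<close>.\<close>

definition transition :: "real \<Rightarrow> (real \<Rightarrow> real) \<Rightarrow> bool" where
  "transition r f \<longleftrightarrow>
     (\<forall>\<xi>. 0 \<le> f \<xi> \<and> f \<xi> \<le> 1) \<and> (\<forall>\<xi>. f (- \<xi>) = f \<xi>) \<and>
     (\<forall>\<xi> \<eta>. \<bar>f \<xi> - f \<eta>\<bar> \<le> 6 * \<bar>\<xi> - \<eta>\<bar>) \<and>
     (\<forall>\<xi>. \<bar>\<xi>\<bar> \<le> 1/2 - r \<longrightarrow> f \<xi> = 1) \<and> (\<forall>\<xi>. 1/2 + r \<le> \<bar>\<xi>\<bar> \<longrightarrow> f \<xi> = 0) \<and>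
     (\<forall>\<xi>. \<bar>\<xi> - 1/2\<bar> \<le> 1 - r \<longrightarrow> f \<xi> + f (1 - \<xi>) = 1)"

lemma transitionD:
  assumes "transition r f"
  shows "0 \<le> f \<xi>" "f \<xi> \<le> 1" "f (- \<xi>) = f \<xi>" "\<bar>f \<xi> - f \<eta>\<bar> \<le> 6 * \<bar>\<xi> - \<eta>\<bar>"
    "\<bar>\<xi>\<bar> \<le> 1/2 - r \<Longrightarrow> f \<xi> = 1" "1/2 + r \<le> \<bar>\<xi>\<bar> \<Longrightarrow> f \<xi> = 0"
    "\<bar>\<xi> - 1/2\<bar> \<le> 1 - r \<Longrightarrow> f \<xi> + f (1 - \<xi>) = 1"
  using assms unfolding transition_def by blast+

lemma transition_mono: "transition r f \<Longrightarrow> r \<le> r' \<Longrightarrow> transition r' f"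
  unfolding transition_def by auto

lemma transition_continuous:
  assumes "transition r f" shows "continuous_on UNIV f"
proof -
  have "6-lipschitz_on UNIV f"
    using transitionD(4)[OF assms] by (auto intro!: lipschitz_onI simp: dist_real_def)
  thus ?thesis by (rule lipschitz_on_continuous_on)
qed

lemma transition_measurable: "transition r f \<Longrightarrow> f \<in> borel_measurable borel"
  by (rule borel_measurable_continuous_onI[OF transition_continuous])

lemma transition_integrable:
  assumes "transition r f" shows "integrable lborel f"
  by (rule integrable_compact_support[OF transition_measurable[OF assms], of 1 "1/2 + r"])
     (use transitionD[OF assms] in auto)

lemma transition_integral_le:
  assumes f: "transition r f" and r: "r \<le> 1/2"
  shows "(LINT \<xi>|lborel. cmod (complex_of_real (f \<xi>))) \<le> 2"
proof -
  have "(LINT \<xi>|lborel. cmod (complex_of_real (f \<xi>))) \<le> (LINT \<xi>|lborel. indicator {-1..1::real} \<xi>)"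
  proof (rule integral_mono)
    fix \<xi> :: real
    show "cmod (complex_of_real (f \<xi>)) \<le> indicator {-1..1} \<xi>"
      using transitionD(1,2,6)[OF f, of \<xi>] r by (auto simp: indicator_def abs_if split: if_splits)
  qed (use transition_integrable[OF f] in auto)
  thus ?thesis by simp
qed

lemma prob_space_U01: "prob_space U01"
  unfolding U01_def by (rule prob_space_uniform_measure) auto

lemma sets_U01 [measurable_cong]: "sets U01 = sets borel" by (simp add: U01_def)

lemma space_U01 [simp]: "space U01 = UNIV" by (simp add: U01_def)

lemma integrable_U01:
  fixes f :: "real \<Rightarrow> 'b::{banach, second_countable_topology}"
  assumes [measurable]: "f \<in> borel_measurable borel" and "\<And>x. norm (f x) \<le> B"
  shows "integrable U01 f"
proof -
  interpret prob_space U01 by (rule prob_space_U01)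
  show ?thesis by (rule integrable_const_bound[of _ B]) (use assms in auto)
qed

lemma AE_U01: "(\<And>t. 0 \<le> t \<Longrightarrow> t \<le> 1 \<Longrightarrow> P t) \<Longrightarrow> AE t in U01. P t"
  unfolding U01_def by (rule AE_uniform_measureI) auto

lemma measure_U01_UNIV [simp]: "Sigma_Algebra.measure U01 UNIV = 1"
  using prob_space.prob_space[OF prob_space_U01] by simp

lemma integral_U01:
  fixes f :: "real \<Rightarrow> real"
  assumes [measurable]: "f \<in> borel_measurable borel"
  shows "(LINT t|U01. f t) = (LINT t|lborel. f t * indicator {0..1} t)"
proof -
  have "U01 = density lborel (\<lambda>x. ennreal (indicator {0..1} x))"
    unfolding U01_def uniform_measure_def by (intro density_cong) (auto simp: indicator_def)
  hence "(LINT t|U01. f t) = (LINT t|density lborel (\<lambda>x. ennreal (indicator {0..1} x)). f t)" by simp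
  also have "\<dots> = (LINT t|lborel. indicator {0..1} t *\<^sub>R f t)" by (rule integral_density) auto
  finally show ?thesis by (simp add: mult.commute)
qed

lemma transition_avg_integrable:
  assumes "transition r f"
  shows "integrable U01 (\<lambda>t. (f (\<xi> + a * t) + f (\<xi> - a * t)) / 2)"
proof (rule integrable_U01)
  have [measurable]: "f \<in> borel_measurable borel" using transition_measurable[OF assms] .
  show "(\<lambda>t. (f (\<xi> + a * t) + f (\<xi> - a * t)) / 2) \<in> borel_measurable borel" by measurable
  show "norm ((f (\<xi> + a * t) + f (\<xi> - a * t)) / 2) \<le> 1" for t
    using transitionD(1,2)[OF assms, of "\<xi> + a * t"] transitionD(1,2)[OF assms, of "\<xi> - a * t"] by simp
qed

lemma avg_eq_const:
  assumes "transition r f" "\<And>t. 0 \<le> t \<Longrightarrow> t \<le> 1 \<Longrightarrow> f (\<xi> + a * t) + f (\<xi> - a * t) = 2 * c"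
  shows "avg a f \<xi> = c"
proof -
  have "avg a f \<xi> = (LINT t|U01. c)"
    unfolding avg_def
    by (rule integral_cong_AE)
       (use transition_avg_integrable[OF assms(1)] assms(2) in \<open>auto intro!: AE_U01\<close>)
  thus ?thesis by simp
qed

text \<open>A Lipschitz function moves by at most its constant times a. As averaging preserves the
  constant 6, summable lengths make the iterated averages converge.\<close>

lemma avg_close:
  assumes f: "transition r f" and a: "a \<ge> 0"
  shows "\<bar>avg a f \<xi> - f \<xi>\<bar> \<le> 6 * a"
proof -
  interpret prob_space U01 by (rule prob_space_U01)
  have "avg a f \<xi> - f \<xi> = (LINT t|U01. (f (\<xi> + a * t) + f (\<xi> - a * t)) / 2 - f \<xi>)"
    unfolding avg_def by (subst Bochner_Integration.integral_diff) (use transition_avg_integrable[OF f] in auto)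
  moreover have "\<bar>\<dots>\<bar> \<le> (LINT t|U01. \<bar>(f (\<xi> + a * t) + f (\<xi> - a * t)) / 2 - f \<xi>\<bar>)"
    by (rule integral_abs_bound)
  moreover have "\<dots> \<le> (LINT t|U01. 6 * a)"
  proof (rule integral_mono_AE)
    show "AE t in U01. \<bar>(f (\<xi> + a * t) + f (\<xi> - a * t)) / 2 - f \<xi>\<bar> \<le> 6 * a"
    proof (rule AE_U01)
      fix t :: real assume t: "0 \<le> t" "t \<le> 1"
      have "\<bar>f (\<xi> + a * t) - f \<xi>\<bar> \<le> 6 * \<bar>a * t\<bar>" "\<bar>f (\<xi> - a * t) - f \<xi>\<bar> \<le> 6 * \<bar>a * t\<bar>"
        using transitionD(4)[OF f, of "\<xi> + a * t" \<xi>] transitionD(4)[OF f, of "\<xi> - a * t" \<xi>] by auto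
      moreover have "\<bar>a * t\<bar> \<le> a" using a t by (simp add: abs_mult mult_left_le)
      ultimately show "\<bar>(f (\<xi> + a * t) + f (\<xi> - a * t)) / 2 - f \<xi>\<bar> \<le> 6 * a" by argo
    qed
  qed (use transition_avg_integrable[OF f] in auto)
  ultimately show ?thesis by (simp del: integral_abs_bound)
qed

text \<open>The points \<xi> + a t and \<xi> - a t stay within a of \<xi>, hence each plateau
  shrinks by a. For the reflection, 1 - (\<xi> + a t) = (1 - \<xi>) - a t, so the four values in the
  two averages pair up, each pair with sum 1.\<close>

lemma transition_avg:
  assumes f: "transition r f" and a: "a \<ge> 0"
  shows "transition (r + a) (avg a f)"
  unfolding transition_def
proof (intro conjI allI impI)
  interpret prob_space U01 by (rule prob_space_U01)
  note int = transition_avg_integrable[OF f]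
  have at: "0 \<le> a * t" "a * t \<le> a" if "0 \<le> t" "t \<le> 1" for t
    using a that by (simp_all add: mult_left_le)
  fix \<xi> \<eta> :: real
  have "(LINT t|U01. 0) \<le> avg a f \<xi>" unfolding avg_def
    by (rule integral_mono_AE) (use int transitionD(1)[OF f] in \<open>auto intro!: AE_I2\<close>)
  thus "0 \<le> avg a f \<xi>" by simp
  have "avg a f \<xi> \<le> (LINT t|U01. 1)" unfolding avg_def
    by (rule integral_mono_AE)
       (use int add_mono[OF transitionD(2)[OF f] transitionD(2)[OF f]] in \<open>auto intro!: AE_I2\<close>)
  thus "avg a f \<xi> \<le> 1" by simp
  have "f (- \<xi> + a * t) = f (\<xi> - a * t)" "f (- \<xi> - a * t) = f (\<xi> + a * t)" for t
    using transitionD(3)[OF f, of "\<xi> - a * t"] transitionD(3)[OF f, of "\<xi> + a * t"] by (auto simp: algebra_simps)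
  thus "avg a f (- \<xi>) = avg a f \<xi>" unfolding avg_def by (simp add: add.commute)
  have "avg a f \<xi> - avg a f \<eta> =
      (LINT t|U01. (f (\<xi> + a * t) + f (\<xi> - a * t)) / 2 - (f (\<eta> + a * t) + f (\<eta> - a * t)) / 2)"
    unfolding avg_def by (subst Bochner_Integration.integral_diff) (use int in auto)
  moreover have "\<bar>\<dots>\<bar> \<le> (LINT t|U01. \<bar>(f (\<xi> + a * t) + f (\<xi> - a * t)) / 2 - (f (\<eta> + a * t) + f (\<eta> - a * t)) / 2\<bar>)"
    by (rule integral_abs_bound)
  moreover have "\<dots> \<le> (LINT t|U01. 6 * \<bar>\<xi> - \<eta>\<bar>)"
  proof (rule integral_mono_AE, goal_cases)
    case 3 show ?case
    proof (rule AE_U01)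
      fix t :: real
      show "\<bar>(f (\<xi> + a * t) + f (\<xi> - a * t)) / 2 - (f (\<eta> + a * t) + f (\<eta> - a * t)) / 2\<bar> \<le> 6 * \<bar>\<xi> - \<eta>\<bar>"
        using transitionD(4)[OF f, of "\<xi> + a * t" "\<eta> + a * t"]
          transitionD(4)[OF f, of "\<xi> - a * t" "\<eta> - a * t"] by simp argo
    qed
  qed (use int in auto)
  ultimately show "\<bar>avg a f \<xi> - avg a f \<eta>\<bar> \<le> 6 * \<bar>\<xi> - \<eta>\<bar>" by (simp del: integral_abs_bound)
next
  have at: "0 \<le> a * t" "a * t \<le> a" if "0 \<le> t" "t \<le> 1" for t
    using a that by (simp_all add: mult_left_le)
  fix \<xi> :: real
  { assume "\<bar>\<xi>\<bar> \<le> 1/2 - (r + a)"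
    hence "f (\<xi> + a * t) = 1" "f (\<xi> - a * t) = 1" if "0 \<le> t" "t \<le> 1" for t
      using at[OF that] by (auto intro!: transitionD(5)[OF f])
    thus "avg a f \<xi> = 1" by (intro avg_eq_const[OF f]) simp }
  { assume "1/2 + (r + a) \<le> \<bar>\<xi>\<bar>"
    hence "f (\<xi> + a * t) = 0" "f (\<xi> - a * t) = 0" if "0 \<le> t" "t \<le> 1" for t
      using at[OF that] by (auto intro!: transitionD(6)[OF f])
    thus "avg a f \<xi> = 0" by (intro avg_eq_const[OF f]) simp }
  { assume *: "\<bar>\<xi> - 1/2\<bar> \<le> 1 - (r + a)"
    have "avg a f \<xi> + avg a f (1 - \<xi>) = (LINT t|U01. (f (\<xi> + a * t) + f (\<xi> - a * t)) / 2 +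
             (f (1 - \<xi> + a * t) + f (1 - \<xi> - a * t)) / 2)"
      unfolding avg_def
      by (subst Bochner_Integration.integral_add) (use transition_avg_integrable[OF f] in auto)
    also have "\<dots> = (LINT t|U01. 1)"
    proof (rule integral_cong_AE, goal_cases)
      case 3 show ?case
      proof (rule AE_U01)
        fix t :: real assume t: "0 \<le> t" "t \<le> 1"
        have "\<bar>(\<xi> + a * t) - 1/2\<bar> \<le> 1 - r" "\<bar>(\<xi> - a * t) - 1/2\<bar> \<le> 1 - r"
          using * at[OF t] by argo+
        from transitionD(7)[OF f this(1)] transitionD(7)[OF f this(2)]
        show "(f (\<xi> + a * t) + f (\<xi> - a * t)) / 2 + (f (1 - \<xi> + a * t) + f (1 - \<xi> - a * t)) / 2 = 1"
          by (simp add: add_divide_distrib[symmetric] diff_add_eq diff_diff_eq2 diff_diff_add)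
      qed
    qed (use transition_avg_integrable[OF f] in auto)
    finally show "avg a f \<xi> + avg a f (1 - \<xi>) = 1" by simp }
qed

text \<open>The integral is sin \<theta> / \<theta>. The bound 1 serves small \<theta>, and 1 /
  |\<theta>| is the one factor of decay that each average contributes.\<close>

lemma integral_cos_U01_le:
  assumes "\<theta> \<noteq> 0"
  shows "\<bar>LINT t|U01. cos (\<theta> * t)\<bar> \<le> min 1 (1 / \<bar>\<theta>\<bar>)"
proof -
  interpret prob_space U01 by (rule prob_space_U01)
  have "\<bar>LINT t|U01. cos (\<theta> * t)\<bar> \<le> (LINT t|U01. \<bar>cos (\<theta> * t)\<bar>)" by (rule integral_abs_bound)
  also have "\<dots> \<le> (LINT t|U01. 1)"
    by (rule integral_mono_AE) (auto intro!: AE_I2 integrable_U01[of _ 1])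
  finally have 1: "\<bar>LINT t|U01. cos (\<theta> * t)\<bar> \<le> 1" by simp
  have "(LINT t|U01. cos (\<theta> * t)) = (LINT t|lborel. cos (\<theta> * t) * indicator {0..1} t)"
    by (rule integral_U01) simp
  also have "\<dots> = sin (\<theta> * 1) / \<theta> - sin (\<theta> * 0) / \<theta>"
    by (rule integral_FTC_Icc_real)
       (use assms in \<open>auto intro!: derivative_eq_intros continuous_intros\<close>)
  finally have "\<bar>LINT t|U01. cos (\<theta> * t)\<bar> \<le> 1 / \<bar>\<theta>\<bar>"
    using abs_sin_le_one[of \<theta>] by (simp add: divide_right_mono)
  with 1 show ?thesis by simp
qed

text \<open>A translate contributes a phase, and the opposite phases of the two translates combine
  to a cosine.\<close>

lemma ift_avg:
  assumes f: "transition r f"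
  shows "ift (\<lambda>\<xi>. of_real (avg a f \<xi>)) x = of_real (LINT t|U01. cos (2 * pi * a * x * t)) * ift (\<lambda>\<xi>. of_real (f \<xi>)) x"
proof -
  interpret prob_space U01 by (rule prob_space_U01)
  interpret pair_sigma_finite U01 lborel ..
  have [measurable]: "f \<in> borel_measurable borel" using transition_measurable[OF f] .
  have fint: "integrable lborel (\<lambda>\<xi>. complex_of_real (f \<xi>))" using transition_integrable[OF f] by simp
  let ?F = "\<lambda>t \<xi>. of_real (f (\<xi> + a * t)) * cis (2 * pi * x * \<xi>) / 2 + of_real (f (\<xi> - a * t)) * cis (2 * pi * x * \<xi>) / 2"
  have shift: "(LINT \<xi>|lborel. complex_of_real (f (\<xi> + c)) * cis (2 * pi * x * \<xi>)) = cis (- (2 * pi * x * c)) * ift (\<lambda>\<xi>. of_real (f \<xi>)) x" for c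
  proof -
    have "ift (\<lambda>\<xi>. of_real (f \<xi>)) x = \<bar>1\<bar> *\<^sub>R (LINT \<xi>|lborel. complex_of_real (f (c + 1 * \<xi>)) * cis (2 * pi * x * (c + 1 * \<xi>)))"
      unfolding ift_def by (rule lborel_integral_real_affine) simp
    also have "\<dots> = (LINT \<xi>|lborel. cis (2 * pi * x * c) * (complex_of_real (f (\<xi> + c)) * cis (2 * pi * x * \<xi>)))"
      by (simp add: cis_mult[symmetric] algebra_simps)
    also have "\<dots> = cis (2 * pi * x * c) * (LINT \<xi>|lborel. (complex_of_real (f (\<xi> + c)) * cis (2 * pi * x * \<xi>)))"
      by simp
    finally show ?thesis by (simp add: mult.assoc[symmetric] cis_mult)
  qed
  have sint: "integrable lborel (\<lambda>\<xi>. complex_of_real (f (\<xi> + c)) * cis (2 * pi * x * \<xi>))" for c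
  proof (rule integrable_mult_cis)
    show "integrable lborel (\<lambda>\<xi>. complex_of_real (f (\<xi> + c)))"
      using lborel_integrable_real_affine[OF fint, of 1 c] by (simp add: add.commute)
  qed simp
  have "ift (\<lambda>\<xi>. of_real (avg a f \<xi>)) x = (LINT \<xi>|lborel. LINT t|U01. ?F t \<xi>)"
    unfolding ift_def avg_def
    by (simp only: integral_mult_left_zero[symmetric] integral_complex_of_real[symmetric])
       (simp add: field_simps)
  also have "\<dots> = (LINT t|U01. LINT \<xi>|lborel. ?F t \<xi>)"
  proof (rule Fubini_integral)
    show "integrable (U01 \<Otimes>\<^sub>M lborel) (\<lambda>(t, \<xi>). ?F t \<xi>)"
    proof (rule Fubini_integrable)
      \<comment> \<open>A translate has the same L1 norm, so the inner integral is bounded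
        independently of t and hence integrable over the probability space
        \<open>U01\<close>.\<close>
      have b: "(LINT y|lborel. norm (case (t, y) of (t, \<xi>) \<Rightarrow> ?F t \<xi>)) \<le> (LINT \<xi>|lborel. cmod (of_real (f \<xi>)))" for t
      proof -
        have "(LINT y|lborel. norm (case (t, y) of (t, \<xi>) \<Rightarrow> ?F t \<xi>)) \<le> 
           (LINT y|lborel. f (y + a * t) / 2 + f (y + (- a * t)) / 2)"
        proof (rule integral_mono)
          fix y
          have "norm (?F t y) \<le> norm (of_real (f (y + a * t)) * cis (2 * pi * x * y) / 2)
               + norm (of_real (f (y - a * t)) * cis (2 * pi * x * y) / 2)" by (rule norm_triangle_ineq)
          thus "norm (case (t, y) of (t, \<xi>) \<Rightarrow> ?F t \<xi>) \<le> f (y + a * t) / 2 + f (y + (- a * t)) / 2"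
            using transitionD(1)[OF f] by (simp add: norm_mult)
        next
          show "integrable lborel (\<lambda>y. norm (case (t, y) of (t, \<xi>) \<Rightarrow> ?F t \<xi>))"
            using sint[of "a*t"] sint[of "- a*t"] by simp
          show "integrable lborel (\<lambda>y. f (y + a * t) / 2 + f (y + (- a * t)) / 2)"
            using lborel_integrable_real_affine[OF transition_integrable[OF f], of 1 "a*t"]
              lborel_integrable_real_affine[OF transition_integrable[OF f], of 1 "-a*t"]
            by (simp add: add.commute)
        qed
        also have "\<dots> = (LINT y|lborel. f (a * t + 1 * y)) / 2 + (LINT y|lborel. f (- a * t + 1 * y)) / 2"
            using lborel_integrable_real_affine[OF transition_integrable[OF f], of 1 "a*t"]
              lborel_integrable_real_affine[OF transition_integrable[OF f], of 1 "-a*t"]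
            by (subst Bochner_Integration.integral_add) (auto simp: add.commute)
        also have "\<dots> = (LINT y|lborel. f y)"
          using lborel_integral_real_affine[of 1 f "a*t"] lborel_integral_real_affine[of 1 f "-a*t"] by simp
        also have "\<dots> = (LINT \<xi>|lborel. cmod (of_real (f \<xi>)))" using transitionD(1)[OF f] by simp
        finally show ?thesis .
      qed
      show "integrable U01 (\<lambda>t. LINT y|lborel. norm (case (t, y) of (t, \<xi>) \<Rightarrow> ?F t \<xi>))"
        by (rule integrable_U01[where B="LINT \<xi>|lborel. cmod (of_real (f \<xi>))"])
           (use b in \<open>auto intro!: borel_measurable_lebesgue_integral simp: split_beta'\<close>)
      show "AE t in U01. integrable lborel (\<lambda>y. case (t, y) of (t, \<xi>) \<Rightarrow> ?F t \<xi>)"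
        using sint[of "a*_"] sint[of "- a*_"] by simp
    qed measurable
  qed
  also have "\<dots> = (LINT t|U01. of_real (cos (2 * pi * a * x * t)) * ift (\<lambda>\<xi>. of_real (f \<xi>)) x)"
  proof (rule Bochner_Integration.integral_cong[OF refl])
    fix t
    have "(LINT \<xi>|lborel. ?F t \<xi>) = (cis (- (2 * pi * x * (a * t))) * ift (\<lambda>\<xi>. of_real (f \<xi>)) x
       + cis (- (2 * pi * x * (- a * t))) * ift (\<lambda>\<xi>. of_real (f \<xi>)) x) / 2"
      using shift[of "a*t"] shift[of "-a*t"] sint[of "a*t"] sint[of "-a*t"]
      by (subst Bochner_Integration.integral_add) (auto simp: add_divide_distrib)
    also have "\<dots> = (cis (- (2 * pi * a * x * t)) + cis (2 * pi * a * x * t)) / 2 * ift (\<lambda>\<xi>. of_real (f \<xi>)) x"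
      by (simp add: algebra_simps add_divide_distrib)
    also have "(cis (- (2 * pi * a * x * t)) + cis (2 * pi * a * x * t)) / 2 = of_real (cos (2 * pi * a * x * t))"
      by (simp add: complex_eq_iff)
    finally show "(LINT \<xi>|lborel. ?F t \<xi>) = of_real (cos (2 * pi * a * x * t)) * ift (\<lambda>\<xi>. of_real (f \<xi>)) x" .
  qed
  finally show ?thesis by (simp only: integral_mult_left_zero integral_complex_of_real)
qed

lemma norm_ift_avg_le:
  assumes f: "transition r f" and "a > 0" "x \<noteq> 0"
  shows "cmod (ift (\<lambda>\<xi>. of_real (avg a f \<xi>)) x)
           \<le> min 1 (1 / (2 * pi * a * \<bar>x\<bar>)) * cmod (ift (\<lambda>\<xi>. of_real (f \<xi>)) x)"
  using integral_cos_U01_le[of "2 * pi * a * x"] assms(2,3)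
  by (auto simp: ift_avg[OF f] norm_mult abs_mult intro!: mult_right_mono)

text \<open>Slope 6 makes the ramp 1/6 wide, that is, of half-width 1/12. The other 1/12 is left to
  the averages.\<close>

definition trapezoid :: "real \<Rightarrow> real" where
  "trapezoid \<xi> = max 0 (min 1 (1/2 + 6 * (1/2 - \<bar>\<xi>\<bar>)))"

lemma transition_trapezoid: "transition (1/12) trapezoid"
  unfolding transition_def trapezoid_def by (auto simp: max_def min_def abs_if)

primrec smoothed :: "(nat \<Rightarrow> real) \<Rightarrow> nat \<Rightarrow> real \<Rightarrow> real" where
  "smoothed a 0 = trapezoid"
| "smoothed a (Suc k) = avg (a k) (smoothed a k)"

lemma transition_smoothed:
  assumes "\<And>k. a k > 0"
  shows "transition (1/12 + (\<Sum>k<n. a k)) (smoothed a n)"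
proof (induction n)
  case (Suc n)
  from transition_avg[OF Suc, of "a n"] assms[of n] show ?case by (simp add: add_ac less_imp_le)
qed (use transition_trapezoid in auto)

text \<open>Averages beyond the m-th have multipliers of modulus at most 1, so the bound is uniform
  in n and will survive the limit. The leading 2 bounds the L1 norm of the trapezoid.\<close>

lemma norm_ift_smoothed_le:
  assumes a: "\<And>k. a k > 0" and x: "x \<noteq> 0"
  shows "cmod (ift (\<lambda>\<xi>. of_real (smoothed a (m + n) \<xi>)) x) \<le> 2 * (\<Prod>k<m. min 1 (1 / (2 * pi * a k * \<bar>x\<bar>)))"
proof -
  have step: "cmod (ift (\<lambda>\<xi>. of_real (smoothed a (Suc k) \<xi>)) x)
      \<le> min 1 (1 / (2 * pi * a k * \<bar>x\<bar>)) * cmod (ift (\<lambda>\<xi>. of_real (smoothed a k \<xi>)) x)" for k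
    using norm_ift_avg_le[OF transition_smoothed[where a=a and n=k, OF a] a x, of k] by simp
  have 1: "cmod (ift (\<lambda>\<xi>. of_real (smoothed a m \<xi>)) x) \<le> 2 * (\<Prod>k<m. min 1 (1 / (2 * pi * a k * \<bar>x\<bar>)))"
  proof (induction m)
    case 0
    have "cmod (ift (\<lambda>\<xi>. of_real (trapezoid \<xi>)) x) \<le> (LINT \<xi>|lborel. cmod (complex_of_real (trapezoid \<xi>)))"
      using transition_integrable[OF transition_trapezoid] by (intro norm_ift_le) simp
    thus ?case using transition_integral_le[OF transition_trapezoid] by simp
  next
    case (Suc m)
    have "0 \<le> min 1 (1 / (2 * pi * a m * \<bar>x\<bar>))" using a[of m] by simp
    from order_trans[OF step mult_left_mono[OF Suc this]] show ?case by (simp add: mult_ac)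
  qed
  show ?thesis
  proof (induction n)
    case (Suc n)
    have "cmod (ift (\<lambda>\<xi>. of_real (smoothed a (Suc (m + n)) \<xi>)) x) \<le> 1 * cmod (ift (\<lambda>\<xi>. of_real (smoothed a (m + n) \<xi>)) x)"
      by (rule order_trans[OF step]) (rule mult_right_mono, auto)
    with Suc show ?case by simp
  qed (use 1 in simp)
qed

text \<open>The increments of the iterates are at most 6 \<open>a k\<close>, so the iterates
  converge, and every clause of \<open>transition\<close> is closed under pointwise limits. The
  transforms converge by dominated convergence on [-1, 1], which keeps the product bound for each
  finite m; m may then be chosen depending on x.\<close>

lemma cutoff_exists:
  assumes a: "\<And>k. a k > 0" and s: "summable a" and s12: "suminf a \<le> 1/12"
  shows "\<exists>\<kappa>. transition (1/6) \<kappa> \<and>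
    (\<forall>x m. x \<noteq> 0 \<longrightarrow> cmod (ift (\<lambda>\<xi>. of_real (\<kappa> \<xi>)) x) \<le> 2 * (\<Prod>k<m. min 1 (1 / (2 * pi * a k * \<bar>x\<bar>))))"
proof -
  let ?f = "smoothed a"
  have part: "(\<Sum>k<n. a k) \<le> 1/12" for n
    using sum_le_suminf[OF s, of "{..<n}"] less_imp_le[OF a] s12 by (auto intro: order_trans)
  have tr: "transition (1/6) (?f n)" for n
    using transition_mono[OF transition_smoothed[where a=a and n=n, OF a], of "1/6"] part[of n] by simp
  have "convergent (\<lambda>n. ?f n \<xi>)" for \<xi>
  proof -
    have "summable (\<lambda>k. ?f (Suc k) \<xi> - ?f k \<xi>)"
    proof (rule summable_comparison_test'[of "\<lambda>k. 6 * a k" 0])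
      show "norm (?f (Suc k) \<xi> - ?f k \<xi>) \<le> 6 * a k" for k
        using avg_close[OF tr less_imp_le[OF a[of k]]] by simp
    qed (use s in auto)
    hence "convergent (\<lambda>n. ?f n \<xi> - ?f 0 \<xi>)"
      unfolding summable_iff_convergent sum_lessThan_telescope[of "\<lambda>k. ?f k \<xi>"] .
    thus ?thesis unfolding convergent_diff_const_right_iff .
  qed
  then obtain \<kappa> where lim: "\<And>\<xi>. (\<lambda>n. ?f n \<xi>) \<longlonglongrightarrow> \<kappa> \<xi>"
    unfolding convergent_def by metis
  note trD = transitionD[OF tr]
  have T: "transition (1/6) \<kappa>"
    unfolding transition_def
  proof (intro conjI allI impI)
    fix \<xi> \<eta> :: real
    show "0 \<le> \<kappa> \<xi>" by (rule LIMSEQ_le_const[OF lim]) (use trD in auto)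
    show "\<kappa> \<xi> \<le> 1" by (rule LIMSEQ_le_const2[OF lim]) (use trD in auto)
    show "\<kappa> (- \<xi>) = \<kappa> \<xi>" by (rule LIMSEQ_unique[OF lim]) (simp add: trD lim)
    have "(\<lambda>n. \<bar>?f n \<xi> - ?f n \<eta>\<bar>) \<longlonglongrightarrow> \<bar>\<kappa> \<xi> - \<kappa> \<eta>\<bar>" by (intro tendsto_intros lim)
    thus "\<bar>\<kappa> \<xi> - \<kappa> \<eta>\<bar> \<le> 6 * \<bar>\<xi> - \<eta>\<bar>" by (rule LIMSEQ_le_const2) (use trD in auto)
  next
    fix \<xi> :: real
    { assume "\<bar>\<xi>\<bar> \<le> 1/2 - 1/6" thus "\<kappa> \<xi> = 1" using lim[of \<xi>] by (simp add: trD LIMSEQ_const_iff) }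
    { assume "1/2 + 1/6 \<le> \<bar>\<xi>\<bar>" thus "\<kappa> \<xi> = 0" using lim[of \<xi>] by (simp add: trD LIMSEQ_const_iff) }
    { assume *: "\<bar>\<xi> - 1/2\<bar> \<le> 1 - 1/6"
      have "(\<lambda>n. ?f n \<xi> + ?f n (1 - \<xi>)) \<longlonglongrightarrow> \<kappa> \<xi> + \<kappa> (1 - \<xi>)" by (intro tendsto_intros lim)
      thus "\<kappa> \<xi> + \<kappa> (1 - \<xi>) = 1" using trD(7)[OF *] by (simp add: LIMSEQ_const_iff) }
  qed
  have [measurable]: "?f n \<in> borel_measurable borel" "\<kappa> \<in> borel_measurable borel" for n
    using transition_measurable[OF tr] transition_measurable[OF T] by auto
  have conv: "(\<lambda>n. ift (\<lambda>\<xi>. of_real (?f n \<xi>)) x) \<longlonglongrightarrow> ift (\<lambda>\<xi>. of_real (\<kappa> \<xi>)) x" for x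
    unfolding ift_def
  proof (rule integral_dominated_convergence[where w="indicator {-1..1::real}"])
    show "AE \<xi> in lborel. (\<lambda>n. of_real (?f n \<xi>) * cis (2 * pi * x * \<xi>)) \<longlonglongrightarrow> of_real (\<kappa> \<xi>) * cis (2 * pi * x * \<xi>)"
      by (intro AE_I2 tendsto_intros lim)
    show "AE \<xi> in lborel. norm (complex_of_real (?f n \<xi>) * cis (2 * pi * x * \<xi>)) \<le> indicator {-1..1} \<xi>" for n
    proof (intro AE_I2)
      fix \<xi>
      show "norm (complex_of_real (?f n \<xi>) * cis (2 * pi * x * \<xi>)) \<le> indicator {-1..1} \<xi>"
        using trD(1,2)[of n \<xi>] trD(6)[of \<xi> n] by (auto simp: norm_mult indicator_def abs_if split: if_splits)
    qed
  qed auto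
  have "cmod (ift (\<lambda>\<xi>. of_real (\<kappa> \<xi>)) x) \<le> 2 * (\<Prod>k<m. min 1 (1 / (2 * pi * a k * \<bar>x\<bar>)))" if "x \<noteq> 0" for x m
  proof (rule LIMSEQ_le_const2[OF tendsto_norm[OF conv]])
    show "\<exists>N. \<forall>n\<ge>N. cmod (ift (\<lambda>\<xi>. of_real (?f n \<xi>)) x) \<le> 2 * (\<Prod>k<m. min 1 (1 / (2 * pi * a k * \<bar>x\<bar>)))"
      using norm_ift_smoothed_le[where a=a and m=m, OF a that] by (metis le_add_diff_inverse)
  qed
  with T show ?thesis by blast
qed

section \<open>Weighted decay\<close>

definition submult_weight :: "(real \<Rightarrow> real) \<Rightarrow> bool" where
  "submult_weight W \<longleftrightarrow> (\<forall>x. 1 \<le> W x) \<and> (\<forall>x y. W (x + y) \<le> W x * W y)"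

definition int_inv_sq :: real where "int_inv_sq = (LINT y|lborel. 1 / (1 + \<bar>y\<bar>)\<^sup>2)"

lemma integrable_decay:
  fixes k :: "real \<Rightarrow> complex"
  assumes [measurable]: "k \<in> borel_measurable borel" and le: "\<And>y. cmod (k y) \<le> C / (1 + \<bar>y\<bar>)\<^sup>2"
  shows "integrable lborel k"
proof (rule Bochner_Integration.integrable_bound)
  show "integrable lborel (\<lambda>y. C * (1 / (1 + \<bar>y\<bar>)\<^sup>2))"
    using inverse_square_integrable by (rule integrable_mult_right)
  show "AE y in lborel. norm (k y) \<le> norm (C * (1 / (1 + \<bar>y\<bar>)\<^sup>2))"
    unfolding real_norm_def using le by (intro AE_I2 order_trans[OF _ abs_ge_self]) simp
qed simp

lemma integrable_bounded_mult:
  fixes F G :: "real \<Rightarrow> complex"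
  assumes [measurable]: "F \<in> borel_measurable borel" and F: "\<And>x. cmod (F x) \<le> B"
    and G: "integrable lborel G"
  shows "integrable lborel (\<lambda>x. F x * G x)"
proof (rule Bochner_Integration.integrable_bound)
  have [measurable]: "G \<in> borel_measurable borel" using G by auto
  show "integrable lborel (\<lambda>x. of_real B * G x)" using G by simp
  show "AE x in lborel. norm (F x * G x) \<le> norm (of_real B * G x)"
    using F by (auto intro!: AE_I2 mult_right_mono simp: norm_mult intro: order_trans[OF F])
  show "(\<lambda>x. F x * G x) \<in> borel_measurable lborel" by simp
qed

text \<open>Submultiplicativity gives W x \<le> W y * W (x - y), so convolution keeps the weight,
  and the extra (1 + |y|)^2 in the bound for F makes the remaining integral finite. The conclusion
  has no such factor; in an iteration the accumulated product therefore takes the role of G.\<close>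

lemma norm_ift_mult_le:
  assumes W: "submult_weight W"
    and F: "integrable lborel F" "continuous_on UNIV F" "\<And>x. cmod (F x) \<le> B"
    and kF: "\<And>y. cmod (ift F y) \<le> C1 / ((1 + \<bar>y\<bar>)\<^sup>2 * W y)"
    and G: "integrable lborel G" and kG: "\<And>x. cmod (ift G x) \<le> C2 / W x"
  shows "cmod (ift (\<lambda>\<xi>. F \<xi> * G \<xi>) x) \<le> C1 * int_inv_sq * C2 / W x"
proof -
  have W1: "1 \<le> W x" "0 < W x" and Wsub: "W (x + y) \<le> W x * W y" for x y
    using W unfolding submult_weight_def by (auto intro: less_le_trans[OF zero_less_one])
  have [measurable]: "F \<in> borel_measurable borel" "G \<in> borel_measurable borel"
    using F(1) G by auto
  have C1: "0 \<le> C1" using order_trans[OF norm_ge_zero kF[of 0]] W1(2)[of 0] by (simp add: zero_le_divide_iff)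
  have C2: "0 \<le> C2" using order_trans[OF norm_ge_zero kG[of 0]] W1(2)[of 0] by (simp add: zero_le_divide_iff)
  have kint: "integrable lborel (ift F)"
  proof (rule integrable_decay)
    show "cmod (ift F y) \<le> C1 / (1 + \<bar>y\<bar>)\<^sup>2" for y
      by (rule order_trans[OF kF divide_left_mono])
         (use C1 W1[of y] in \<open>auto intro!: mult_pos_pos mult_right_mono[of 1 "W y", simplified] simp: mult_le_cancel_left1 add_pos_nonneg\<close>)
  qed simp
  have pt: "cmod (ift F y * ift G (x - y)) \<le> C1 * C2 / W x * (1 / (1 + \<bar>y\<bar>)\<^sup>2)" for y
  proof -
    have "cmod (ift F y * ift G (x - y)) \<le> (C1 / ((1 + \<bar>y\<bar>)\<^sup>2 * W y)) * (C2 / W (x - y))"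
      unfolding norm_mult using kF kG C1 W1(2)[of y] by (intro mult_mono) auto
    also have "\<dots> = (C1 * C2 / (1 + \<bar>y\<bar>)\<^sup>2) / (W y * W (x - y))" by simp
    also have "\<dots> \<le> (C1 * C2 / (1 + \<bar>y\<bar>)\<^sup>2) / W x"
      using Wsub[of y "x - y"] W1(2) C1 C2 by (intro divide_left_mono) auto
    finally show ?thesis by (simp add: field_simps)
  qed
  have "cmod (ift (\<lambda>\<xi>. F \<xi> * G \<xi>) x) \<le> (LINT y|lborel. cmod (ift F y * ift G (x - y)))"
    unfolding ift_mult_convolution[OF F kint G] by (rule integral_norm_bound)
  also have "\<dots> \<le> (LINT y|lborel. C1 * C2 / W x * (1 / (1 + \<bar>y\<bar>)\<^sup>2))"
  proof (rule integral_mono)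
    show i: "integrable lborel (\<lambda>y. C1 * C2 / W x * (1 / (1 + \<bar>y\<bar>)\<^sup>2))"
      using inverse_square_integrable by (rule integrable_mult_right)
    show "integrable lborel (\<lambda>y. cmod (ift F y * ift G (x - y)))"
    proof (rule Bochner_Integration.integrable_bound[OF i])
      show "AE y in lborel. norm (cmod (ift F y * ift G (x - y))) \<le> norm (C1 * C2 / W x * (1 / (1 + \<bar>y\<bar>)\<^sup>2))"
        unfolding real_norm_def abs_norm_cancel using pt by (intro AE_I2 order_trans[OF pt abs_ge_self])
    qed simp
  qed (rule pt)
  also have "\<dots> = C1 * C2 / W x * int_inv_sq"
    unfolding int_inv_sq_def by (rule integral_mult_right_zero)
  finally show ?thesis by (simp add: mult_ac)
qed

text \<open>Each further factor F costs the same constant C1 * \<open>int_inv_sq\<close>, so the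
  bounds grow only geometrically in n.\<close>

lemma norm_ift_power_mult_le:
  assumes W: "submult_weight W"
    and F: "integrable lborel F" "continuous_on UNIV F" "\<And>x. cmod (F x) \<le> B"
    and kF: "\<And>y. cmod (ift F y) \<le> C1 / ((1 + \<bar>y\<bar>)\<^sup>2 * W y)"
    and G: "integrable lborel G" and kG: "\<And>x. cmod (ift G x) \<le> C2 / W x"
  shows "integrable lborel (\<lambda>\<xi>. F \<xi> ^ n * G \<xi>) \<and>
         (\<forall>x. cmod (ift (\<lambda>\<xi>. F \<xi> ^ n * G \<xi>) x) \<le> (C1 * int_inv_sq) ^ n * C2 / W x)"
proof (induction n)
  case 0 show ?case using G kG by simp
next
  case (Suc n)
  have [measurable]: "F \<in> borel_measurable borel" using F(1) by auto
  have "integrable lborel (\<lambda>\<xi>. F \<xi> * (F \<xi> ^ n * G \<xi>))"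
    by (rule integrable_bounded_mult[OF _ F(3)]) (use Suc in auto)
  moreover have "cmod (ift (\<lambda>\<xi>. F \<xi> * (F \<xi> ^ n * G \<xi>)) x) \<le> C1 * int_inv_sq * ((C1 * int_inv_sq) ^ n * C2) / W x" for x
    using Suc by (intro norm_ift_mult_le[OF W F kF]) auto
  ultimately show ?case by (simp add: mult.assoc)
qed

lemma int_inv_sq_nonneg: "0 \<le> int_inv_sq"
  unfolding int_inv_sq_def by simp

text \<open>The geometric growth in the number of factors is absorbed by the coefficients of an
  entire function h. The factor G supplies integrability: where f vanishes, h (f \<xi>) equals h 0,
  which need not be 0.\<close>

lemma norm_ift_power_series_le:
  fixes f :: "real \<Rightarrow> real" and a :: "nat \<Rightarrow> real"
  assumes W: "submult_weight W"
    and f: "integrable lborel f" "continuous_on UNIV f" "\<And>x. \<bar>f x\<bar> \<le> 1"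
    and kf: "\<And>y. cmod (ift (\<lambda>\<xi>. of_real (f \<xi>)) y) \<le> C1 / ((1 + \<bar>y\<bar>)\<^sup>2 * W y)"
    and G: "integrable lborel G" and kG: "\<And>x. cmod (ift G x) \<le> C2 / W x"
    and h: "\<And>y. (\<lambda>n. a n * y ^ n) sums h y"
  shows "\<exists>C. \<forall>x. cmod (ift (\<lambda>\<xi>. of_real (h (f \<xi>)) * G \<xi>) x) \<le> C / W x"
proof -
  let ?F = "\<lambda>\<xi>. complex_of_real (f \<xi>)"
  define M where "M = C1 * int_inv_sq"
  have W1: "0 < W x" for x using W unfolding submult_weight_def by (auto intro: less_le_trans[OF zero_less_one])
  have C1: "0 \<le> C1" using order_trans[OF norm_ge_zero kf[of 0]] W1[of 0] by (simp add: zero_le_divide_iff)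
  have M0: "0 \<le> M" using C1 int_inv_sq_nonneg by (simp add: M_def)
  have F: "integrable lborel ?F" "continuous_on UNIV ?F" "\<And>x. cmod (?F x) \<le> 1"
    using f by (auto intro!: continuous_intros)
  have [measurable]: "f \<in> borel_measurable borel" "G \<in> borel_measurable borel" using f(1) G by auto
  note P = norm_ift_power_mult_le[OF W F kf G kG, folded M_def]
  \<comment> \<open>Convergence of the power series at r + 1 forces absolute convergence at
    r.\<close>
  have sa: "summable (\<lambda>n. \<bar>a n\<bar> * r ^ n)" if "r \<ge> 0" for r
  proof -
    have "summable (\<lambda>n. norm (a n * r ^ n))"
      by (rule powser_insidea[of a "r + 1"]) (use h that in \<open>auto simp: sums_iff\<close>)
    thus ?thesis using that by (simp add: abs_mult)
  qed
  let ?t = "\<lambda>n \<xi>. of_real (a n) * (?F \<xi> ^ n * G \<xi>)"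
  have tle: "cmod (?t n \<xi>) \<le> \<bar>a n\<bar> * cmod (G \<xi>)" for n \<xi>
    using f(3)[of \<xi>] by (simp add: norm_mult norm_power power_le_one mult_left_le_one_le mult_left_mono)
  have "cmod (ift (\<lambda>\<xi>. of_real (h (f \<xi>)) * G \<xi>) x) \<le> (\<Sum>n. \<bar>a n\<bar> * M ^ n) * C2 / W x" for x
  proof -
    have hs: "(\<Sum>n. ?t n \<xi> * cis (2 * pi * x * \<xi>)) = of_real (h (f \<xi>)) * G \<xi> * cis (2 * pi * x * \<xi>)" for \<xi>
    proof -
      have "(\<lambda>n. of_real (a n * f \<xi> ^ n) * (G \<xi> * cis (2 * pi * x * \<xi>))) sums
          (of_real (h (f \<xi>)) * (G \<xi> * cis (2 * pi * x * \<xi>)))"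
        by (intro sums_mult2 sums_of_real h)
      thus ?thesis by (simp add: sums_iff mult_ac)
    qed
    have int: "integrable lborel (\<lambda>\<xi>. ?t n \<xi> * cis (2 * pi * x * \<xi>))" for n
      using P by (intro integrable_mult_cis integrable_mult_right) auto
    have s1: "summable (\<lambda>n. LINT \<xi>|lborel. cmod (?t n \<xi> * cis (2 * pi * x * \<xi>)))"
    proof (rule summable_comparison_test'[of "\<lambda>n. \<bar>a n\<bar> * 1 ^ n * (LINT \<xi>|lborel. cmod (G \<xi>))" 0])
      show "summable (\<lambda>n. \<bar>a n\<bar> * 1 ^ n * (LINT \<xi>|lborel. cmod (G \<xi>)))"
        by (rule summable_mult2[OF sa]) simp
      fix n
      have "(LINT \<xi>|lborel. cmod (?t n \<xi> * cis (2 * pi * x * \<xi>))) \<le> (LINT \<xi>|lborel. \<bar>a n\<bar> * cmod (G \<xi>))"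
      proof (rule integral_mono)
        show "cmod (?t n \<xi> * cis (2 * pi * x * \<xi>)) \<le> \<bar>a n\<bar> * cmod (G \<xi>)" for \<xi>
          using tle[of n \<xi>] by (simp add: norm_mult)
      qed (use integrable_norm[OF int[of n]] G in auto)
      thus "norm (LINT \<xi>|lborel. cmod (?t n \<xi> * cis (2 * pi * x * \<xi>))) \<le> \<bar>a n\<bar> * 1 ^ n * (LINT \<xi>|lborel. cmod (G \<xi>))"
        by simp
    qed
    have "(\<lambda>n. LINT \<xi>|lborel. ?t n \<xi> * cis (2 * pi * x * \<xi>)) sums (LINT \<xi>|lborel. (\<Sum>n. ?t n \<xi> * cis (2 * pi * x * \<xi>)))"
    proof (rule sums_integral[OF int _ s1], intro AE_I2)
      fix \<xi>
      show "summable (\<lambda>n. norm (?t n \<xi> * cis (2 * pi * x * \<xi>)))"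
        by (rule summable_comparison_test'[of "\<lambda>n. \<bar>a n\<bar> * cmod (G \<xi>)" 0])
           (use tle[of _ \<xi>] sa[of 1] in \<open>auto intro!: summable_mult2 simp: norm_mult\<close>)
    qed
    moreover have "(LINT \<xi>|lborel. ?t n \<xi> * cis (2 * pi * x * \<xi>)) = of_real (a n) * ift (\<lambda>\<xi>. ?F \<xi> ^ n * G \<xi>) x" for n
      unfolding ift_def by (simp only: integral_mult_right_zero[symmetric] mult.assoc)
    ultimately have eq: "(\<lambda>n. of_real (a n) * ift (\<lambda>\<xi>. ?F \<xi> ^ n * G \<xi>) x) sums ift (\<lambda>\<xi>. of_real (h (f \<xi>)) * G \<xi>) x"
      unfolding hs ift_def[of "\<lambda>\<xi>. of_real (h (f \<xi>)) * G \<xi>"] by simp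
    have le: "cmod (of_real (a n) * ift (\<lambda>\<xi>. ?F \<xi> ^ n * G \<xi>) x) \<le> \<bar>a n\<bar> * M ^ n * (C2 / W x)" for n
    proof -
      have "\<bar>a n\<bar> * cmod (ift (\<lambda>\<xi>. ?F \<xi> ^ n * G \<xi>) x) \<le> \<bar>a n\<bar> * (M ^ n * C2 / W x)"
        using P[of n] by (intro mult_left_mono) auto
      thus ?thesis by (simp add: norm_mult mult.assoc)
    qed
    have sM: "summable (\<lambda>n. \<bar>a n\<bar> * M ^ n * (C2 / W x))" by (rule summable_mult2[OF sa[OF M0]])
    have "cmod (\<Sum>n. of_real (a n) * ift (\<lambda>\<xi>. ?F \<xi> ^ n * G \<xi>) x) \<le> (\<Sum>n. \<bar>a n\<bar> * M ^ n * (C2 / W x))"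
      by (rule norm_suminf_le[OF le sM])
    also have "\<dots> = (\<Sum>n. \<bar>a n\<bar> * M ^ n) * (C2 / W x)"
      by (rule suminf_mult2[symmetric, OF sa[OF M0]])
    finally show ?thesis using eq by (simp add: sums_iff)
  qed
  thus ?thesis by blast
qed

text \<open>Passing from \<open>T\<close> to its running maximum makes the weight monotone without destroying subadditivity,
  so monotonicity of \<open>y / \<Theta> y\<close> need not be checked.\<close>

definition envelope :: "(real \<Rightarrow> real) \<Rightarrow> real \<Rightarrow> real" where
  "envelope T x = Sup (T ` {0..\<bar>x\<bar>})"

lemma
  assumes T: "\<And>y. 0 \<le> y \<Longrightarrow> 0 \<le> T y" "\<And>y. 0 \<le> y \<Longrightarrow> T y \<le> c * y" and c: "0 \<le> c"
  shows envelope_upper: "0 \<le> y \<Longrightarrow> y \<le> \<bar>x\<bar> \<Longrightarrow> T y \<le> envelope T x"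
    and envelope_least: "(\<And>y. 0 \<le> y \<Longrightarrow> y \<le> \<bar>x\<bar> \<Longrightarrow> T y \<le> B) \<Longrightarrow> envelope T x \<le> B"
    and envelope_nonneg: "0 \<le> envelope T x"
    and envelope_mono: "\<bar>x\<bar> \<le> \<bar>x'\<bar> \<Longrightarrow> envelope T x \<le> envelope T x'"
proof -
  have bdd: "bdd_above (T ` {0..\<bar>x\<bar>})" for x
  proof (intro bdd_aboveI[of _ "c * \<bar>x\<bar>"])
    fix z assume "z \<in> T ` {0..\<bar>x\<bar>}"
    then obtain y where y: "z = T y" "0 \<le> y" "y \<le> \<bar>x\<bar>" by auto
    thus "z \<le> c * \<bar>x\<bar>" using T(2)[of y] mult_left_mono[OF y(3) c] by simp
  qed
  show up: "T y \<le> envelope T x" if "0 \<le> y" "y \<le> \<bar>x\<bar>" for y x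
    unfolding envelope_def using that by (intro cSup_upper bdd) auto
  show "envelope T x \<le> B" if "\<And>y. 0 \<le> y \<Longrightarrow> y \<le> \<bar>x\<bar> \<Longrightarrow> T y \<le> B"
    unfolding envelope_def using that by (intro cSup_least) auto
  show "0 \<le> envelope T x" using up[of 0 x] T(1)[of 0] by simp
  show "envelope T x \<le> envelope T x'" if "\<bar>x\<bar> \<le> \<bar>x'\<bar>"
    unfolding envelope_def[of T x] using that up by (intro cSup_least) auto
qed

lemma envelope_subadditive:
  assumes T: "\<And>y. 0 \<le> y \<Longrightarrow> 0 \<le> T y" "\<And>y. 0 \<le> y \<Longrightarrow> T y \<le> c * y" and c: "0 \<le> c"
    and sub: "\<And>y z. 0 \<le> y \<Longrightarrow> 0 \<le> z \<Longrightarrow> T (y + z) \<le> T y + T z"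
  shows "envelope T (x + x') \<le> envelope T x + envelope T x'"
proof (rule envelope_least[OF T c])
  fix y assume y: "0 \<le> y" "y \<le> \<bar>x + x'\<bar>"
  \<comment> \<open>Cutting y at |x| puts one part into [0, |x|] and the other into
    [0, |x'|].\<close>
  define u where "u = min y \<bar>x\<bar>"
  have u: "0 \<le> u" "u \<le> \<bar>x\<bar>" "0 \<le> y - u" "y - u \<le> \<bar>x'\<bar>" using y unfolding u_def by auto
  have "T y \<le> T u + T (y - u)" using sub[of u "y - u"] u by simp
  also have "\<dots> \<le> envelope T x + envelope T x'"
    using u by (intro add_mono envelope_upper[OF T c]) auto
  finally show "T y \<le> envelope T x + envelope T x'" .
qed

section \<open>Examples of submultiplicative weights\<close>

lemma submult_weight_poly: "submult_weight (\<lambda>x. (1 + \<bar>x\<bar>)\<^sup>2)"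
proof -
  have "(1 + \<bar>x + y\<bar>)\<^sup>2 \<le> ((1 + \<bar>x\<bar>) * (1 + \<bar>y\<bar>))\<^sup>2" for x y :: real
  proof (rule power_mono)
    have "1 + \<bar>x + y\<bar> + 0 \<le> 1 + (\<bar>x\<bar> + \<bar>y\<bar>) + \<bar>x\<bar> * \<bar>y\<bar>"
      by (intro add_mono abs_triangle_ineq) auto
    thus "1 + \<bar>x + y\<bar> \<le> (1 + \<bar>x\<bar>) * (1 + \<bar>y\<bar>)" by (simp add: algebra_simps)
  qed simp
  thus ?thesis unfolding submult_weight_def by (auto simp: power_mult_distrib)
qed

lemma submult_weight_mult:
  assumes "submult_weight V" "submult_weight W"
  shows "submult_weight (\<lambda>x. V x * W x)"
proof -
  have V: "1 \<le> V x" "V (x + y) \<le> V x * V y" and W: "1 \<le> W x" "W (x + y) \<le> W x * W y" for x y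
    using assms unfolding submult_weight_def by auto
  have "1 \<le> V x * W x" for x using mult_mono[OF V(1) W(1), of x x] V(1)[of x] by simp
  moreover have "V (x + y) * W (x + y) \<le> (V x * W x) * (V y * W y)" for x y
  proof -
    have "V (x + y) * W (x + y) \<le> (V x * V y) * (W x * W y)"
      using V W by (intro mult_mono mult_nonneg_nonneg) (auto intro: order_trans[OF zero_le_one])
    thus ?thesis by (simp add: mult_ac)
  qed
  ultimately show ?thesis unfolding submult_weight_def by blast
qed

lemma submult_weight_envelope:
  assumes T: "\<And>y. 0 \<le> y \<Longrightarrow> 0 \<le> T y" "\<And>y. 0 \<le> y \<Longrightarrow> T y \<le> c * y" and c: "0 \<le> c"
    and sub: "\<And>y z. 0 \<le> y \<Longrightarrow> 0 \<le> z \<Longrightarrow> T (y + z) \<le> T y + T z"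
  shows "submult_weight (\<lambda>x. exp (envelope T x))"
  using envelope_nonneg[OF T c] envelope_subadditive[OF T c sub]
  unfolding submult_weight_def by (auto simp flip: exp_add)

text \<open>Since \<open>\<kappa> u \<noteq> 0\<close> forces \<open>\<kappa> (u / 2) = 1\<close> for the cutoffs in use, this is the usual Meyer bell; the product
  form avoids case distinctions and square roots.\<close>

definition bell :: "(real \<Rightarrow> real) \<Rightarrow> real \<Rightarrow> real" where
  "bell \<kappa> u = cos (pi/2 * \<kappa> u) * sin (pi/2 * \<kappa> (u / 2))"

section \<open>Decay of the bell\<close>

lemma cos_power_series: "(\<lambda>n. (cos_coeff n * t ^ n) * y ^ n) sums cos (t * y)" for t y :: real
  using cos_converges[of "t * y"] by (simp add: power_mult_distrib mult_ac)

text \<open>\<open>norm_ift_power_series_le\<close> asks for an integrable factor beside the power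
  series. The sine vanishes at 0, so one power of its argument splits off and the cutoff itself
  becomes that factor.\<close>

lemma sin_quotient_power_series:
  fixes t :: real
  shows "\<exists>h. (\<forall>y. (\<lambda>n. (sin_coeff (Suc n) * t ^ Suc n) * y ^ n) sums h y) \<and> (\<forall>y. sin (t * y) = h y * y)"
proof -
  have s: "(\<lambda>n. (sin_coeff (Suc n) * t ^ Suc n) * y ^ n * y) sums sin (t * y)" for y
  proof -
    have "(\<lambda>n. (sin_coeff n * t ^ n) * y ^ n) sums sin (t * y)"
      using sin_converges[of "t * y"] by (simp add: power_mult_distrib mult_ac)
    hence "(\<lambda>n. (sin_coeff (Suc n) * t ^ Suc n) * y ^ Suc n) sums sin (t * y)"
      by (subst sums_Suc_iff) simp
    moreover have "y ^ Suc n = y ^ n * y" for n by simp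
    ultimately show ?thesis by (simp only: mult.assoc)
  qed
  have sm: "summable (\<lambda>n. (sin_coeff (Suc n) * t ^ Suc n) * y ^ n)" for y
  proof (cases "y = 0")
    case False
    have "summable (\<lambda>n. (sin_coeff (Suc n) * t ^ Suc n) * y ^ n * y * inverse y)"
      by (rule summable_mult2[OF sums_summable[OF s]])
    moreover have "c * y * inverse y = c" for c using False by simp
    ultimately show ?thesis by (simp only:)
  next
    case True
    show ?thesis unfolding True by (rule summable_finite[of "{0}"]) auto
  qed
  define h where "h y = (\<Sum>n. (sin_coeff (Suc n) * t ^ Suc n) * y ^ n)" for y
  have hs: "(\<lambda>n. (sin_coeff (Suc n) * t ^ Suc n) * y ^ n) sums h y" for y
    unfolding h_def by (rule summable_sums[OF sm])
  have "sin (t * y) = h y * y" for y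
    by (rule sums_unique2[OF s sums_mult2[OF hs]])
  with hs show ?thesis by (intro exI[of _ h] conjI allI)
qed

text \<open>The fourth power is spent in halves: with W = (1 + |x|)^2 V the cutoff decays like 1 /
  ((1 + |x|)^2 W), where the square in front makes the convolutions converge and the one inside W
  survives. The sine is treated before the cosine because it has compact support and so supplies the
  integrable factor for the cosine series.\<close>

lemma bell_decay:
  assumes V: "submult_weight V" and Vmono: "\<And>x y. \<bar>x\<bar> \<le> \<bar>y\<bar> \<Longrightarrow> V x \<le> V y"
    and \<kappa>: "transition (1/6) \<kappa>"
    and k: "\<And>x. cmod (ift (\<lambda>\<xi>. of_real (\<kappa> \<xi>)) x) \<le> C / ((1 + \<bar>x\<bar>) ^ 4 * V x)"
  shows "\<exists>C'. \<forall>x. cmod (ift (\<lambda>\<xi>. of_real (bell \<kappa> \<xi>)) x) \<le> C' / ((1 + \<bar>x\<bar>)\<^sup>2 * V x)"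
proof -
  define W where "W x = (1 + \<bar>x\<bar>)\<^sup>2 * V x" for x
  have W: "submult_weight W" unfolding W_def by (rule submult_weight_mult[OF submult_weight_poly V])
  have V0: "0 < V x" for x using V unfolding submult_weight_def by (auto intro: less_le_trans[OF zero_less_one])
  have W0: "0 < W x" for x using W unfolding submult_weight_def by (auto intro: less_le_trans[OF zero_less_one])
  have pow4: "(1 + \<bar>x\<bar>) ^ 4 * V x = (1 + \<bar>x\<bar>)\<^sup>2 * W x" for x
    unfolding W_def by (simp add: mult.assoc[symmetric] power_add[symmetric])
  have C0: "0 \<le> C" using order_trans[OF norm_ge_zero k[of 0]] V0[of 0] by (simp add: zero_le_divide_iff)
  define g where "g \<xi> = \<kappa> (\<xi> / 2)" for \<xi>
  have cont: "continuous_on UNIV \<kappa>" "continuous_on UNIV g"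
    using transition_continuous[OF \<kappa>] unfolding g_def
    by (auto intro!: continuous_on_compose2[OF transition_continuous[OF \<kappa>]] continuous_intros)
  have int: "integrable lborel \<kappa>" "integrable lborel g"
    using transition_integrable[OF \<kappa>] lborel_integrable_real_affine[OF transition_integrable[OF \<kappa>], of "1/2" 0]
    unfolding g_def by auto
  have le1: "\<bar>\<kappa> \<xi>\<bar> \<le> 1" "\<bar>g \<xi>\<bar> \<le> 1" for \<xi> using transitionD(1,2)[OF \<kappa>] unfolding g_def by auto
  have kk: "cmod (ift (\<lambda>\<xi>. of_real (\<kappa> \<xi>)) y) \<le> C / ((1 + \<bar>y\<bar>)\<^sup>2 * W y)" for y
    using k[of y] unfolding pow4 .
  \<comment> \<open>Stretching the cutoff by 2 compresses its transform: it is evaluated at 2 y,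
    where V is at least as large as at y.\<close>
  have kg: "cmod (ift (\<lambda>\<xi>. of_real (g \<xi>)) y) \<le> 2 * C / ((1 + \<bar>y\<bar>)\<^sup>2 * W y)" for y
  proof -
    have "ift (\<lambda>\<xi>. of_real (g \<xi>)) y = 2 * ift (\<lambda>\<xi>. of_real (\<kappa> \<xi>)) (2 * y)"
      using ift_scale[of "1/2" "\<lambda>\<xi>. of_real (\<kappa> \<xi>)" y] unfolding g_def by (simp add: mult.commute)
    hence "cmod (ift (\<lambda>\<xi>. of_real (g \<xi>)) y) \<le> 2 * (C / ((1 + \<bar>2 * y\<bar>) ^ 4 * V (2 * y)))"
      using k[of "2 * y"] by (simp add: norm_mult)
    also have "\<dots> \<le> 2 * (C / ((1 + \<bar>y\<bar>) ^ 4 * V y))"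
      using C0 V0 Vmono[of y "2 * y"]
      by (intro mult_left_mono divide_left_mono mult_mono power_mono mult_pos_pos) (auto simp: less_imp_le)
    finally show ?thesis by (simp add: pow4)
  qed
  have kg': "cmod (ift (\<lambda>\<xi>. of_real (g \<xi>)) y) \<le> 2 * C / W y" for y
    using order_trans[OF kg[of y] divide_left_mono[of "W y" "(1 + \<bar>y\<bar>)\<^sup>2 * W y" "2 * C"]] C0 W0[of y]
    by (simp add: add_pos_nonneg)
  obtain h where h: "\<And>y. (\<lambda>n. (sin_coeff (Suc n) * (pi/2) ^ Suc n) * y ^ n) sums h y" "\<And>y. sin (pi/2 * y) = h y * y"
    using sin_quotient_power_series[of "pi/2"] by blast
  have gint: "integrable lborel (\<lambda>\<xi>. complex_of_real (g \<xi>))" using int by simp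
  obtain C2 where C2: "\<And>x. cmod (ift (\<lambda>\<xi>. of_real (h (g \<xi>)) * of_real (g \<xi>)) x) \<le> C2 / W x"
    using norm_ift_power_series_le[OF W int(2) cont(2) le1(2) kg gint kg' h(1)] by blast
  have [measurable]: "g \<in> borel_measurable borel" using int by auto
  have sg: "of_real (h (g \<xi>)) * complex_of_real (g \<xi>) = of_real (sin (pi/2 * g \<xi>))" for \<xi>
    by (simp only: h(2) of_real_mult)
  have sint: "integrable lborel (\<lambda>\<xi>. complex_of_real (sin (pi/2 * g \<xi>)))"
  proof (intro integrable_compact_support[where B=1 and R=2])
    show "complex_of_real (sin (pi / 2 * g x)) = 0" if "2 < \<bar>x\<bar>" for x
      using transitionD(6)[OF \<kappa>, of "x/2"] that by (simp add: g_def)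
  qed auto
  obtain C3 where C3: "\<And>x. cmod (ift (\<lambda>\<xi>. of_real (cos (pi/2 * \<kappa> \<xi>)) * of_real (sin (pi/2 * g \<xi>))) x) \<le> C3 / W x"
    using norm_ift_power_series_le[OF W int(1) cont(1) le1(1) kk sint C2[unfolded sg] cos_power_series[of "pi/2"]] by blast
  thus ?thesis unfolding bell_def g_def W_def by auto
qed

text \<open>Four averages of fixed length provide the factor \<open>(1 + \<bar>x\<bar>) ^ 4\<close>; the others provide the exponential.\<close>

lemma cutoff_with_weight:
  fixes \<Theta> :: "real \<Rightarrow> real" and E \<gamma> :: real
  assumes mono: "\<And>x y. 0 \<le> x \<Longrightarrow> x \<le> y \<Longrightarrow> \<Theta> x \<le> \<Theta> y" and ge1: "\<And>x. 0 \<le> x \<Longrightarrow> 1 \<le> \<Theta> x"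
    and E: "0 \<le> E" and \<gamma>: "0 < \<gamma>" "\<gamma> \<le> 1"
    and s: "summable (\<lambda>k. \<gamma> / ((E + real (Suc k)) * \<Theta> (real (Suc k))))"
    and s1: "(\<Sum>k. \<gamma> / ((E + real (Suc k)) * \<Theta> (real (Suc k)))) \<le> 1"
  defines "T \<equiv> \<lambda>y. pi / (12 * exp 1) * \<gamma> * y / \<Theta> y"
  shows "\<exists>\<kappa> C. transition (1/6) \<kappa> \<and>
    (\<forall>x. cmod (ift (\<lambda>\<xi>. of_real (\<kappa> \<xi>)) x) \<le> C / ((1 + \<bar>x\<bar>) ^ 4 * exp (envelope T x)))"
proof -
  define \<alpha> where "\<alpha> k = \<gamma> / ((E + real (Suc k)) * \<Theta> (real (Suc k)))" for k
  \<comment> \<open>Four lengths 1/96 sum to 1/24. The others are a 24th of a series with sum at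
    most 1. Together they fit the budget 1/12 of \<open>cutoff_exists\<close>.\<close>
  define a where "a k = (if k < 4 then 1/96 else \<alpha> (k - 4) / 24)" for k :: nat
  have th0: "0 < \<Theta> x" if "0 \<le> x" for x using ge1[OF that] by linarith
  have \<alpha>0: "0 < \<alpha> k" for k unfolding \<alpha>_def using \<gamma> E th0 by (intro divide_pos_pos mult_pos_pos) auto
  have a0: "a k > 0" for k using \<alpha>0 by (simp add: a_def)
  have "(\<lambda>k. \<alpha> k / 24) sums (suminf \<alpha> / 24)"
    using s unfolding \<alpha>_def[abs_def] by (intro sums_divide summable_sums)
  hence "(\<lambda>k. a (k + 4)) sums (suminf \<alpha> / 24)" by (simp add: a_def)
  hence as: "a sums (suminf \<alpha> / 24 + (\<Sum>k<4. a k))" by (subst (asm) sums_iff_shift)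
  have "suminf \<alpha> \<le> 1" using s1 unfolding \<alpha>_def[abs_def] .
  moreover have "(\<Sum>k<4. a k) = 1/24" by (simp add: a_def)
  ultimately have "suminf a \<le> 1/12" "summable a" using as by (auto simp: sums_iff)
  then obtain \<kappa> where \<kappa>: "transition (1/6) \<kappa>"
    and k: "\<And>x m. x \<noteq> 0 \<Longrightarrow> cmod (ift (\<lambda>\<xi>. of_real (\<kappa> \<xi>)) x) \<le> 2 * (\<Prod>k<m. min 1 (1 / (2 * pi * a k * \<bar>x\<bar>)))"
    using cutoff_exists[where a=a, OF a0] by blast
  define c0 where "c0 = pi / (12 * exp 1)"
  have "exp 1 \<ge> (2::real)" using exp_ge_add_one_self[of 1] by simp
  hence c0: "0 < c0" "c0 \<le> 1" unfolding c0_def using pi_less_4 by (auto simp: field_simps)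
  have Tle: "T y \<le> y" "0 \<le> T y" if "0 \<le> y" for y
  proof -
    show "0 \<le> T y" unfolding T_def using \<gamma> th0[OF that] that by simp
    have "c0 * \<gamma> * y \<le> 1 * 1 * y" using c0 \<gamma> that by (intro mult_mono) auto
    also have "\<dots> \<le> y * \<Theta> y" using mult_left_mono[OF ge1[OF that] that] by simp
    finally show "T y \<le> y" unfolding T_def c0_def[symmetric] using th0[OF that] by (simp add: divide_le_eq)
  qed
  \<comment> \<open>The 2 is the prefactor in \<open>cutoff_exists\<close>, 17^4 comes from the four
    fixed averages, and exp (E + 1) compensates for counting only those averages with E + k + 1 < T
    y.\<close>
  define D where "D = 2 * 17 ^ 4 * exp (E + 1)"
  have D2: "2 \<le> D"
  proof -
    have "1 * 1 \<le> 17 ^ 4 * exp (E + 1)" using E by (intro mult_mono) auto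
    thus ?thesis by (simp add: D_def)
  qed
  \<comment> \<open>The estimate is needed for every y up to |x|, as \<open>envelope\<close> is a
    supremum over these y.\<close>
  have main: "cmod (ift (\<lambda>\<xi>. of_real (\<kappa> \<xi>)) x) * exp (T y) \<le> D / (1 + \<bar>x\<bar>) ^ 4"
    if x: "x \<noteq> 0" and y: "0 \<le> y" "y \<le> \<bar>x\<bar>" for x y
  proof -
    define n where "n = nat \<lceil>T y - E - 1\<rceil>"
    have n: "T y - E - 1 \<le> real n" unfolding n_def by linarith
    \<comment> \<open>Here (E + k + 1) \<Theta>(k + 1) is at most T y * \<Theta> y = c0 \<gamma> y.
      The value c0 = pi / (12 e) is the one for which a length \<gamma> / (24 c0 \<gamma> y) gives
      exactly the bound 1 / e at |x| = y.\<close>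
    have small: "min 1 (1 / (2 * pi * a (k + 4) * \<bar>x\<bar>)) \<le> exp (-1)" if "k < n" for k
    proof -
      have kT: "E + real (Suc k) < T y" using that unfolding n_def by linarith
      hence T0: "0 < T y" using E by linarith
      hence y0: "0 < y" unfolding T_def using y(1) by (cases "y = 0") auto
      have "real (Suc k) \<le> y" using kT E Tle(1)[OF y(1)] by linarith
      hence th: "\<Theta> (real (Suc k)) \<le> \<Theta> y" by (intro mono) auto
      have p: "0 < (E + real (Suc k)) * \<Theta> (real (Suc k))" using E th0 by (intro mult_pos_pos) auto
      have q: "(E + real (Suc k)) * \<Theta> (real (Suc k)) \<le> T y * \<Theta> y"
        using kT th th0[of "real (Suc k)"] T0 by (intro mult_mono) auto
      have "T y * \<Theta> y = c0 * \<gamma> * y" unfolding T_def c0_def using th0[OF y(1)] by simp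
      hence "exp 1 * ((E + real (Suc k)) * \<Theta> (real (Suc k))) \<le> exp 1 * (c0 * \<gamma> * y)"
        using q by (intro mult_left_mono) auto
      also have "\<dots> = 2 * pi * (\<gamma> / 24) * y" unfolding c0_def by simp
      also have "\<dots> \<le> 2 * pi * (\<gamma> / 24) * \<bar>x\<bar>" using y \<gamma> by (intro mult_left_mono) auto
      finally have "exp 1 \<le> 2 * pi * (\<gamma> / 24) * \<bar>x\<bar> / ((E + real (Suc k)) * \<Theta> (real (Suc k)))"
        using p by (simp add: pos_le_divide_eq)
      also have "\<dots> = 2 * pi * a (k + 4) * \<bar>x\<bar>" by (simp add: a_def \<alpha>_def)
      finally have "1 / (2 * pi * a (k + 4) * \<bar>x\<bar>) \<le> 1 / exp 1"
        by (intro divide_left_mono) (use a0 x in \<open>auto intro!: mult_pos_pos\<close>)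
      thus ?thesis by (simp add: exp_minus inverse_eq_divide min.coboundedI2)
    qed
    \<comment> \<open>96 / (2 pi) is below 16, and replacing min 1 (16 / |x|) by 17 / (1 + |x|)
      gives a form that is also finite at 0.\<close>
    have first: "min 1 (1 / (2 * pi * a k * \<bar>x\<bar>)) \<le> 17 / (1 + \<bar>x\<bar>)" if "k < 4" for k
    proof -
      have "1 / (2 * pi * a k * \<bar>x\<bar>) = (96 / (2 * pi)) / \<bar>x\<bar>" using that x by (simp add: a_def)
      also have "\<dots> \<le> 16 / \<bar>x\<bar>" using pi_gt3 by (intro divide_right_mono) (auto simp: field_simps)
      finally have "min 1 (1 / (2 * pi * a k * \<bar>x\<bar>)) \<le> min 1 (16 / \<bar>x\<bar>)" by (rule min.mono[OF order_refl])
      also have "\<dots> \<le> 17 / (1 + \<bar>x\<bar>)"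
      proof (cases "\<bar>x\<bar> \<le> 16")
        case True
        hence "1 \<le> 17 / (1 + \<bar>x\<bar>)" by (simp add: field_simps)
        thus ?thesis by linarith
      next
        case False
        hence "16 / \<bar>x\<bar> \<le> 17 / (1 + \<bar>x\<bar>)" using x by (simp add: field_simps)
        thus ?thesis by linarith
      qed
      finally show ?thesis .
    qed
    have nn: "0 \<le> min 1 (1 / (2 * pi * a k * \<bar>x\<bar>))" for k using a0[of k] by simp
    have split: "(\<Prod>k<4 + n. f k) = (\<Prod>k<4. f k) * (\<Prod>k<n. f (k + 4))" for f :: "nat \<Rightarrow> real"
      by (induction n) (simp_all only: add_Suc_right prod.lessThan_Suc mult.assoc add.commute[of _ 4], simp)
    have "(\<Prod>k<4 + n. min 1 (1 / (2 * pi * a k * \<bar>x\<bar>))) =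
        (\<Prod>k<4. min 1 (1 / (2 * pi * a k * \<bar>x\<bar>))) * (\<Prod>k<n. min 1 (1 / (2 * pi * a (k + 4) * \<bar>x\<bar>)))"
      by (rule split)
    also have "\<dots> \<le> (\<Prod>k<4::nat. 17 / (1 + \<bar>x\<bar>)) * (\<Prod>k<n. exp (-1))"
      by (intro mult_mono prod_mono prod_nonneg conjI) (use nn first small in auto)
    also have "\<dots> = (17 / (1 + \<bar>x\<bar>)) ^ 4 * exp (- real n)"
      by (simp add: exp_of_nat_mult[symmetric])
    also have "\<dots> \<le> (17 / (1 + \<bar>x\<bar>)) ^ 4 * exp (E + 1 - T y)"
      using n by (intro mult_left_mono) auto
    finally have "cmod (ift (\<lambda>\<xi>. of_real (\<kappa> \<xi>)) x) \<le> 2 * ((17 / (1 + \<bar>x\<bar>)) ^ 4 * exp (E + 1 - T y))"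
      using k[OF x, of "4 + n"] by linarith
    hence "cmod (ift (\<lambda>\<xi>. of_real (\<kappa> \<xi>)) x) * exp (T y) \<le> 2 * ((17 / (1 + \<bar>x\<bar>)) ^ 4 * exp (E + 1 - T y)) * exp (T y)"
      by (rule mult_right_mono) simp
    also have "\<dots> = D / (1 + \<bar>x\<bar>) ^ 4"
      unfolding D_def by (simp add: exp_diff power_divide)
    finally show ?thesis .
  qed
  have Tle': "T y \<le> 1 * y" if "0 \<le> y" for y using Tle[OF that] by simp
  have "cmod (ift (\<lambda>\<xi>. of_real (\<kappa> \<xi>)) x) \<le> D / ((1 + \<bar>x\<bar>) ^ 4 * exp (envelope T x))" for x
  proof (cases "ift (\<lambda>\<xi>. of_real (\<kappa> \<xi>)) x = 0")
    case True thus ?thesis using D2 by simp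
  next
    case nz: False
    let ?K = "cmod (ift (\<lambda>\<xi>. of_real (\<kappa> \<xi>)) x)"
    have K0: "0 < ?K" using nz by simp
    have le: "?K * exp (T y) \<le> D / (1 + \<bar>x\<bar>) ^ 4" if "0 \<le> y" "y \<le> \<bar>x\<bar>" for y
    proof (cases "x = 0")
      case True
      have "?K \<le> 2"
        using norm_ift_le[of "\<lambda>\<xi>. of_real (\<kappa> \<xi>)" x] transition_integrable[OF \<kappa>] transition_integral_le[OF \<kappa>] by simp
      thus ?thesis using True that D2 by (simp add: T_def)
    qed (use main that in auto)
    \<comment> \<open>A logarithm turns the bounds for the individual y into one upper bound for the
      supremum. This is why a vanishing transform value was treated separately.\<close>
    have "envelope T x \<le> ln (D / (1 + \<bar>x\<bar>) ^ 4 / ?K)"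
    proof (rule envelope_least[OF Tle(2) Tle'])
      fix y assume "0 \<le> y" "y \<le> \<bar>x\<bar>"
      from le[OF this] have "exp (T y) \<le> D / (1 + \<bar>x\<bar>) ^ 4 / ?K"
        using K0 by (simp add: pos_le_divide_eq mult_ac)
      thus "T y \<le> ln (D / (1 + \<bar>x\<bar>) ^ 4 / ?K)"
        using less_le_trans[OF exp_gt_zero] by (subst ln_ge_iff) auto
    qed auto
    hence "exp (envelope T x) \<le> exp (ln (D / (1 + \<bar>x\<bar>) ^ 4 / ?K))" by simp
    also have "\<dots> = D / (1 + \<bar>x\<bar>) ^ 4 / ?K"
      using D2 K0 by (intro exp_ln divide_pos_pos) (auto simp: add_pos_nonneg)
    finally have "?K * exp (envelope T x) \<le> D / (1 + \<bar>x\<bar>) ^ 4"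
      using K0 by (simp add: pos_le_divide_eq mult_ac)
    thus ?thesis by (simp only: divide_divide_eq_left[symmetric] pos_le_divide_eq exp_gt_zero)
  qed
  thus ?thesis using \<kappa> by blast
qed

section \<open>Orthonormality\<close>

text \<open>Periodisation: the part on [-1, 0) is translated by 1, and the support condition leaves
  just two translates.\<close>

lemma integral_fold_unit:
  fixes g :: "real \<Rightarrow> complex"
  assumes g: "integrable lborel g" and supp: "\<And>x. 1 \<le> \<bar>x\<bar> \<Longrightarrow> g x = 0"
  shows "(LINT x|lborel. g x) = (LINT x|lborel. indicator {0..1} x *\<^sub>R (g x + g (x - 1)))"
proof -
  have [measurable]: "g \<in> borel_measurable borel" using g by auto
  have i1: "integrable lborel (\<lambda>x. indicator A x *\<^sub>R g x)" if "A \<in> sets borel" for A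
    using g that by (intro integrable_mult_indicator) auto
  have g': "integrable lborel (\<lambda>x. g (-1 + 1 * x))" by (rule lborel_integrable_real_affine[OF g]) simp
  have "(LINT x|lborel. g x) = (LINT x|lborel. indicator {0..<1} x *\<^sub>R g x + indicator {-1..<0} x *\<^sub>R g x)"
    by (rule Bochner_Integration.integral_cong) (use supp in \<open>auto simp: indicator_def abs_if split: if_splits\<close>)
  also have "\<dots> = (LINT x|lborel. indicator {0..<1} x *\<^sub>R g x) + (LINT x|lborel. indicator {-1..<0} x *\<^sub>R g x)"
    by (rule Bochner_Integration.integral_add) (use i1 in auto)
  also have "(LINT x|lborel. indicator {-1..<0} x *\<^sub>R g x) =
      \<bar>1\<bar> *\<^sub>R (LINT x|lborel. indicator {-1..<0} (-1 + 1 * x) *\<^sub>R g (-1 + 1 * x))"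
    by (rule lborel_integral_real_affine) simp
  also have "\<dots> = (LINT x|lborel. indicator {0..<1} x *\<^sub>R g (-1 + 1 * x))"
    by (simp, rule Bochner_Integration.integral_cong) (auto simp: indicator_def)
  also have "(LINT x|lborel. indicator {0..<1} x *\<^sub>R g x) + \<dots> =
      (LINT x|lborel. indicator {0..<1} x *\<^sub>R g x + indicator {0..<1} x *\<^sub>R g (-1 + 1 * x))"
    by (rule Bochner_Integration.integral_add[symmetric])
       (use i1 g' in \<open>auto intro!: integrable_mult_indicator\<close>)
  also have "\<dots> = (LINT x|lborel. indicator {0..1} x *\<^sub>R (g x + g (x - 1)))"
  proof (rule integral_cong_AE)
    have "AE x in lborel. x \<noteq> (1::real)" by (rule AE_lborel_singleton)
    thus "AE x in lborel. indicator {0..<1} x *\<^sub>R g x + indicator {0..<1} x *\<^sub>R g (-1 + 1 * x) =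
        indicator {0..1} x *\<^sub>R (g x + g (x - 1))"
      by eventually_elim (auto simp: indicator_def algebra_simps)
  qed auto
  finally show ?thesis .
qed

lemma integral_cis_unit:
  "(LINT x|lborel. indicator {0..1} x *\<^sub>R cis (2 * pi * of_int n * x)) = (if n = 0 then 1 else 0)"
proof (cases "n = 0")
  case False
  define \<theta> where "\<theta> = 2 * pi * of_int n"
  have \<theta>: "\<theta> \<noteq> 0" using False by (simp add: \<theta>_def)
  have "(LINT x|lborel. indicator {0..1} x *\<^sub>R cis (\<theta> * x)) = cis (\<theta> * 1) / (\<i> * of_real \<theta>) - cis (\<theta> * 0) / (\<i> * of_real \<theta>)"
  proof (rule integral_FTC_Icc)
    fix x :: real
    have ii: "- (\<i> * (e * \<i>)) = e" for e by (simp add: complex_eq_iff)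
    have "((\<lambda>x. exp (\<i> * of_real (\<theta> * x)) / (\<i> * of_real \<theta>)) has_vector_derivative exp (\<i> * of_real (\<theta> * x))) (at x within {0..1})"
      by (rule has_vector_derivative_real_field[where f="\<lambda>z. exp (\<i> * (of_real \<theta> * z)) / (\<i> * of_real \<theta>)", simplified of_real_mult[symmetric]])
         (use \<theta> in \<open>auto intro!: derivative_eq_intros simp: ii\<close>)
    thus "((\<lambda>x. cis (\<theta> * x) / (\<i> * of_real \<theta>)) has_vector_derivative cis (\<theta> * x)) (at x within {0..1})"
      by (simp add: cis_conv_exp)
  qed (auto intro!: continuous_intros)
  moreover have "cis \<theta> = 1" unfolding \<theta>_def by (rule cis_multiple_2pi) simp
  ultimately show ?thesis using False unfolding \<theta>_def by simp
qed simp

text \<open>Polynomial decay is all that the basis property draws on, so the locale is free of the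
  exponential weight. The fourth power for the cutoff is consumed by products with
  \<open>psihat\<close> in the completeness argument.\<close>

locale meyer =
  fixes \<kappa> :: "real \<Rightarrow> real" and C\<kappa> Cb :: real
  assumes \<kappa>: "transition (1/6) \<kappa>"
    and ift_\<kappa>: "\<And>x. cmod (ift (\<lambda>\<xi>. of_real (\<kappa> \<xi>)) x) \<le> C\<kappa> / (1 + \<bar>x\<bar>) ^ 4"
    and ift_b: "\<And>x. cmod (ift (\<lambda>\<xi>. of_real (bell \<kappa> \<xi>)) x) \<le> Cb / (1 + \<bar>x\<bar>)\<^sup>2"
begin

abbreviation "b \<equiv> bell \<kappa>"

text \<open>The phase is a translation by 1/2. It produces the sign (-1)^q under integer shifts, on
  which both the orthogonality of neighbouring scales and the cancellation of aliasing rest.\<close>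

definition psihat :: "real \<Rightarrow> complex" where "psihat \<xi> = cis (pi * \<xi>) * of_real (b \<xi>)"
definition psi :: "real \<Rightarrow> complex" where "psi = ift psihat"
text \<open>The squared modulus of the Fourier transform of Meyer's scaling function.\<close>

definition p :: "real \<Rightarrow> real" where "p \<xi> = (sin (pi/2 * \<kappa> \<xi>))\<^sup>2"

section \<open>Algebra of the cutoff and the bell\<close>

lemma \<kappa>_eq_1: "\<bar>\<xi>\<bar> \<le> 1/3 \<Longrightarrow> \<kappa> \<xi> = 1" using transitionD(5)[OF \<kappa>, of \<xi>] by simp
lemma \<kappa>_eq_0: "2/3 \<le> \<bar>\<xi>\<bar> \<Longrightarrow> \<kappa> \<xi> = 0" using transitionD(6)[OF \<kappa>, of \<xi>] by simp
lemma \<kappa>_even: "\<kappa> (- \<xi>) = \<kappa> \<xi>" by (rule transitionD(3)[OF \<kappa>])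
lemma \<kappa>_reflect: "0 \<le> \<xi> \<Longrightarrow> \<xi> \<le> 1 \<Longrightarrow> \<kappa> (1 - \<xi>) = 1 - \<kappa> \<xi>"
  using transitionD(7)[OF \<kappa>, of \<xi>] unfolding abs_le_iff by simp
lemma \<kappa>_shift: "0 \<le> \<xi> \<Longrightarrow> \<xi> \<le> 1 \<Longrightarrow> \<kappa> (\<xi> - 1) = 1 - \<kappa> \<xi>"
  using \<kappa>_reflect[of \<xi>] \<kappa>_even[of "1 - \<xi>"] by simp

lemma \<kappa>_measurable [measurable]: "\<kappa> \<in> borel_measurable borel"
  by (rule transition_measurable[OF \<kappa>])

lemma b_continuous: "continuous_on UNIV b"
  unfolding bell_def[abs_def]
  by (intro continuous_intros continuous_on_compose2[OF transition_continuous[OF \<kappa>]]) auto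

lemma b_measurable [measurable]: "b \<in> borel_measurable borel"
  by (rule borel_measurable_continuous_onI[OF b_continuous])

lemma b_le_1: "\<bar>b u\<bar> \<le> 1"
  unfolding bell_def abs_mult by (rule mult_le_one) auto

lemma b_inner: "\<bar>u\<bar> \<le> 1/3 \<Longrightarrow> b u = 0" unfolding bell_def by (simp add: \<kappa>_eq_1)
lemma b_outer: "4/3 \<le> \<bar>u\<bar> \<Longrightarrow> b u = 0" unfolding bell_def by (simp add: \<kappa>_eq_0)

text \<open>At each u one of the two cutoffs is constant: \<kappa> (u / 2) = 1 for |u| \<le> 2/3,
  and \<kappa> u = 0 beyond. The identity makes squared bells telescope over dyadic scales.\<close>

lemma b_square: "(b u)\<^sup>2 = p (u / 2) - p u"
proof (cases "\<bar>u\<bar> \<le> 2/3")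
  case True
  hence "\<kappa> (u / 2) = 1" by (intro \<kappa>_eq_1) simp
  thus ?thesis unfolding bell_def p_def by (simp add: cos_squared_eq)
next
  case False
  hence "\<kappa> u = 0" by (intro \<kappa>_eq_0) simp
  thus ?thesis unfolding bell_def p_def by simp
qed

text \<open>On the overlap 1/3 \<le> |u| \<le> 2/3 the two bells are a cosine and a sine of the same
  angle. In the form sin (pi \<kappa>) the product is visibly invariant when \<kappa> is replaced by
  1 - \<kappa>.\<close>

lemma b_b_double: "b u * b (2 * u) = sin (pi * \<kappa> u) / 2"
proof -
  consider "\<bar>u\<bar> \<le> 1/3" | "2/3 \<le> \<bar>u\<bar>" | "1/3 \<le> \<bar>u\<bar>" "\<bar>u\<bar> \<le> 2/3" by linarith
  thus ?thesis
  proof cases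
    case 1 thus ?thesis by (simp add: b_inner \<kappa>_eq_1)
  next
    case 2 thus ?thesis by (simp add: b_outer \<kappa>_eq_0)
  next
    case 3
    have "\<kappa> (2 * u) = 0" "\<kappa> (u / 2) = 1" using 3 by (auto intro!: \<kappa>_eq_0 \<kappa>_eq_1)
    hence "b u * b (2 * u) = cos (pi/2 * \<kappa> u) * sin (pi/2 * \<kappa> u)" unfolding bell_def by simp
    also have "\<dots> = sin (2 * (pi/2 * \<kappa> u)) / 2" unfolding sin_double by simp
    finally show ?thesis by simp
  qed
qed

text \<open>On [-2/3, -1/3] the reflection of \<kappa> exchanges sine and cosine, and both sides
  become the same product. Elsewhere the supports make both sides vanish.\<close>

lemma b_aliasing: "b u * b (u + 1) = b (2 * u) * b (2 * u + 2)"
proof (cases "-2/3 \<le> u \<and> u \<le> -1/3")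
  case True
  have k: "\<kappa> (u + 1) = 1 - \<kappa> u" using \<kappa>_shift[of "u + 1"] True by simp
  have "\<kappa> (u / 2) = 1" "\<kappa> ((u + 1) / 2) = 1" "\<kappa> (2 * u) = 0" "\<kappa> (2 * u + 2) = 0"
    using True by (auto intro!: \<kappa>_eq_0 \<kappa>_eq_1)
  moreover have "(2 * u + 2) / 2 = u + 1" by simp
  moreover have "cos (pi/2 * (1 - y)) = sin (pi/2 * y)" "sin (pi/2 * (1 - y)) = cos (pi/2 * y)" for y
    by (simp_all add: right_diff_distrib cos_diff sin_diff)
  ultimately show ?thesis unfolding bell_def by (simp only: k) simp
next
  case False
  hence "\<bar>u\<bar> \<le> 1/3 \<or> 4/3 \<le> \<bar>u\<bar> \<or> \<bar>u + 1\<bar> \<le> 1/3 \<or> 4/3 \<le> \<bar>u + 1\<bar>" by argo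
  hence "b u * b (u + 1) = 0" using b_inner b_outer by auto
  moreover have "4/3 \<le> \<bar>2 * u\<bar> \<or> 4/3 \<le> \<bar>2 * u + 2\<bar>" using False by argo
  hence "b (2 * u) * b (2 * u + 2) = 0" using b_outer by auto
  ultimately show ?thesis by (simp only:)
qed

lemma p_bound: "\<bar>p u\<bar> \<le> 1" unfolding p_def by (simp add: abs_square_le_1)

lemma p_measurable [measurable]: "p \<in> borel_measurable borel" unfolding p_def[abs_def] by measurable

lemma p_eq_1: "\<bar>u\<bar> \<le> 1/3 \<Longrightarrow> p u = 1" by (simp add: p_def \<kappa>_eq_1)
lemma p_eq_0: "2/3 \<le> \<bar>u\<bar> \<Longrightarrow> p u = 0" by (simp add: p_def \<kappa>_eq_0)

lemma p_integrable: "integrable lborel (\<lambda>\<xi>. complex_of_real (p \<xi>))"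
  by (rule integrable_compact_support[where B=1 and R=1]) (use p_bound in \<open>auto intro!: p_eq_0\<close>)

text \<open>Reflection turns p (x - 1) into the squared cosine on [0, 1], so the folded function is
  constantly 1. In other words, the integer translates of the scaling function are
  orthonormal.\<close>

lemma ift_p_int: "ift (\<lambda>\<xi>. of_real (p \<xi>)) (of_int n) = (if n = 0 then 1 else 0)"
proof -
  let ?g = "\<lambda>\<xi>. of_real (p \<xi>) * cis (2 * pi * of_int n * \<xi>)"
  have "ift (\<lambda>\<xi>. of_real (p \<xi>)) (of_int n) = (LINT \<xi>|lborel. ?g \<xi>)" by (simp add: ift_def)
  also have "\<dots> = (LINT x|lborel. indicator {0..1} x *\<^sub>R (?g x + ?g (x - 1)))"
    by (rule integral_fold_unit) (use p_integrable p_eq_0 in \<open>auto intro!: integrable_mult_cis\<close>)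
  also have "\<dots> = (LINT x|lborel. indicator {0..1} x *\<^sub>R cis (2 * pi * of_int n * x))"
  proof (rule Bochner_Integration.integral_cong[OF refl])
    fix x :: real
    have c: "cis (2 * pi * of_int n * (x - 1)) = cis (2 * pi * of_int n * x)"
      using cis_multiple_2pi[of "of_int n"]
      by (simp add: right_diff_distrib cis_divide[symmetric])
    have "p x + p (x - 1) = 1" if "0 \<le> x" "x \<le> 1"
      unfolding p_def using \<kappa>_shift[OF that]
      by (simp add: right_diff_distrib sin_diff)
    hence "?g x + ?g (x - 1) = cis (2 * pi * of_int n * x)" if "0 \<le> x" "x \<le> 1"
      unfolding c using that by (simp add: distrib_right[symmetric] of_real_add[symmetric] del: of_real_add)
    thus "indicator {0..1} x *\<^sub>R (?g x + ?g (x - 1)) = indicator {0..1} x *\<^sub>R cis (2 * pi * of_int n * x)"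
      by (auto simp: indicator_def)
  qed
  finally show ?thesis unfolding integral_cis_unit .
qed

text \<open>At n = 0 the two terms of \<open>b_square\<close> contribute 2 and 1; at other integers
  both vanish.\<close>

lemma ift_b_square_int: "ift (\<lambda>\<xi>. of_real ((b \<xi>)\<^sup>2)) (of_int n) = (if n = 0 then 1 else 0)"
proof -
  have i: "integrable lborel (\<lambda>\<xi>. complex_of_real (p (1/2 * \<xi>)))"
    using lborel_integrable_real_affine[OF p_integrable, of "1/2" 0] by simp
  have "ift (\<lambda>\<xi>. of_real ((b \<xi>)\<^sup>2)) (of_int n) =
      ift (\<lambda>\<xi>. of_real (p (1/2 * \<xi>)) - of_real (p \<xi>)) (of_int n)"
    by (simp add: b_square)
  also have "\<dots> = ift (\<lambda>\<xi>. of_real (p (1/2 * \<xi>))) (of_int n) - ift (\<lambda>\<xi>. of_real (p \<xi>)) (of_int n)"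
    by (rule ift_diff[OF i p_integrable])
  also have "ift (\<lambda>\<xi>. of_real (p (1/2 * \<xi>))) (of_int n) = 2 * ift (\<lambda>\<xi>. of_real (p \<xi>)) (of_int (2 * n))"
    by (subst ift_scale) (auto simp: mult.commute)
  finally show ?thesis unfolding ift_p_int by simp
qed

text \<open>Under the shift by 1 the amplitude is invariant on [0, 1], whereas the odd multiple of
  pi in the phase changes the sign. The folded integrand is therefore identically 0.\<close>

lemma cross_integral:
  "(LINT \<xi>|lborel. of_real (b \<xi> * b (2 * \<xi>)) * cis (pi * of_int (2 * n + 1) * \<xi>)) = 0"
proof -
  let ?g = "\<lambda>\<xi>. of_real (b \<xi> * b (2 * \<xi>)) * cis (pi * of_int (2 * n + 1) * \<xi>)"
  have "(LINT \<xi>|lborel. ?g \<xi>) = (LINT x|lborel. indicator {0..1} x *\<^sub>R (?g x + ?g (x - 1)))"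
  proof (rule integral_fold_unit[OF integrable_mult_cis])
    show "integrable lborel (\<lambda>\<xi>. complex_of_real (b \<xi> * b (2 * \<xi>)))"
    proof (rule integrable_compact_support[where B=1 and R=2])
      show "norm (complex_of_real (b \<xi> * b (2 * \<xi>))) \<le> 1" for \<xi>
        using b_le_1[of \<xi>] b_le_1[of "2 * \<xi>"] by (simp add: norm_mult mult_le_one)
      show "complex_of_real (b \<xi> * b (2 * \<xi>)) = 0" if "2 < \<bar>\<xi>\<bar>" for \<xi>
        using that b_outer[of \<xi>] by simp
    qed simp
    show "?g x = 0" if "1 \<le> \<bar>x\<bar>" for x using that b_outer[of "2 * x"] by simp
  qed simp
  also have "\<dots> = 0"
  proof (rule integral_eq_zero_AE, rule AE_I2)
    fix x :: real
    have "cis (pi * of_int (2 * n + 1)) = -1"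
      using cis_multiple_2pi[of "of_int n"] by (simp add: distrib_left cis_mult[symmetric] mult_ac)
    hence c: "cis (pi * of_int (2 * n + 1) * (x - 1)) = - cis (pi * of_int (2 * n + 1) * x)"
      by (simp add: right_diff_distrib cis_divide[symmetric] del: of_int_add of_int_mult)
    have "b (x - 1) * b (2 * (x - 1)) = b x * b (2 * x)" if "0 \<le> x" "x \<le> 1"
      unfolding b_b_double using \<kappa>_shift[OF that] by (simp add: right_diff_distrib sin_diff)
    hence "?g x + ?g (x - 1) = 0" if "0 \<le> x" "x \<le> 1"
      unfolding c using that by simp
    thus "indicator {0..1} x *\<^sub>R (?g x + ?g (x - 1)) = 0" by (auto simp: indicator_def)
  qed
  finally show ?thesis .
qed

section \<open>The wavelet system on the frequency side\<close>

lemma psihat_continuous: "continuous_on UNIV psihat"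
  unfolding psihat_def[abs_def] by (intro continuous_intros b_continuous)

lemma psihat_measurable [measurable]: "psihat \<in> borel_measurable borel"
  by (rule borel_measurable_continuous_onI[OF psihat_continuous])

lemma psihat_le_1: "cmod (psihat u) \<le> 1" using b_le_1[of u] by (simp add: psihat_def norm_mult)

lemma psihat_integrable: "integrable lborel psihat"
  by (rule integrable_compact_support[where B=1 and R=2])
     (use psihat_le_1 in \<open>auto simp: psihat_def intro!: b_outer\<close>)

lemma psi_eq: "psi x = ift (\<lambda>\<xi>. of_real (b \<xi>)) (x + 1/2)"
  using ift_modulate[of "1/2" "\<lambda>\<xi>. of_real (b \<xi>)" x] by (simp add: psi_def psihat_def[abs_def])

lemma psi_decay: "cmod (psi x) \<le> 4 * Cb / (1 + \<bar>x\<bar>)\<^sup>2"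
proof -
  have Cb: "0 \<le> Cb" using order_trans[OF norm_ge_zero ift_b[of 0]] by simp
  have "1 + \<bar>x\<bar> \<le> 2 * (1 + \<bar>x + 1/2\<bar>)" by argo
  hence "(1 + \<bar>x\<bar>)\<^sup>2 \<le> (2 * (1 + \<bar>x + 1/2\<bar>))\<^sup>2" by (rule power_mono) simp
  hence "(1 + \<bar>x\<bar>)\<^sup>2 \<le> 4 * (1 + \<bar>x + 1/2\<bar>)\<^sup>2" unfolding power_mult_distrib by simp
  hence "Cb * (1 + \<bar>x\<bar>)\<^sup>2 \<le> Cb * (4 * (1 + \<bar>x + 1/2\<bar>)\<^sup>2)" using Cb by (rule mult_left_mono)
  hence "Cb / (1 + \<bar>x + 1/2\<bar>)\<^sup>2 \<le> 4 * Cb / (1 + \<bar>x\<bar>)\<^sup>2"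
    by (simp add: pos_divide_le_eq pos_le_divide_eq add_pos_nonneg mult_ac)
  thus ?thesis using ift_b[of "x + 1/2"] unfolding psi_eq by linarith
qed

lemma psi_measurable [measurable]: "psi \<in> borel_measurable borel"
  unfolding psi_def by simp

lemma psi_integrable: "integrable lborel psi"
  by (rule integrable_decay[OF _ psi_decay]) simp

lemma ift_psi: "ift psi (- \<xi>) = psihat \<xi>"
  unfolding psi_def
  by (rule ift_inversion[OF psihat_integrable psihat_continuous psihat_le_1]) (use psi_integrable in \<open>simp add: psi_def\<close>)

definition Psi :: "int \<Rightarrow> int \<Rightarrow> real \<Rightarrow> complex" where
  "Psi j k \<xi> = of_real (2 powr (- real_of_int j / 2)) *
     (cis (2 * pi * (- real_of_int k / 2 powr real_of_int j) * \<xi>) * psihat (1 / 2 powr real_of_int j * \<xi>))"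

lemma ift_Psi: "ift (Psi j k) = wavelet_system psi j k"
proof
  fix x
  define s where "s = 2 powr real_of_int j"
  have s: "s > 0" by (simp add: s_def)
  have c: "ift (\<lambda>\<xi>. of_real c * f \<xi>) x = of_real c * ift f x" for c :: real and f
    unfolding ift_def by (simp only: integral_mult_right_zero[symmetric] mult.assoc)
  have "2 powr (- real_of_int j / 2) * s = 2 powr (real_of_int j / 2)"
    unfolding s_def powr_add[symmetric] by (simp add: field_simps)
  hence "of_real (2 powr (- real_of_int j / 2)) * of_real s = complex_of_real (2 powr (real_of_int j / 2))"
    by (simp only: of_real_mult[symmetric])
  moreover have "(x + - real_of_int k / s) / (1 / s) = s * x - real_of_int k"
    using s by (simp add: field_simps)
  ultimately show "ift (Psi j k) x = wavelet_system psi j k x"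
    unfolding Psi_def[abs_def] c ift_modulate s_def[symmetric] wavelet_system_def
    using s by (subst ift_scale) (auto simp: psi_def mult.assoc)
qed

lemma Psi_continuous: "continuous_on UNIV (Psi j k)"
  unfolding Psi_def[abs_def]
  by (intro continuous_intros continuous_on_compose2[OF psihat_continuous]) auto

lemma Psi_measurable [measurable]: "Psi j k \<in> borel_measurable borel"
  by (rule borel_measurable_continuous_onI[OF Psi_continuous])

lemma Psi_integrable: "integrable lborel (Psi j k)"
proof -
  have "integrable lborel (\<lambda>\<xi>. psihat (0 + 1 / 2 powr real_of_int j * \<xi>))"
    by (rule lborel_integrable_real_affine[OF psihat_integrable]) simp
  hence "integrable lborel (\<lambda>\<xi>. of_real (2 powr (- real_of_int j / 2)) * (psihat (1 / 2 powr real_of_int j * \<xi>) *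
      cis (2 * pi * (- real_of_int k / 2 powr real_of_int j) * \<xi>)))"
    by (intro integrable_mult_right integrable_mult_cis) auto
  thus ?thesis unfolding Psi_def[abs_def] by (simp only: mult.commute[of "cis _"])
qed

lemma Psi_bound: "cmod (Psi j k \<xi>) \<le> 2 powr (- real_of_int j / 2)"
  unfolding Psi_def using psihat_le_1 by (simp add: norm_mult mult_left_le)

lemma wavelet_system_integrable: "integrable lborel (wavelet_system psi j k)"
proof -
  have "integrable lborel (\<lambda>x. psi (- real_of_int k + 2 powr real_of_int j * x))"
    by (rule lborel_integrable_real_affine[OF psi_integrable]) simp
  thus ?thesis unfolding wavelet_system_def[abs_def] by (auto simp: algebra_simps)
qed

lemma wavelet_system_measurable [measurable]: "wavelet_system psi j k \<in> borel_measurable borel"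
  using wavelet_system_integrable by auto

lemma ift_wavelet_system: "ift (wavelet_system psi j k) (- \<xi>) = Psi j k \<xi>"
  unfolding ift_Psi[symmetric]
  by (rule ift_inversion[OF Psi_integrable Psi_continuous Psi_bound]) (simp add: ift_Psi wavelet_system_integrable)

lemma L2_inner_Psi:
  "L2_inner (wavelet_system psi j k) (wavelet_system psi j' k') = (LINT \<xi>|lborel. Psi j k \<xi> * cnj (Psi j' k' \<xi>))"
proof -
  have "L2_inner (wavelet_system psi j k) (wavelet_system psi j' k') =
      (LINT x|lborel. wavelet_system psi j k x * cnj (ift (Psi j' k') x))"
    unfolding L2_inner_def ift_Psi by (rule integral_completion) simp
  also have "\<dots> = (LINT \<xi>|lborel. ift (wavelet_system psi j k) (- \<xi>) * cnj (Psi j' k' \<xi>))"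
    by (rule ift_parseval[OF wavelet_system_integrable Psi_integrable])
  finally show ?thesis by (simp add: ift_wavelet_system)
qed

lemma Psi_product:
  "Psi j k \<xi> * cnj (Psi j' k' \<xi>) =
     of_real (2 powr (- (real_of_int j + real_of_int j') / 2)) *
     (of_real (b (\<xi> / 2 powr real_of_int j) * b (\<xi> / 2 powr real_of_int j')) *
      cis (pi * (1 - 2 * real_of_int k) * (\<xi> / 2 powr real_of_int j)
           - pi * (1 - 2 * real_of_int k') * (\<xi> / 2 powr real_of_int j')))"
proof -
  have P: "Psi j k \<xi> = of_real (2 powr (- real_of_int j / 2)) *
      (of_real (b (\<xi> / 2 powr real_of_int j)) * cis (pi * (1 - 2 * real_of_int k) * (\<xi> / 2 powr real_of_int j)))" for j k
  proof -
    have "2 * pi * (- real_of_int k / 2 powr real_of_int j) * \<xi> + pi * (1 / 2 powr real_of_int j * \<xi>)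
        = pi * (1 - 2 * real_of_int k) * (\<xi> / 2 powr real_of_int j)" by (simp add: field_simps)
    hence "cis (2 * pi * (- real_of_int k / 2 powr real_of_int j) * \<xi>) * cis (pi * (1 / 2 powr real_of_int j * \<xi>))
        = cis (pi * (1 - 2 * real_of_int k) * (\<xi> / 2 powr real_of_int j))" by (simp only: cis_mult)
    thus ?thesis unfolding Psi_def psihat_def by (simp add: mult_ac)
  qed
  have "2 powr (- real_of_int j / 2) * 2 powr (- real_of_int j' / 2) = 2 powr (- (real_of_int j + real_of_int j') / 2)"
    unfolding powr_add[symmetric] by (simp add: add_divide_distrib diff_divide_distrib)
  hence "complex_of_real (2 powr (- (real_of_int j + real_of_int j') / 2)) =
     of_real (2 powr (- real_of_int j / 2)) * of_real (2 powr (- real_of_int j' / 2))"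
    by (simp only: of_real_mult[symmetric])
  moreover have "cis (A - B) = cis A * cnj (cis B)" for A B by (simp add: cis_cnj cis_mult)
  ultimately show ?thesis unfolding P by (simp only: complex_cnj_mult complex_cnj_complex_of_real of_real_mult mult_ac)
qed

text \<open>Equal scales reduce to integer Fourier coefficients of the squared bell and neighbouring
  scales to \<open>cross_integral\<close>. From two scales apart on the products vanish, because the
  support 1/3 \<le> |u| \<le> 4/3 has endpoints of ratio 4.\<close>

lemma wavelet_orthonormal_le:
  assumes "j \<le> j'"
  shows "L2_inner (wavelet_system psi j k) (wavelet_system psi j' k') = (if j = j' \<and> k = k' then 1 else 0)"
proof -
  define s where "s = 2 powr real_of_int j'"
  have s: "s > 0" "s \<noteq> 0" by (auto simp: s_def)
  let ?I = "LINT \<xi>|lborel. Psi j k \<xi> * cnj (Psi j' k' \<xi>)"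
  consider "j' = j" | "j' = j + 1" | "j' \<ge> j + 2" using assms by linarith
  hence "?I = (if j = j' \<and> k = k' then 1 else 0)"
  proof cases
    case 1
    have "?I = \<bar>s\<bar> *\<^sub>R (LINT \<xi>|lborel. Psi j k (0 + s * \<xi>) * cnj (Psi j' k' (0 + s * \<xi>)))"
      by (rule lborel_integral_real_affine[OF s(2)])
    also have "\<dots> = \<bar>s\<bar> *\<^sub>R (LINT \<xi>|lborel. of_real (1 / s) * (of_real ((b \<xi>)\<^sup>2) * cis (2 * pi * of_int (k' - k) * \<xi>)))"
    proof (intro arg_cong[where f="\<lambda>z. \<bar>s\<bar> *\<^sub>R z"] Bochner_Integration.integral_cong refl)
      fix \<xi>
      have "2 powr (- (real_of_int j + real_of_int j') / 2) = 1 / s"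
        unfolding s_def 1 by (simp add: powr_minus inverse_eq_divide)
      moreover have "pi * (1 - 2 * real_of_int k) * \<xi> - pi * (1 - 2 * real_of_int k') * \<xi> = 2 * pi * of_int (k' - k) * \<xi>"
        by (simp add: algebra_simps)
      ultimately show "Psi j k (0 + s * \<xi>) * cnj (Psi j' k' (0 + s * \<xi>)) =
          of_real (1 / s) * (of_real ((b \<xi>)\<^sup>2) * cis (2 * pi * of_int (k' - k) * \<xi>))"
        using s unfolding Psi_product s_def[symmetric] unfolding 1[symmetric] s_def[symmetric]
        by (simp add: power2_eq_square)
    qed
    also have "\<dots> = ift (\<lambda>\<xi>. of_real ((b \<xi>)\<^sup>2)) (of_int (k' - k))"
      unfolding integral_mult_right_zero ift_def using s by (simp add: scaleR_conv_of_real)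
    finally show ?thesis unfolding ift_b_square_int using 1 by auto
  next
    case 2
    have sj: "2 powr real_of_int j = s / 2" unfolding s_def 2 by (simp add: powr_add)
    have "?I = \<bar>s\<bar> *\<^sub>R (LINT \<xi>|lborel. Psi j k (0 + s * \<xi>) * cnj (Psi j' k' (0 + s * \<xi>)))"
      by (rule lborel_integral_real_affine[OF s(2)])
    also have "\<dots> = \<bar>s\<bar> *\<^sub>R (LINT \<xi>|lborel. of_real (2 powr (- (real_of_int j + real_of_int j') / 2)) *
        (of_real (b \<xi> * b (2 * \<xi>)) * cis (pi * of_int (2 * (k' - 2 * k) + 1) * \<xi>)))"
    proof (intro arg_cong[where f="\<lambda>z. \<bar>s\<bar> *\<^sub>R z"] Bochner_Integration.integral_cong refl)
      fix \<xi>
      \<comment> \<open>One phase is doubled and becomes an even multiple of pi \<xi>, the other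
        stays odd; the difference is odd, as \<open>cross_integral\<close> requires.\<close>
      have "pi * (1 - 2 * real_of_int k) * (2 * \<xi>) - pi * (1 - 2 * real_of_int k') * \<xi> = pi * of_int (2 * (k' - 2 * k) + 1) * \<xi>"
        by (simp add: algebra_simps)
      moreover have "(0 + s * \<xi>) / (s / 2) = 2 * \<xi>" "(0 + s * \<xi>) / s = \<xi>" using s by auto
      ultimately show "Psi j k (0 + s * \<xi>) * cnj (Psi j' k' (0 + s * \<xi>)) =
          of_real (2 powr (- (real_of_int j + real_of_int j') / 2)) *
        (of_real (b \<xi> * b (2 * \<xi>)) * cis (pi * of_int (2 * (k' - 2 * k) + 1) * \<xi>))"
        unfolding Psi_product sj s_def[symmetric] by (simp only: mult.commute[of "b (2 * \<xi>)"])
    qed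
    also have "\<dots> = 0" unfolding integral_mult_right_zero cross_integral by simp
    finally show ?thesis using 2 by simp
  next
    case 3
    have "b (\<xi> / 2 powr real_of_int j) * b (\<xi> / 2 powr real_of_int j') = 0" for \<xi>
    proof (cases "\<bar>\<xi> / s\<bar> \<le> 1/3")
      case True thus ?thesis using b_inner unfolding s_def by simp
    next
      case False
      have "4 * 2 powr real_of_int j = 2 powr (real_of_int j + 2)" by (simp add: powr_add)
      also have "\<dots> \<le> s" unfolding s_def using 3 by (intro powr_mono) auto
      finally have "4 * 2 powr real_of_int j \<le> s" .
      moreover have "s < 3 * \<bar>\<xi>\<bar>" using False s by (simp add: field_simps)
      ultimately have "4/3 \<le> \<bar>\<xi> / 2 powr real_of_int j\<bar>" by (simp add: field_simps)
      thus ?thesis using b_outer by simp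
    qed
    thus ?thesis unfolding Psi_product using 3 by (simp only: of_real_0 mult_zero_left mult_zero_right) simp
  qed
  thus ?thesis unfolding L2_inner_Psi .
qed

lemma L2_inner_commute: "L2_inner g f = cnj (L2_inner f g)"
  unfolding L2_inner_def by (simp add: mult.commute flip: Bochner_Integration.integral_cnj)

lemma wavelet_orthonormal:
  "L2_inner (wavelet_system psi j k) (wavelet_system psi j' k') = (if j = j' \<and> k = k' then 1 else 0)"
proof (cases "j \<le> j'")
  case False
  hence "L2_inner (wavelet_system psi j' k') (wavelet_system psi j k) = 0"
    by (subst wavelet_orthonormal_le) auto
  with False show ?thesis by (subst L2_inner_commute) auto
qed (rule wavelet_orthonormal_le)

lemma psi_bounded: "cmod (psi x) \<le> 4 * Cb"
proof -
  have "0 \<le> 4 * Cb" using order_trans[OF norm_ge_zero ift_b[of 0]] by simp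
  hence "4 * Cb / (1 + \<bar>x\<bar>)\<^sup>2 \<le> 4 * Cb / 1" by (intro divide_left_mono) (auto simp: add_pos_nonneg)
  thus ?thesis using psi_decay[of x] by simp
qed

lemma L2_psi: "L2 psi"
proof -
  have "integrable lborel (\<lambda>x. (cmod (psi x))\<^sup>2)"
  proof (rule Bochner_Integration.integrable_bound)
    show "integrable lborel (\<lambda>x. 4 * Cb * cmod (psi x))" using psi_integrable by simp
    show "AE x in lborel. norm ((cmod (psi x))\<^sup>2) \<le> norm (4 * Cb * cmod (psi x))"
      using mult_right_mono[OF psi_bounded norm_ge_zero]
      by (auto intro!: AE_I2 order_trans[OF _ abs_ge_self] simp: power2_eq_square simp del: abs_mult)
  qed simp
  thus ?thesis unfolding L2_def by (auto intro: integrable_completion[THEN iffD2] measurable_completion)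
qed

lemma bandlimited_psi: "bandlimited psi"
proof -
  have "fourier psi \<xi> = psihat \<xi>" for \<xi>
  proof -
    have "fourier psi \<xi> = (LINT x|lebesgue. psi x * cis (2 * pi * (- \<xi>) * x))"
      unfolding fourier_def by (simp add: cis_conv_exp mult_ac)
    also have "\<dots> = ift psi (- \<xi>)" unfolding ift_def by (rule integral_completion) simp
    finally show ?thesis by (simp add: ift_psi)
  qed
  hence "\<forall>\<xi>. \<bar>\<xi>\<bar> > 4/3 \<longrightarrow> fourier psi \<xi> = 0" using b_outer by (simp add: psihat_def)
  moreover have "integrable lebesgue psi" using psi_integrable by (simp add: integrable_completion)
  ultimately show ?thesis unfolding bandlimited_def by blast
qed

end

section \<open>Poisson summation\<close>

lemma integral_cis_period:
  "(LINT x|lborel. indicator {a..<a + 1} x *\<^sub>R cis (2 * pi * of_int n * x)) = (if n = 0 then 1 else 0)"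
proof -
  have c: "cis (2 * pi * of_int n * (a + x)) = cis (2 * pi * of_int n * a) * cis (2 * pi * of_int n * x)" for x
    by (simp add: distrib_left cis_mult)
  have "(LINT x|lborel. indicator {a..<a + 1} x *\<^sub>R cis (2 * pi * of_int n * x)) =
      \<bar>1\<bar> *\<^sub>R (LINT x|lborel. indicator {a..<a + 1} (a + 1 * x) *\<^sub>R cis (2 * pi * of_int n * (a + 1 * x)))"
    by (rule lborel_integral_real_affine) simp
  also have "\<dots> = (LINT x|lborel. cis (2 * pi * of_int n * a) * (indicator {0..1} x *\<^sub>R cis (2 * pi * of_int n * x)))"
    unfolding abs_one scaleR_one mult_1 c
  proof (rule integral_cong_AE)
    have "AE x in lborel. x \<noteq> (1::real)" by (rule AE_lborel_singleton)
    thus "AE x in lborel. indicator {a..<a + 1} (a + x) *\<^sub>R (cis (2 * pi * of_int n * a) * cis (2 * pi * of_int n * x)) =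
        cis (2 * pi * of_int n * a) * (indicator {0..1} x *\<^sub>R cis (2 * pi * of_int n * x))"
      by eventually_elim (auto simp: indicator_def)
  qed auto
  also have "\<dots> = cis (2 * pi * of_int n * a) * (if n = 0 then 1 else 0)"
    unfolding integral_mult_right_zero integral_cis_unit ..
  finally show ?thesis by simp
qed

lemma integral_double_sum:
  fixes g :: "nat \<Rightarrow> nat \<Rightarrow> 'a \<Rightarrow> complex"
  assumes "\<And>k l. integrable M (g k l)"
  shows "(LINT x|M. (\<Sum>k<N. \<Sum>l<N. g k l x)) = (\<Sum>k<N. \<Sum>l<N. LINT x|M. g k l x)"
  using assms by (simp add: Bochner_Integration.integral_sum Bochner_Integration.integrable_sum)

section \<open>Fejer means\<close>

definition fejer :: "nat \<Rightarrow> real \<Rightarrow> real" where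
  "fejer N t = (cmod (\<Sum>k<N. cis (2 * pi * real k * t)))\<^sup>2 / real N"

lemma fejer_nonneg: "0 \<le> fejer N t" by (simp add: fejer_def)

lemma fejer_eq_sum:
  "of_real (fejer N t) = (\<Sum>k<N. \<Sum>l<N. cis (2 * pi * of_int (int k - int l) * t)) / of_nat N"
proof -
  have "of_real ((cmod (\<Sum>k<N. cis (2 * pi * real k * t)))\<^sup>2) =
     (\<Sum>k<N. cis (2 * pi * real k * t)) * cnj (\<Sum>l<N. cis (2 * pi * real l * t))"
    by (rule complex_norm_square)
  also have "\<dots> = (\<Sum>k<N. \<Sum>l<N. cis (2 * pi * of_int (int k - int l) * t))"
    by (simp add: sum_product cis_cnj cis_mult algebra_simps)
  finally show ?thesis by (simp add: fejer_def)
qed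

lemma fejer_measurable [measurable]: "fejer N \<in> borel_measurable borel"
  unfolding fejer_def[abs_def] by measurable

lemma fejer_le: "fejer N t \<le> real N"
proof -
  have "cmod (\<Sum>k<N. cis (2 * pi * real k * t)) \<le> (\<Sum>k<N. 1)"
    by (rule order_trans[OF norm_sum]) simp
  hence "(cmod (\<Sum>k<N. cis (2 * pi * real k * t)))\<^sup>2 \<le> (real N)\<^sup>2" by (intro power_mono) auto
  thus ?thesis unfolding fejer_def by (cases "N = 0") (auto simp: power2_eq_square divide_le_eq)
qed

text \<open>Multiplying the Dirichlet sum by \<open>1 - cis (2 pi t)\<close> telescopes; as in Korovkin's theorem, this bound
  alone makes the Fejer means converge.\<close>

lemma fejer_cos: "fejer N t * (1 - cos (2 * pi * t)) \<le> 2 / real N"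
proof -
  have n: "(cmod (1 - cis x))\<^sup>2 = 2 * (1 - cos x)" for x
    by (simp add: cmod_power2 power2_diff algebra_simps)
  have "cis (2 * pi * real k * t) = cis (2 * pi * t) ^ k" for k
    by (simp only: Complex.DeMoivre mult_ac)
  hence "(1 - cis (2 * pi * t)) * (\<Sum>k<N. cis (2 * pi * real k * t)) = 1 - cis (2 * pi * t) ^ N"
    by (simp add: one_diff_power_eq)
  also have "\<dots> = 1 - cis (real N * (2 * pi * t))" by (simp add: Complex.DeMoivre)
  finally have "(cmod (1 - cis (2 * pi * t)))\<^sup>2 * (cmod (\<Sum>k<N. cis (2 * pi * real k * t)))\<^sup>2 =
     (cmod (1 - cis (real N * (2 * pi * t))))\<^sup>2"
    by (simp only: norm_mult[symmetric] power_mult_distrib[symmetric])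
  hence "(1 - cos (2 * pi * t)) * (cmod (\<Sum>k<N. cis (2 * pi * real k * t)))\<^sup>2 = 1 - cos (real N * (2 * pi * t))"
    unfolding n mult.assoc by (rule mult_left_cancel[THEN iffD1, rotated]) simp
  also have "\<dots> \<le> 2" using cos_ge_minus_one[of "real N * (2 * pi * t)"] by linarith
  finally show ?thesis unfolding fejer_def by (simp add: divide_right_mono mult.commute)
qed

lemma integral_fejer:
  assumes "N > 0"
  shows "(LINT x|lborel. indicator {a..<a + 1} x * fejer N x) = 1"
proof -
  have i: "integrable lborel (\<lambda>x. indicator {a..<a + 1} x *\<^sub>R cis (c * x))" for c
    by (rule integrable_compact_support[where B=1 and R="\<bar>a\<bar> + 1"]) (auto simp: indicator_def)
  have "complex_of_real (LINT x|lborel. indicator {a..<a + 1} x * fejer N x) =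
      (LINT x|lborel. (\<Sum>k<N. \<Sum>l<N. indicator {a..<a + 1} x *\<^sub>R cis (2 * pi * of_int (int k - int l) * x)) / of_nat N)"
    unfolding integral_complex_of_real[symmetric] of_real_mult fejer_eq_sum
    by (simp add: sum_distrib_left scaleR_conv_of_real)
  also have "\<dots> = (\<Sum>k<N. \<Sum>l<N. LINT x|lborel. indicator {a..<a + 1} x *\<^sub>R cis (2 * pi * of_int (int k - int l) * x)) / of_nat N"
    unfolding integral_divide_zero by (subst integral_double_sum) (use i in auto)
  also have "\<dots> = (\<Sum>k<N. \<Sum>l<N. if l = k then 1 else 0) / of_nat N"
    unfolding integral_cis_period by (intro arg_cong2[where f="(/)"] sum.cong) auto
  also have "\<dots> = 1" using assms by simp
  finally show ?thesis by (simp only: of_real_eq_1_iff)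
qed

lemma cesaro_mean:
  fixes s :: "nat \<Rightarrow> complex"
  assumes "s \<longlonglongrightarrow> S"
  shows "(\<lambda>N. (\<Sum>n<N. s n) / of_nat N) \<longlonglongrightarrow> S"
proof (rule LIMSEQ_I)
  fix e :: real assume e: "e > 0"
  then obtain M where M: "\<And>n. n \<ge> M \<Longrightarrow> cmod (s n - S) < e / 2"
    using LIMSEQ_D[OF assms, of "e/2"] by auto
  define A where "A = (\<Sum>n<M. cmod (s n - S))"
  obtain K :: nat where K: "real K > 2 * A / e" using reals_Archimedean2 by blast
  show "\<exists>no. \<forall>n\<ge>no. cmod ((\<Sum>n<n. s n) / of_nat n - S) < e"
  proof (intro exI allI impI)
    fix N assume N: "N \<ge> max (max M K) 1"
    have "(\<Sum>n<N. s n) / of_nat N - S = (\<Sum>n<N. s n - S) / of_nat N"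
      using N by (simp add: sum_subtractf diff_divide_distrib)
    hence "cmod ((\<Sum>n<N. s n) / of_nat N - S) \<le> (\<Sum>n<N. cmod (s n - S)) / real N"
      by (simp add: norm_divide divide_right_mono norm_sum)
    also have "(\<Sum>n<N. cmod (s n - S)) = A + (\<Sum>n=M..<N. cmod (s n - S))"
      unfolding A_def using N by (metis atLeast0LessThan le0 max.bounded_iff sum.atLeastLessThan_concat)
    also have "(\<Sum>n=M..<N. cmod (s n - S)) \<le> (\<Sum>n=M..<N. e / 2)"
      by (intro sum_mono less_imp_le[OF M]) auto
    also have "\<dots> \<le> real N * (e / 2)" using e by simp
    also have "A + real N * (e / 2) < real N * e"
    proof -
      have "2 * A / e < real N" using K N by linarith
      hence "2 * A < real N * e" using e by (simp add: divide_less_eq)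
      thus ?thesis by simp
    qed
    finally show "cmod ((\<Sum>n<N. s n) / of_nat N - S) < e"
      using N by (simp add: divide_less_eq mult.commute divide_right_mono)
  qed
qed

text \<open>Passing from N to N + 1 adds a border to the square of index pairs, and this border is
  the N-th symmetric partial sum. Fejer means of a coefficient sequence thus are Cesaro means of its
  symmetric partial sums.\<close>

lemma dirichlet_double_sum:
  fixes c :: "int \<Rightarrow> complex"
  shows "(\<Sum>k<N. \<Sum>l<N. c (int k - int l)) = (\<Sum>n<N. c 0 + (\<Sum>m<n. c (int (Suc m)) + c (- int (Suc m))))"
proof (induction N)
  case (Suc N)
  have r: "(\<Sum>l<N. c (int N - int l)) = (\<Sum>m<N. c (int (Suc m)))"
    by (rule sum.reindex_bij_witness[of _ "\<lambda>m. N - Suc m" "\<lambda>l. N - Suc l"]) (auto simp: of_nat_diff)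
  have r': "(\<Sum>k<N. c (int k - int N)) = (\<Sum>m<N. c (- int (Suc m)))"
    by (rule sum.reindex_bij_witness[of _ "\<lambda>m. N - Suc m" "\<lambda>l. N - Suc l"]) (auto simp: of_nat_diff algebra_simps)
  have "(\<Sum>k<Suc N. \<Sum>l<Suc N. c (int k - int l)) = (\<Sum>k<N. \<Sum>l<N. c (int k - int l)) +
      (\<Sum>k<N. c (int k - int N)) + ((\<Sum>l<N. c (int N - int l)) + c 0)"
    by (simp add: sum.distrib)
  moreover have "(\<Sum>n<Suc N. c 0 + (\<Sum>m<n. c (int (Suc m)) + c (- int (Suc m)))) =
      (\<Sum>n<N. c 0 + (\<Sum>m<n. c (int (Suc m)) + c (- int (Suc m)))) +
      (c 0 + ((\<Sum>m<N. c (int (Suc m))) + (\<Sum>m<N. c (- int (Suc m)))))"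
    by (simp only: sum.lessThan_Suc sum.distrib add_ac)
  ultimately show ?case unfolding Suc r r' by (simp only: add_ac)
qed simp

lemma summable_inverse_square: "summable (\<lambda>n. C / (1 + real n)\<^sup>2)"
proof -
  have "summable (\<lambda>n. 1 / (real (Suc n))\<^sup>2)"
    using inverse_power_summable[of 2, where 'a=real] summable_Suc_iff[of "\<lambda>n. 1 / (real n)\<^sup>2"]
    by (simp add: inverse_eq_divide power_divide)
  from summable_mult[OF this, of C] show ?thesis by (simp add: add.commute)
qed

text \<open>The numbers \<open>ift H n\<close> are the Fourier coefficients of the periodisation h
  of H. Their Fejer means tend to h 0 by continuity, while the series converges absolutely by the
  decay hypothesis, so its sum must agree with the limit of its means. Pairing n with -(n + 1) lists
  every integer once over the naturals.\<close>

lemma poisson_summation_0: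
  fixes H :: "real \<Rightarrow> complex"
  assumes cont: "continuous_on UNIV H" and bd: "\<And>x. cmod (H x) \<le> B" and supp: "\<And>x. real Q < \<bar>x\<bar> \<Longrightarrow> H x = 0"
    and dec: "\<And>x. cmod (ift H x) \<le> C / (1 + \<bar>x\<bar>)\<^sup>2"
  shows "(\<lambda>n. ift H (real n) + ift H (- real (Suc n))) sums (\<Sum>q\<in>{- int Q..int Q}. H (of_int q))"
proof -
  have [measurable]: "H \<in> borel_measurable borel" by (rule borel_measurable_continuous_onI[OF cont])
  have Hint: "integrable lborel H" by (rule integrable_compact_support[OF _ bd supp]) simp
  let ?I = "{-1/2..<1/2::real}"
  let ?Q = "{- int Q..int Q}"
  define h where "h t = (\<Sum>q\<in>?Q. H (t + of_int q))" for t
  define c where "c n = ift H (of_int n)" for n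
  have [measurable]: "h \<in> borel_measurable borel" unfolding h_def[abs_def] by measurable
  have hcont: "continuous_on UNIV h" unfolding h_def[abs_def]
    by (intro continuous_intros continuous_on_compose2[OF cont]) auto
  define M where "M = real (card ?Q) * B"
  have hM: "cmod (h t) \<le> M" for t
    unfolding h_def M_def by (rule order_trans[OF norm_sum sum_bounded_above]) (use bd in auto)
  have M0: "0 \<le> M" using order_trans[OF norm_ge_zero hM[of 0]] .
  have hF_int: "integrable lborel (\<lambda>t. indicator ?I t *\<^sub>R (g t * of_real (fejer N t)))"
    if [measurable]: "g \<in> borel_measurable borel" and g: "\<And>t. cmod (g t) \<le> D" for g D N
  proof (rule integrable_compact_support[where B="D * real N" and R=1])
    fix t
    have D: "0 \<le> D" using order_trans[OF norm_ge_zero g[of t]] .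
    have "cmod (g t) * fejer N t \<le> D * real N"
      using g[of t] fejer_le[of N t] fejer_nonneg[of N t] D by (intro mult_mono) auto
    thus "cmod (indicator ?I t *\<^sub>R (g t * of_real (fejer N t))) \<le> D * real N"
      using D fejer_nonneg[of N t] by (auto simp: indicator_def norm_mult)
  qed (auto simp: indicator_def)
  \<comment> \<open>Unfolding: the integral of H against a kernel of period 1 is that of the
    periodisation over one period.\<close>
  have mean: "(\<Sum>k<N. \<Sum>l<N. c (int k - int l)) / of_nat N =
      (LINT t|lborel. indicator ?I t *\<^sub>R (h t * of_real (fejer N t)))" for N
  proof -
    have "(LINT \<xi>|lborel. H \<xi> * of_real (fejer N \<xi>)) =
       (LINT \<xi>|lborel. (\<Sum>k<N. \<Sum>l<N. H \<xi> * cis (2 * pi * of_int (int k - int l) * \<xi>)) / of_nat N)"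
      unfolding fejer_eq_sum by (simp add: sum_distrib_left)
    also have "\<dots> = (\<Sum>k<N. \<Sum>l<N. c (int k - int l)) / of_nat N"
      unfolding integral_divide_zero c_def ift_def
      by (subst integral_double_sum) (use Hint in \<open>auto intro!: integrable_mult_cis\<close>)
    finally have 1: "(\<Sum>k<N. \<Sum>l<N. c (int k - int l)) / of_nat N = (LINT \<xi>|lborel. H \<xi> * of_real (fejer N \<xi>))" ..
    have F: "fejer N (t + of_int q) = fejer N t" for t q
    proof -
      have "cis (2 * pi * real k * (t + of_int q)) = cis (2 * pi * real k * t)" for k
      proof -
        have "cis (2 * pi * (real k * of_int q)) = 1" by (rule cis_multiple_2pi) simp
        thus ?thesis by (simp add: distrib_left cis_mult[symmetric] mult.assoc)
      qed
      thus ?thesis by (simp add: fejer_def)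
    qed
    \<comment> \<open>Translates of a half-open unit interval partition the line, so exactly one q
      contributes, namely the floor of \<xi> + 1/2.\<close>
    have part: "H \<xi> = (\<Sum>q\<in>?Q. indicator ?I (\<xi> - of_int q) *\<^sub>R H \<xi>)" for \<xi>
    proof (cases "H \<xi> = 0")
      case False
      hence x: "\<bar>\<xi>\<bar> \<le> real Q" using supp by force
      define q0 where "q0 = \<lfloor>\<xi> + 1/2\<rfloor>"
      have q0: "\<xi> - of_int q = \<xi> - of_int q \<and> (\<xi> - of_int q \<in> ?I \<longleftrightarrow> q = q0)" for q
        unfolding q0_def by (auto simp: floor_eq_iff eq_commute[of q])
      have "q0 \<in> ?Q" using x unfolding q0_def by (auto simp: le_floor_iff floor_le_iff)
      have "(\<Sum>q\<in>?Q. indicator ?I (\<xi> - of_int q) *\<^sub>R H \<xi>) = (\<Sum>q\<in>?Q. if q = q0 then H \<xi> else 0)"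
        using q0 by (intro sum.cong) (auto simp: indicator_def)
      thus ?thesis using \<open>q0 \<in> ?Q\<close> by simp
    qed simp
    have shift: "(LINT \<xi>|lborel. indicator ?I (\<xi> - of_int q) *\<^sub>R (H \<xi> * of_real (fejer N \<xi>))) =
       (LINT t|lborel. indicator ?I t *\<^sub>R (H (t + of_int q) * of_real (fejer N t)))" for q
    proof -
      have "(LINT \<xi>|lborel. indicator ?I (\<xi> - of_int q) *\<^sub>R (H \<xi> * of_real (fejer N \<xi>))) =
         \<bar>1\<bar> *\<^sub>R (LINT t|lborel. indicator ?I (of_int q + 1 * t - of_int q) *\<^sub>R (H (of_int q + 1 * t) * of_real (fejer N (of_int q + 1 * t))))"
        by (rule lborel_integral_real_affine) simp
      thus ?thesis by (simp add: F add.commute[of "of_int q"])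
    qed
    have sint: "integrable lborel (\<lambda>\<xi>. indicator ?I (\<xi> - of_int q) *\<^sub>R (H \<xi> * of_real (fejer N \<xi>)))" for q
    proof -
      have "integrable lborel (\<lambda>t. indicator ?I t *\<^sub>R (H (t + of_int q) * of_real (fejer N t)))"
        using bd by (intro hF_int) auto
      from lborel_integrable_real_affine[OF this, of 1 "- of_int q"] show ?thesis
        using F[of _ "- q"] by (simp add: add.commute)
    qed
    have "(LINT \<xi>|lborel. H \<xi> * of_real (fejer N \<xi>)) =
       (LINT \<xi>|lborel. (\<Sum>q\<in>?Q. indicator ?I (\<xi> - of_int q) *\<^sub>R (H \<xi> * of_real (fejer N \<xi>))))"
    proof (rule Bochner_Integration.integral_cong[OF refl])
      fix \<xi>
      have "(\<Sum>q\<in>?Q. indicator ?I (\<xi> - of_int q) *\<^sub>R H \<xi>) * of_real (fejer N \<xi>) =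
          (\<Sum>q\<in>?Q. indicator ?I (\<xi> - of_int q) *\<^sub>R (H \<xi> * of_real (fejer N \<xi>)))"
        by (simp only: sum_distrib_right mult_scaleR_left)
      thus "H \<xi> * of_real (fejer N \<xi>) = (\<Sum>q\<in>?Q. indicator ?I (\<xi> - of_int q) *\<^sub>R (H \<xi> * of_real (fejer N \<xi>)))"
        using part[of \<xi>] by (simp only:)
    qed
    also have "\<dots> = (\<Sum>q\<in>?Q. LINT t|lborel. indicator ?I t *\<^sub>R (H (t + of_int q) * of_real (fejer N t)))"
      by (subst Bochner_Integration.integral_sum[OF sint]) (simp only: shift)
    also have "\<dots> = (LINT t|lborel. (\<Sum>q\<in>?Q. indicator ?I t *\<^sub>R (H (t + of_int q) * of_real (fejer N t))))"
      using bd by (intro Bochner_Integration.integral_sum[symmetric] hF_int) auto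
    also have "\<dots> = (LINT t|lborel. indicator ?I t *\<^sub>R (h t * of_real (fejer N t)))"
      by (simp only: h_def sum_distrib_right scaleR_sum_right)
    finally show ?thesis using 1 by simp
  qed
  have "(\<lambda>N. (\<Sum>k<N. \<Sum>l<N. c (int k - int l)) / of_nat N) \<longlonglongrightarrow> h 0"
  proof (rule LIMSEQ_I)
    fix e :: real assume e: "e > 0"
    have "isCont h 0" using hcont by (simp add: continuous_on_eq_continuous_at)
    then obtain d where d: "d > 0" "\<And>t. \<bar>t\<bar> < d \<Longrightarrow> cmod (h t - h 0) < e / 2"
      using continuous_at_eps_delta[THEN iffD1, rule_format, of 0 h "e/2"] e by (auto simp: dist_norm)
    define d' where "d' = min d (1/2)"
    have d': "0 < d'" "d' \<le> 1/2" "d' \<le> d" using d(1) by (auto simp: d'_def)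
    define a where "a = 1 - cos (2 * pi * d')"
    have "cos (2 * pi * d') < cos 0" using d' by (intro cos_monotone_0_pi) auto
    hence a0: "0 < a" by (simp add: a_def)
    \<comment> \<open>Near 0 continuity gives e / 2. Away from 0 the gap a bounds 1 - cos (2 pi t)
      from below, so that the crude bound 2 M is absorbed by the cosine term, whose Fejer mean
      \<open>fejer_cos\<close> controls.\<close>
    have pt: "cmod (h t - h 0) \<le> e / 2 + 2 * M / a * (1 - cos (2 * pi * t))" if t: "\<bar>t\<bar> \<le> 1/2" for t
    proof (cases "\<bar>t\<bar> < d'")
      case True
      hence "cmod (h t - h 0) < e / 2" using d d' by simp
      moreover have "0 \<le> 2 * M / a * (1 - cos (2 * pi * t))" using M0 a0 by simp
      ultimately show ?thesis by linarith
    next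
      case False
      have "cos (2 * pi * \<bar>t\<bar>) \<le> cos (2 * pi * d')"
        using False t d' by (intro cos_monotone_0_pi_le) auto
      moreover have "cos (2 * pi * \<bar>t\<bar>) = cos (2 * pi * t)" by (cases "t \<ge> 0") auto
      ultimately have "a \<le> 1 - cos (2 * pi * t)" unfolding a_def by linarith
      hence "2 * M / a * a \<le> 2 * M / a * (1 - cos (2 * pi * t))" using M0 a0 by (intro mult_left_mono) auto
      moreover have "cmod (h t - h 0) \<le> 2 * M"
        using norm_triangle_ineq4[of "h t" "h 0"] hM[of t] hM[of 0] by linarith
      ultimately show ?thesis using a0 e by simp
    qed
    have est: "cmod ((\<Sum>k<N. \<Sum>l<N. c (int k - int l)) / of_nat N - h 0) \<le> e / 2 + 2 * M / a * (2 / real N)" if N: "N > 0" for N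
    proof -
      have i0: "integrable lborel (\<lambda>t. indicator ?I t *\<^sub>R (h 0 * of_real (fejer N t)))"
        by (rule hF_int[where D="cmod (h 0)"]) auto
      have ih: "integrable lborel (\<lambda>t. indicator ?I t *\<^sub>R (h t * of_real (fejer N t)))"
        by (rule hF_int[OF _ hM]) simp
      have f1: "integrable lborel (\<lambda>t. indicator ?I t * fejer N t)"
      proof (rule integrable_compact_support[where B="real N" and R=1])
        show "norm (indicator ?I t * fejer N t) \<le> real N" for t
          using fejer_le[of N t] fejer_nonneg[of N t] by (auto simp: indicator_def)
      qed (auto simp: indicator_def)
      have F1: "(LINT t|lborel. indicator ?I t * fejer N t) = 1" using integral_fejer[OF N, of "-1/2"] by simp
      have "(LINT t|lborel. indicator ?I t *\<^sub>R (h 0 * of_real (fejer N t))) = h 0 * of_real (LINT t|lborel. indicator ?I t * fejer N t)"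
        unfolding integral_complex_of_real[symmetric] integral_mult_right_zero[symmetric]
        by (simp add: scaleR_conv_of_real mult_ac)
      hence 0: "(LINT t|lborel. indicator ?I t *\<^sub>R (h 0 * of_real (fejer N t))) = h 0"
        unfolding F1 by simp
      have "(\<Sum>k<N. \<Sum>l<N. c (int k - int l)) / of_nat N - h 0 =
         (LINT t|lborel. indicator ?I t *\<^sub>R (h t * of_real (fejer N t)) - indicator ?I t *\<^sub>R (h 0 * of_real (fejer N t)))"
        unfolding Bochner_Integration.integral_diff[OF ih i0] 0 mean ..
      hence "cmod ((\<Sum>k<N. \<Sum>l<N. c (int k - int l)) / of_nat N - h 0) \<le> (LINT t|lborel. cmod (indicator ?I t *\<^sub>R (h t * of_real (fejer N t)) - indicator ?I t *\<^sub>R (h 0 * of_real (fejer N t))))"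
        by (simp only: integral_norm_bound)
      also have "\<dots> \<le> (LINT t|lborel. e / 2 * (indicator ?I t * fejer N t) + 2 * M / a * (2 / real N) * indicator ?I t)"
      proof (rule integral_mono)
        show "integrable lborel (\<lambda>t. cmod (indicator ?I t *\<^sub>R (h t * of_real (fejer N t)) - indicator ?I t *\<^sub>R (h 0 * of_real (fejer N t))))"
          by (intro integrable_norm Bochner_Integration.integrable_diff ih i0)
        show "integrable lborel (\<lambda>t. e / 2 * (indicator ?I t * fejer N t) + 2 * M / a * (2 / real N) * indicator ?I t)"
          by (intro Bochner_Integration.integrable_add integrable_mult_right f1 integrable_real_indicator) simp_all
        fix t
        show "cmod (indicator ?I t *\<^sub>R (h t * of_real (fejer N t)) - indicator ?I t *\<^sub>R (h 0 * of_real (fejer N t)))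
            \<le> e / 2 * (indicator ?I t * fejer N t) + 2 * M / a * (2 / real N) * indicator ?I t"
        proof (cases "t \<in> ?I")
          case True
          hence t: "\<bar>t\<bar> \<le> 1/2" by auto
          have "cmod ((h t - h 0) * of_real (fejer N t)) = cmod (h t - h 0) * fejer N t"
            using fejer_nonneg[of N t] by (simp add: norm_mult)
          also have "\<dots> \<le> (e / 2 + 2 * M / a * (1 - cos (2 * pi * t))) * fejer N t"
            using pt[OF t] fejer_nonneg by (rule mult_right_mono)
          also have "\<dots> = e / 2 * fejer N t + 2 * M / a * (fejer N t * (1 - cos (2 * pi * t)))"
            by (simp add: algebra_simps)
          also have "\<dots> \<le> e / 2 * fejer N t + 2 * M / a * (2 / real N)"
            using M0 a0 by (intro add_left_mono mult_left_mono fejer_cos) auto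
          finally show ?thesis using True by (simp add: left_diff_distrib)
        qed simp
      qed
      also have "\<dots> = e / 2 * 1 + 2 * M / a * (2 / real N) * 1"
      proof (subst Bochner_Integration.integral_add)
        show "(LINT t|lborel. e / 2 * (indicator ?I t * fejer N t)) + (LINT t|lborel. 2 * M / a * (2 / real N) * indicator ?I t)
            = e / 2 * 1 + 2 * M / a * (2 / real N) * 1"
          unfolding integral_mult_right_zero F1 by simp
      qed (intro integrable_mult_right f1 integrable_real_indicator; simp)+
      finally show ?thesis by simp
    qed
    define Z where "Z = 2 * M / a * 2"
    obtain K :: nat where K: "real K > 2 * Z / e" using reals_Archimedean2 by blast
    show "\<exists>no. \<forall>N\<ge>no. cmod ((\<Sum>k<N. \<Sum>l<N. c (int k - int l)) / of_nat N - h 0) < e"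
    proof (intro exI allI impI)
      fix N assume N: "N \<ge> max K 1"
      hence "2 * Z / e < real N" using K by linarith
      hence "Z < e / 2 * real N" using e by (simp add: pos_divide_less_eq mult_ac)
      hence "Z / real N < e / 2" using N by (simp add: pos_divide_less_eq)
      moreover have "2 * M / a * (2 / real N) = Z / real N" by (simp add: Z_def)
      ultimately have "2 * M / a * (2 / real N) < e / 2" by (simp only:)
      thus "cmod ((\<Sum>k<N. \<Sum>l<N. c (int k - int l)) / of_nat N - h 0) < e"
        using est[of N] N by simp
    qed
  qed
  hence lim1: "(\<lambda>N. (\<Sum>n<N. c 0 + (\<Sum>m<n. c (int (Suc m)) + c (- int (Suc m)))) / of_nat N) \<longlonglongrightarrow> h 0"
    unfolding dirichlet_double_sum .
  have cb: "cmod (c n) \<le> C / (1 + \<bar>of_int n\<bar>)\<^sup>2" for n unfolding c_def by (rule dec)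
  have s1: "summable (\<lambda>n. c (int n))"
    by (rule summable_comparison_test'[OF summable_inverse_square[of C], of 0]) (use cb[of "int _"] in auto)
  have s2: "summable (\<lambda>n. c (- int (Suc n)))"
  proof (rule summable_comparison_test'[OF summable_inverse_square[of C], of 0])
    fix n :: nat
    have C: "0 \<le> C" using order_trans[OF norm_ge_zero cb[of 0]] by simp
    have "C / (1 + \<bar>real_of_int (- int (Suc n))\<bar>)\<^sup>2 \<le> C / (1 + real n)\<^sup>2"
      using C by (intro divide_left_mono power_mono mult_pos_pos) auto
    thus "cmod (c (- int (Suc n))) \<le> C / (1 + real n)\<^sup>2" using cb[of "- int (Suc n)"] by linarith
  qed
  define S where "S = (\<Sum>n. c (int n)) + (\<Sum>n. c (- int (Suc n)))"
  have "(\<lambda>n. (\<Sum>m<Suc n. c (int m)) + (\<Sum>m<n. c (- int (Suc m)))) \<longlonglongrightarrow> S"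
    unfolding S_def by (rule tendsto_add[OF LIMSEQ_Suc[OF summable_LIMSEQ[OF s1]] summable_LIMSEQ[OF s2]])
  moreover have "(\<Sum>m<Suc n. c (int m)) + (\<Sum>m<n. c (- int (Suc m))) = c 0 + (\<Sum>m<n. c (int (Suc m)) + c (- int (Suc m)))" for n
    by (simp only: sum.lessThan_Suc_shift sum.distrib) simp
  ultimately have "(\<lambda>n. c 0 + (\<Sum>m<n. c (int (Suc m)) + c (- int (Suc m)))) \<longlonglongrightarrow> S" by (simp only:)
  from LIMSEQ_unique[OF cesaro_mean[OF this] lim1] have "S = h 0" .
  moreover have "(\<lambda>n. c (int n) + c (- int (Suc n))) sums S"
    unfolding S_def by (rule sums_add[OF summable_sums[OF s1] summable_sums[OF s2]])
  moreover have "c (int n) = ift H (real n)" "c (- int (Suc n)) = ift H (- real (Suc n))" for n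
    unfolding c_def of_int_of_nat_eq of_int_minus by (rule refl)+
  moreover have "h 0 = (\<Sum>q\<in>?Q. H (of_int q))" by (simp add: h_def)
  ultimately show ?thesis by (simp only:)
qed

text \<open>Translating H by u only multiplies its transform by a phase. The condition on Q makes
  the sum include every q for which u + q can meet the support.\<close>

lemma poisson_summation:
  fixes H :: "real \<Rightarrow> complex"
  assumes cont: "continuous_on UNIV H" and bd: "\<And>x. cmod (H x) \<le> B" and supp: "\<And>x. R < \<bar>x\<bar> \<Longrightarrow> H x = 0"
    and dec: "\<And>x. cmod (ift H x) \<le> C / (1 + \<bar>x\<bar>)\<^sup>2" and Q: "R + \<bar>u\<bar> \<le> real Q"
  shows "(\<lambda>n. ift H (real n) * cis (- (2 * pi * real n * u)) + ift H (- real (Suc n)) * cis (2 * pi * real (Suc n) * u))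
           sums (\<Sum>q\<in>{- int Q..int Q}. H (u + of_int q))"
proof -
  have e: "ift (\<lambda>\<xi>. H (u + \<xi>)) x = ift H x * cis (- (2 * pi * x * u))" for x
  proof -
    have "ift H x = \<bar>1\<bar> *\<^sub>R (LINT \<xi>|lborel. H (u + 1 * \<xi>) * cis (2 * pi * x * (u + 1 * \<xi>)))"
      unfolding ift_def by (rule lborel_integral_real_affine) simp
    also have "\<dots> = (LINT \<xi>|lborel. cis (2 * pi * x * u) * (H (u + \<xi>) * cis (2 * pi * x * \<xi>)))"
      by (simp add: cis_mult[symmetric] algebra_simps)
    also have "\<dots> = cis (2 * pi * x * u) * ift (\<lambda>\<xi>. H (u + \<xi>)) x"
      unfolding ift_def by (rule integral_mult_right_zero)
    finally have "ift H x * cis (- (2 * pi * x * u)) =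
        (cis (2 * pi * x * u) * cis (- (2 * pi * x * u))) * ift (\<lambda>\<xi>. H (u + \<xi>)) x" by (simp only: mult_ac)
    thus ?thesis by (simp add: cis_mult)
  qed
  have "(\<lambda>n. ift (\<lambda>\<xi>. H (u + \<xi>)) (real n) + ift (\<lambda>\<xi>. H (u + \<xi>)) (- real (Suc n)))
      sums (\<Sum>q\<in>{- int Q..int Q}. H (u + of_int q))"
  proof (rule poisson_summation_0[where C=C and B=B])
    show "continuous_on UNIV (\<lambda>\<xi>. H (u + \<xi>))"
      by (rule continuous_on_compose2[OF cont]) (auto intro!: continuous_intros)
    show "H (u + x) = 0" if "real Q < \<bar>x\<bar>" for x using that Q by (intro supp) linarith
    show "cmod (ift (\<lambda>\<xi>. H (u + \<xi>)) x) \<le> C / (1 + \<bar>x\<bar>)\<^sup>2" for x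
      using dec[of x] by (simp add: e norm_mult)
  qed (rule bd)
  note S = this
  have E: "ift (\<lambda>\<xi>. H (u + \<xi>)) (real n) + ift (\<lambda>\<xi>. H (u + \<xi>)) (- real (Suc n)) =
      ift H (real n) * cis (- (2 * pi * real n * u)) + ift H (- real (Suc n)) * cis (2 * pi * real (Suc n) * u)" for n
    by (simp only: e[of "real n"] e[of "- real (Suc n)"] mult_minus_left mult_minus_right minus_minus)
  show ?thesis by (rule sums_cong[THEN iffD1, OF E S])
qed

section \<open>Completeness\<close>

text \<open>Vanishing on intervals passes to all Borel sets by induction over their generation, and
  a density all of whose integrals are 0 vanishes almost everywhere. Truncation to [-n, n] provides
  integrability, as g is only locally integrable.\<close>

lemma AE_zero_of_interval_integrals_real:
  fixes g :: "real \<Rightarrow> real"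
  assumes [measurable]: "g \<in> borel_measurable borel"
    and int: "\<And>a b. integrable lborel (\<lambda>x. indicator {a..b} x *\<^sub>R g x)"
    and zero: "\<And>a b. a \<le> b \<Longrightarrow> (LINT x|lborel. indicator {a..b} x *\<^sub>R g x) = 0"
  shows "AE x in lborel. g x = 0"
proof -
  have "AE x in lborel. indicator {- real n..real n} x *\<^sub>R g x = 0" for n
  proof -
    define h where "h x = indicator {- real n..real n} x *\<^sub>R g x" for x
    have hint: "integrable lborel h" unfolding h_def[abs_def] by (rule int)
    have hs: "set_integrable lborel A h" if "A \<in> sets borel" for A
      unfolding set_integrable_def using hint that by (intro integrable_mult_indicator) auto
    have all0: "(LINT x|lborel. h x) = 0" unfolding h_def by (rule zero) simp
    have "(LINT x:A|lborel. h x) = 0" if "A \<in> sets borel" for A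
      using that
    proof (induction rule: borel_set_induct)
      case empty show ?case by (simp add: set_lebesgue_integral_def)
    next
      case (interval a b)
      have e: "indicator {a..b} x *\<^sub>R h x = indicator {max a (- real n)..min b (real n)} x *\<^sub>R g x" for x
        by (auto simp: h_def indicator_def)
      show ?case
      proof (cases "max a (- real n) \<le> min b (real n)")
        case True thus ?thesis unfolding set_lebesgue_integral_def e by (rule zero)
      next
        case False
        hence "{max a (- real n)..min b (real n)} = {}" by auto
        thus ?thesis unfolding set_lebesgue_integral_def e by simp
      qed
    next
      case (compl A)
      have "(LINT x:A|lborel. h x) + (LINT x:-A|lborel. h x) = (LINT x:(A \<union> - A)|lborel. h x)"
        using compl by (intro set_integral_Un[symmetric] hs) auto
      also have "\<dots> = 0" using all0 by (simp add: set_lebesgue_integral_def)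
      finally show ?case using compl by simp
    next
      case (union F)
      have "(LINT x:(\<Union>i. F i)|lborel. h x) = (\<Sum>i. (LINT x:F i|lborel. h x))"
      proof (rule lebesgue_integral_countable_add)
        show "F i \<inter> F j = {}" if "i \<noteq> j" for i j
          using union(1) that by (auto simp: disjoint_family_on_def)
        show "set_integrable lborel (\<Union>i. F i) h" using union by (intro hs) auto
      qed (use union in auto)
      thus ?case using union by simp
    qed
    hence "AE x in lborel. h x = 0"
      using hint by (intro density_unique_real) auto
    thus ?thesis unfolding h_def .
  qed
  hence "AE x in lborel. \<forall>n. indicator {- real n..real n} x *\<^sub>R g x = 0" unfolding AE_all_countable by blast
  thus ?thesis
  proof eventually_elim
    case (elim x)
    obtain n :: nat where "\<bar>x\<bar> \<le> real n" using real_arch_simple by blast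
    thus ?case using elim[rule_format, of n] by (auto simp: indicator_def abs_le_iff)
  qed
qed

lemma AE_zero_of_interval_integrals:
  fixes f :: "real \<Rightarrow> complex"
  assumes [measurable]: "f \<in> borel_measurable borel"
    and int: "\<And>a b. integrable lborel (\<lambda>x. indicator {a..b} x *\<^sub>R f x)"
    and zero: "\<And>a b. a \<le> b \<Longrightarrow> (LINT x|lborel. indicator {a..b} x *\<^sub>R f x) = 0"
  shows "AE x in lborel. f x = 0"
proof -
  have "AE x in lborel. Re (f x) = 0"
  proof (rule AE_zero_of_interval_integrals_real)
    fix a b :: real
    have e: "indicator {a..b} x *\<^sub>R Re (f x) = Re (indicator {a..b} x *\<^sub>R f x)" for x by simp
    show "integrable lborel (\<lambda>x. indicator {a..b} x *\<^sub>R Re (f x))" unfolding e using int by (rule integrable_Re)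
    show "(LINT x|lborel. indicator {a..b} x *\<^sub>R Re (f x)) = 0" if "a \<le> b"
      unfolding e integral_Re[OF int] zero[OF that] by simp
  qed simp
  moreover have "AE x in lborel. Im (f x) = 0"
  proof (rule AE_zero_of_interval_integrals_real)
    fix a b :: real
    have e: "indicator {a..b} x *\<^sub>R Im (f x) = Im (indicator {a..b} x *\<^sub>R f x)" for x by simp
    show "integrable lborel (\<lambda>x. indicator {a..b} x *\<^sub>R Im (f x))" unfolding e using int by (rule integrable_Im)
    show "(LINT x|lborel. indicator {a..b} x *\<^sub>R Im (f x)) = 0" if "a \<le> b"
      unfolding e integral_Im[OF int] zero[OF that] by simp
  qed simp
  ultimately show ?thesis by eventually_elim (simp add: complex_eq_iff)
qed

text \<open>A weighted arithmetic-geometric inequality, equivalent to Cauchy-Schwarz once r is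
  optimised. The parameter later balances a kernel of small norm against f.\<close>

lemma square_integrable_mult:
  fixes f g :: "real \<Rightarrow> complex"
  assumes [measurable]: "f \<in> borel_measurable borel" "g \<in> borel_measurable borel"
    and f: "integrable lborel (\<lambda>x. (cmod (f x))\<^sup>2)" and g: "integrable lborel (\<lambda>x. (cmod (g x))\<^sup>2)"
  shows "integrable lborel (\<lambda>x. f x * cnj (g x))"
    and "r > 0 \<Longrightarrow> (LINT x|lborel. cmod (f x * cnj (g x))) \<le>
           (r * (LINT x|lborel. (cmod (f x))\<^sup>2) + (LINT x|lborel. (cmod (g x))\<^sup>2) / r) / 2"
proof -
  have le: "cmod (f x * cnj (g x)) \<le> (r * (cmod (f x))\<^sup>2 + (cmod (g x))\<^sup>2 / r) / 2" if r: "r > 0" for r x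
  proof -
    have "0 \<le> (r * cmod (f x) - cmod (g x))\<^sup>2 / r" using r by simp
    also have "\<dots> = r * (cmod (f x))\<^sup>2 + (cmod (g x))\<^sup>2 / r - 2 * (cmod (f x) * cmod (g x))"
      using r by (simp add: power2_diff field_simps power2_eq_square)
    finally show ?thesis by (simp add: norm_mult)
  qed
  have i: "integrable lborel (\<lambda>x. (r * (cmod (f x))\<^sup>2 + (cmod (g x))\<^sup>2 / r) / 2)" for r
    using f g by simp
  show int: "integrable lborel (\<lambda>x. f x * cnj (g x))"
  proof (rule Bochner_Integration.integrable_bound[OF i[of 1]])
    show "AE x in lborel. norm (f x * cnj (g x)) \<le> norm ((1 * (cmod (f x))\<^sup>2 + (cmod (g x))\<^sup>2 / 1) / 2)"
      unfolding real_norm_def by (intro AE_I2 order_trans[OF le[OF zero_less_one] abs_ge_self])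
  qed simp
  assume r: "r > 0"
  have "(LINT x|lborel. cmod (f x * cnj (g x))) \<le> (LINT x|lborel. (r * (cmod (f x))\<^sup>2 + (cmod (g x))\<^sup>2 / r) / 2)"
    by (rule integral_mono[OF integrable_norm[OF int] i le[OF r]])
  also have "\<dots> = (r * (LINT x|lborel. (cmod (f x))\<^sup>2) + (LINT x|lborel. (cmod (g x))\<^sup>2) / r) / 2"
    using f g by simp
  finally show "(LINT x|lborel. cmod (f x * cnj (g x))) \<le>
           (r * (LINT x|lborel. (cmod (f x))\<^sup>2) + (LINT x|lborel. (cmod (g x))\<^sup>2) / r) / 2" .
qed

section \<open>Resolving test functions into wavelets of finitely many scales\<close>

context meyer
begin

lemma psihat_aliasing:
  "psihat u * cnj (psihat (u + of_int q)) = of_real ((if even q then 1 else -1) * (b u * b (u + of_int q)))"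
proof -
  have "cis (pi * u) * cnj (cis (pi * (u + of_int q))) = cis (- (pi * of_int q))"
    by (simp add: cis_cnj cis_mult distrib_left)
  also have "\<dots> = of_real (if even q then 1 else -1)"
  proof (cases "even q")
    case True
    then obtain m where "q = 2 * m" by blast
    hence "- (pi * of_int q) = 2 * pi * of_int (- m)" by simp
    moreover have "cis (2 * pi * of_int (- m)) = 1" by (rule cis_multiple_2pi) simp
    ultimately show ?thesis using True by (simp only:) simp
  next
    case False
    then obtain m where m: "q = 2 * m + 1" by (rule oddE)
    have "- (pi * of_int q) = 2 * pi * of_int (- m) + (- pi)" using m by (simp add: algebra_simps)
    hence "cis (- (pi * of_int q)) = cis (2 * pi * of_int (- m)) * cis (- pi)" by (simp only: cis_mult)
    also have "cis (2 * pi * of_int (- m)) = 1" by (rule cis_multiple_2pi) simp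
    finally show ?thesis using False by (simp add: complex_eq_iff)
  qed
  finally show ?thesis unfolding psihat_def by (simp add: mult_ac)
qed

lemma powr_shift: "2 powr real_of_int (j + 1) = 2 * 2 powr real_of_int j"
  by (simp add: powr_add)

text \<open>A telescoping sum over scales. The term q = 0 is a difference of p at consecutive
  scales. The terms q = 1, -1 enter with a minus sign, and \<open>b_aliasing\<close> identifies q =
  2, -2 at one scale with q = 1, -1 at the next, so these telescope too; |q| = 3 is excluded by the
  supports. The hypotheses on G remove the aliasing terms at both ends, and where G is nonzero they
  make p equal to 0 at the lower end and to 1 at the upper end.\<close>

lemma frequency_reconstruction:
  fixes G :: "real \<Rightarrow> complex" and j0 :: int
  assumes G0: "\<And>\<xi>. \<bar>\<xi>\<bar> \<le> 4/3 * 2 powr real_of_int j0 \<Longrightarrow> G \<xi> = 0"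
    and G1: "\<And>\<xi>. 1/3 * 2 powr real_of_int (j0 + int N) \<le> \<bar>\<xi>\<bar> \<Longrightarrow> G \<xi> = 0"
  defines "s \<equiv> \<lambda>n. 2 powr real_of_int (j0 + int n)"
  shows "(\<Sum>n<N. psihat (\<xi> / s n) * (\<Sum>q\<in>{-3..3}. G (s n * (\<xi> / s n + of_int q)) * cnj (psihat (\<xi> / s n + of_int q)))) = G \<xi>"
proof -
  have s0: "s n > 0" for n by (simp add: s_def)
  have sS: "s (Suc n) = 2 * s n" for n using powr_shift[of "j0 + int n"] by (simp add: s_def add_ac)
  define t where "t n = G (\<xi> + s n) * of_real (b (\<xi> / s n) * b (\<xi> / s n + 1)) +
      G (\<xi> - s n) * of_real (b (\<xi> / s n) * b (\<xi> / s n - 1))" for n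
  define P where "P n = G \<xi> * of_real (p (\<xi> / s n))" for n
  have step: "psihat (\<xi> / s n) * (\<Sum>q\<in>{-3..3}. G (s n * (\<xi> / s n + of_int q)) * cnj (psihat (\<xi> / s n + of_int q)))
      = (P (Suc n) - P n) + (t (Suc n) - t n)" for n
  proof -
    define u where "u = \<xi> / s n"
    have u: "\<xi> / s (Suc n) = u / 2" "s n * u = \<xi>" using s0[of n] by (auto simp: u_def sS)
    have "{-3..3} = {-3, -2, -1, 0, 1, 2, 3::int}" by auto
    hence "psihat u * (\<Sum>q\<in>{-3..3}. G (s n * (u + of_int q)) * cnj (psihat (u + of_int q))) =
       (\<Sum>q\<in>{-3, -2, -1, 0, 1, 2, 3::int}. G (s n * (u + of_int q)) * (psihat u * cnj (psihat (u + of_int q))))"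
      by (simp only: sum_distrib_left mult_ac)
    also have "\<dots> = (\<Sum>q\<in>{-3, -2, -1, 0, 1, 2, 3::int}. G (\<xi> + s n * of_int q) *
        of_real ((if even q then 1 else -1) * (b u * b (u + of_int q))))"
      unfolding psihat_aliasing distrib_left u ..
    also have "\<dots> = - (G (\<xi> - 3 * s n) * of_real (b u * b (u - 3))) + G (\<xi> - 2 * s n) * of_real (b u * b (u - 2))
        - G (\<xi> - s n) * of_real (b u * b (u - 1)) + G \<xi> * of_real (b u * b u)
        - G (\<xi> + s n) * of_real (b u * b (u + 1)) + G (\<xi> + 2 * s n) * of_real (b u * b (u + 2))
        - G (\<xi> + 3 * s n) * of_real (b u * b (u + 3))"
      by (simp add: mult.commute[of "s n"] del: of_real_mult)
    also have "b u * b (u - 3) = 0" using b_outer[of u] b_outer[of "u - 3"] by (cases "4/3 \<le> \<bar>u\<bar>") auto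
    also have "b u * b (u + 3) = 0" using b_outer[of u] b_outer[of "u + 3"] by (cases "4/3 \<le> \<bar>u\<bar>") auto
    also have "b u * b (u + 2) = b (u / 2) * b (u / 2 + 1)" using b_aliasing[of "u / 2"] by simp
    also have "b u * b (u - 2) = b (u / 2) * b (u / 2 - 1)"
      using b_aliasing[of "u / 2 - 1"] by (simp add: right_diff_distrib mult.commute)
    also have "b u * b u = p (u / 2) - p u" using b_square[of u] by (simp add: power2_eq_square)
    finally show ?thesis unfolding t_def P_def u u_def[symmetric] unfolding sS by (simp add: algebra_simps)
  qed
  have "t 0 = 0"
  proof -
    have z: "G (\<xi> + s 0 * of_int q) * of_real (b (\<xi> / s 0) * b (\<xi> / s 0 + of_int q)) = 0" for q
    proof (cases "4/3 \<le> \<bar>\<xi> / s 0 + of_int q\<bar>")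
      case False
      have "\<bar>\<xi> + s 0 * of_int q\<bar> = s 0 * \<bar>\<xi> / s 0 + of_int q\<bar>"
        using s0[of 0] by (simp add: abs_mult_pos[symmetric] field_simps)
      also have "\<dots> \<le> s 0 * (4/3)" using False s0[of 0] by (intro mult_left_mono) auto
      finally show ?thesis using G0[of "\<xi> + s 0 * of_int q"] by (simp add: s_def mult.commute)
    qed (use b_outer in simp)
    show ?thesis using z[of 1] z[of "-1"] by (auto simp: t_def)
  qed
  moreover have "t N = 0"
  proof -
    have z: "G (\<xi> + s N * of_int q) * of_real (b (\<xi> / s N) * b (\<xi> / s N + of_int q)) = 0" for q
    proof (cases "\<bar>\<xi> / s N + of_int q\<bar> \<le> 1/3")
      case False
      have "s N * (1/3) \<le> s N * \<bar>\<xi> / s N + of_int q\<bar>" using False s0[of N] by (intro mult_left_mono) auto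
      also have "\<dots> = \<bar>\<xi> + s N * of_int q\<bar>"
        using s0[of N] by (simp add: abs_mult_pos[symmetric] field_simps)
      finally show ?thesis using G1[of "\<xi> + s N * of_int q"] by (simp add: s_def mult.commute)
    qed (use b_inner in simp)
    show ?thesis using z[of 1] z[of "-1"] by (auto simp: t_def)
  qed
  moreover have "P N - P 0 = G \<xi>"
  proof (cases "G \<xi> = 0")
    case False
    hence "\<bar>\<xi>\<bar> > 4/3 * s 0" "\<bar>\<xi>\<bar> < 1/3 * s N" using G0[of \<xi>] G1[of \<xi>] by (force simp: s_def)+
    hence "\<bar>\<xi> / s N\<bar> \<le> 1/3" "2/3 \<le> \<bar>\<xi> / s 0\<bar>"
      using s0[of 0] s0[of N] by (auto simp: field_simps)
    thus ?thesis unfolding P_def by (simp add: p_eq_1 p_eq_0)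
  qed (simp add: P_def)
  ultimately show ?thesis
    unfolding step by (simp add: sum.distrib sum_lessThan_telescope)
qed

lemma psi_square_integrable: "integrable lborel (\<lambda>x. (cmod (psi x))\<^sup>2)"
  using L2_psi unfolding L2_def by (subst (asm) integrable_completion) auto

lemma wavelet_system_square:
  "integrable lborel (\<lambda>x. (cmod (wavelet_system psi j k x))\<^sup>2)"
  "(LINT x|lborel. (cmod (wavelet_system psi j k x))\<^sup>2) = (LINT x|lborel. (cmod (psi x))\<^sup>2)"
proof -
  define s where "s = 2 powr real_of_int j"
  have s: "s > 0" "s \<noteq> 0" by (auto simp: s_def)
  have "(2 powr (real_of_int j / 2))\<^sup>2 = s"
    unfolding s_def power2_eq_square powr_add[symmetric] by simp
  hence e: "(cmod (wavelet_system psi j k x))\<^sup>2 = s * (cmod (psi (- real_of_int k + s * x)))\<^sup>2" for x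
    unfolding wavelet_system_def s_def[symmetric] by (simp add: norm_mult power_mult_distrib)
  show "integrable lborel (\<lambda>x. (cmod (wavelet_system psi j k x))\<^sup>2)"
    unfolding e by (intro integrable_mult_right lborel_integrable_real_affine[OF psi_square_integrable] s)
  show "(LINT x|lborel. (cmod (wavelet_system psi j k x))\<^sup>2) = (LINT x|lborel. (cmod (psi x))\<^sup>2)"
    unfolding e integral_mult_right_zero
    using lborel_integral_real_affine[OF s(2), of "\<lambda>x. (cmod (psi x))\<^sup>2" "- real_of_int k"] s by simp
qed

text \<open>Poisson summation expands the periodised sum into a Fourier series in \<xi> / 2^j with
  coefficients \<open>ift H\<close>, so D is an absolutely convergent combination of transforms of
  wavelets of scale j. Orthogonality to each of them passes to the sum.\<close>

lemma perp_periodized: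
  fixes H f :: "real \<Rightarrow> complex" and j :: int
  assumes [measurable]: "f \<in> borel_measurable borel" and f2: "integrable lborel (\<lambda>x. (cmod (f x))\<^sup>2)"
    and perp: "\<And>k. (LINT x|lborel. f x * cnj (wavelet_system psi j k x)) = 0"
    and H: "continuous_on UNIV H" "\<And>x. cmod (H x) \<le> B" "\<And>x. 4/3 < \<bar>x\<bar> \<Longrightarrow> H x = 0"
      "\<And>x. cmod (ift H x) \<le> C / (1 + \<bar>x\<bar>)\<^sup>2"
  defines "D \<equiv> \<lambda>\<xi>. psihat (\<xi> / 2 powr real_of_int j) * (\<Sum>q\<in>{-3..3}. H (\<xi> / 2 powr real_of_int j + of_int q))"
  shows "integrable lborel D" "integrable lborel (\<lambda>x. f x * cnj (ift D x))" "(LINT x|lborel. f x * cnj (ift D x)) = 0"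
proof -
  define s where "s = 2 powr real_of_int j"
  have s: "s > 0" "s \<noteq> 0" by (auto simp: s_def)
  define c where "c = 2 powr (real_of_int j / 2)"
  have c0: "c > 0" by (simp add: c_def)
  have [measurable]: "H \<in> borel_measurable borel" by (rule borel_measurable_continuous_onI[OF H(1)])
  have C: "0 \<le> C" using order_trans[OF norm_ge_zero H(4)[of 0]] by simp
  define \<alpha> where "\<alpha> n = ift H (real n)" for n
  define \<beta> where "\<beta> n = ift H (- real (Suc n))" for n
  define \<gamma> where "\<gamma> n = cmod (\<alpha> n) + cmod (\<beta> n)" for n
  \<comment> \<open>The n-th term carries the translates n and -(n + 1), matching
    \<open>poisson_summation\<close>; the factor c undoes the normalisation in
    \<open>Psi\<close>.\<close>
  define t where "t n \<xi> = of_real c * (\<alpha> n * Psi j (int n) \<xi> + \<beta> n * Psi j (- int (Suc n)) \<xi>)" for n \<xi>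
  have \<gamma>0: "0 \<le> \<gamma> n" for n by (simp add: \<gamma>_def)
  have \<gamma>s: "summable \<gamma>"
  proof (rule summable_comparison_test'[OF summable_inverse_square[of "2 * C"], of 0])
    fix n :: nat
    have "C / (1 + \<bar>- real (Suc n)\<bar>)\<^sup>2 \<le> C / (1 + real n)\<^sup>2"
      using C by (intro divide_left_mono power_mono mult_pos_pos) auto
    thus "norm (\<gamma> n) \<le> 2 * C / (1 + real n)\<^sup>2"
      using H(4)[of "real n"] H(4)[of "- real (Suc n)"] unfolding \<gamma>_def \<alpha>_def \<beta>_def by simp
  qed
  have cPsi: "of_real c * Psi j k \<xi> = psihat (\<xi> / s) * cis (- (2 * pi * real_of_int k * (\<xi> / s)))" for k \<xi>
  proof -
    have "c * 2 powr (- real_of_int j / 2) = 1" unfolding c_def powr_add[symmetric] by simp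
    hence "of_real c * complex_of_real (2 powr (- real_of_int j / 2)) = 1" by (simp only: of_real_mult[symmetric] of_real_1)
    moreover have "2 * pi * (- real_of_int k / s) * \<xi> = - (2 * pi * real_of_int k * (\<xi> / s))" by simp
    moreover have "1 / s * \<xi> = \<xi> / s" by simp
    ultimately show ?thesis unfolding Psi_def s_def[symmetric]
      by (simp only: mult.assoc[symmetric]) (simp only: mult_1 mult.commute)
  qed
  have t_eq: "t n \<xi> = psihat (\<xi> / s) * (\<alpha> n * cis (- (2 * pi * real n * (\<xi> / s))) + \<beta> n * cis (2 * pi * real (Suc n) * (\<xi> / s)))" for n \<xi>
  proof -
    have "t n \<xi> = \<alpha> n * (of_real c * Psi j (int n) \<xi>) + \<beta> n * (of_real c * Psi j (- int (Suc n)) \<xi>)"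
      unfolding t_def by (simp only: distrib_left mult_ac)
    moreover have "- (2 * pi * real_of_int (- int (Suc n)) * (\<xi> / s)) = 2 * pi * real (Suc n) * (\<xi> / s)"
      by (simp only: of_int_minus of_int_of_nat_eq mult_minus_left mult_minus_right minus_minus)
    ultimately show ?thesis unfolding cPsi by (simp only: of_int_of_nat_eq distrib_left mult_ac)
  qed
  have tD: "(\<lambda>n. t n \<xi>) sums D \<xi>" for \<xi>
  proof (cases "4/3 < \<bar>\<xi> / s\<bar>")
    case True
    hence "psihat (\<xi> / s) = 0" using b_outer[of "\<xi> / s"] by (simp add: psihat_def)
    thus ?thesis unfolding t_eq D_def s_def[symmetric] by simp
  next
    case False
    have u: "\<bar>\<xi> / s\<bar> \<le> 4/3" using False by (simp only: not_less)
    \<comment> \<open>The supports of \<open>psihat\<close> and H both end at 4/3, and 4/3 + 4/3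
      \<le> 3 explains the range -3..3.\<close>
    have Q3: "4/3 + \<bar>\<xi> / s\<bar> \<le> real 3" by (rule order_trans[OF add_left_mono[OF u]]) simp
    have "(\<lambda>n. \<alpha> n * cis (- (2 * pi * real n * (\<xi> / s))) + \<beta> n * cis (2 * pi * real (Suc n) * (\<xi> / s)))
       sums (\<Sum>q\<in>{- int 3..int 3}. H (\<xi> / s + of_int q))"
      unfolding \<alpha>_def \<beta>_def by (rule poisson_summation[where R="4/3", OF H Q3])
    from sums_mult[OF this, of "psihat (\<xi> / s)"] show ?thesis
      unfolding t_eq D_def s_def[symmetric] by simp
  qed
  define e where "e \<xi> = cmod (psihat (\<xi> / s))" for \<xi>
  have eint: "integrable lborel e"
    using lborel_integrable_real_affine[OF integrable_norm[OF psihat_integrable], of "1 / s" 0] s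
    unfolding e_def[abs_def] by simp
  have tle: "cmod (t n \<xi>) \<le> \<gamma> n * e \<xi>" for n \<xi>
  proof -
    have "cmod (\<alpha> n * cis (- (2 * pi * real n * (\<xi> / s))) + \<beta> n * cis (2 * pi * real (Suc n) * (\<xi> / s))) \<le> \<gamma> n"
      by (rule order_trans[OF norm_triangle_ineq]) (simp add: norm_mult \<gamma>_def)
    from mult_right_mono[OF this norm_ge_zero[of "psihat (\<xi> / s)"]] show ?thesis
      unfolding t_eq norm_mult[of "psihat (\<xi> / s)"] e_def by (simp only: mult.commute)
  qed
  have tint: "integrable lborel (t n)" for n
    unfolding t_def[abs_def] by (intro integrable_mult_right Bochner_Integration.integrable_add Psi_integrable)
  have tn: "(LINT \<xi>|lborel. cmod (t n \<xi>)) \<le> \<gamma> n * (LINT \<xi>|lborel. e \<xi>)" for n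
  proof -
    have "(LINT \<xi>|lborel. cmod (t n \<xi>)) \<le> (LINT \<xi>|lborel. \<gamma> n * e \<xi>)"
      by (rule integral_mono[OF integrable_norm[OF tint] integrable_mult_right[OF eint] tle])
    thus ?thesis by simp
  qed
  have sumt: "summable (\<lambda>n. LINT \<xi>|lborel. cmod (t n \<xi> * cis (2 * pi * x * \<xi>)))" for x
    by (rule summable_comparison_test'[OF summable_mult2[OF \<gamma>s, of "LINT \<xi>|lborel. e \<xi>"], of 0])
       (use tn in \<open>simp add: norm_mult\<close>)
  have sumtp: "summable (\<lambda>n. norm (t n \<xi> * cis (2 * pi * x * \<xi>)))" for x \<xi>
    by (rule summable_comparison_test'[OF summable_mult2[OF \<gamma>s, of "e \<xi>"], of 0])
       (use tle in \<open>simp add: norm_mult\<close>)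
  have sD: "(\<Sum>n. t n \<xi> * cis (2 * pi * x * \<xi>)) = D \<xi> * cis (2 * pi * x * \<xi>)" for x \<xi>
    using sums_mult2[OF tD] by (simp add: sums_iff)
  have "integrable lborel (\<lambda>\<xi>. (\<Sum>n. t n \<xi> * cis (2 * pi * 0 * \<xi>)))"
    by (rule integrable_suminf) (use tint sumtp[of _ 0] sumt[of 0] in \<open>auto\<close>)
  thus "integrable lborel D" unfolding sD by simp
  have iD: "(\<lambda>n. ift (t n) x) sums ift D x" for x
    unfolding ift_def[of D] sD[symmetric] unfolding ift_def
    by (rule sums_integral) (use tint sumtp[of _ x] sumt[of x] in \<open>auto intro!: integrable_mult_cis\<close>)
  have it: "ift (t n) x = of_real c * (\<alpha> n * wavelet_system psi j (int n) x + \<beta> n * wavelet_system psi j (- int (Suc n)) x)" for n x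
  proof -
    have i: "integrable lborel (\<lambda>\<xi>. Psi j k \<xi> * cis (2 * pi * x * \<xi>))" for k
      by (rule integrable_mult_cis[OF Psi_integrable]) simp
    have "ift (t n) x = (LINT \<xi>|lborel. of_real c * (\<alpha> n * (Psi j (int n) \<xi> * cis (2 * pi * x * \<xi>)) +
        \<beta> n * (Psi j (- int (Suc n)) \<xi> * cis (2 * pi * x * \<xi>))))"
      unfolding ift_def t_def by (simp only: distrib_right mult.assoc)
    also have "\<dots> = of_real c * (\<alpha> n * ift (Psi j (int n)) x + \<beta> n * ift (Psi j (- int (Suc n))) x)"
      unfolding ift_def integral_mult_right_zero
      by (subst Bochner_Integration.integral_add[OF integrable_mult_right[OF i] integrable_mult_right[OF i]])
         (simp only: integral_mult_right_zero)
    finally show ?thesis by (simp only: ift_Psi)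
  qed
  \<comment> \<open>All wavelets have the same norm, so one constant bounds every pairing with f and
    summability rests on the coefficients alone.\<close>
  define A where "A = ((LINT x|lborel. (cmod (f x))\<^sup>2) + (LINT x|lborel. (cmod (psi x))\<^sup>2)) / 2"
  have fw: "integrable lborel (\<lambda>x. f x * cnj (wavelet_system psi j k x))"
    "(LINT x|lborel. cmod (f x * cnj (wavelet_system psi j k x))) \<le> A" for k
    using square_integrable_mult(1)[OF _ _ f2 wavelet_system_square(1)[of j k]]
      square_integrable_mult(2)[OF _ _ f2 wavelet_system_square(1)[of j k], of 1]
    by (auto simp: A_def wavelet_system_square(2))
  have ft: "f x * cnj (ift (t n) x) = of_real c * (cnj (\<alpha> n) * (f x * cnj (wavelet_system psi j (int n) x)) +
     cnj (\<beta> n) * (f x * cnj (wavelet_system psi j (- int (Suc n)) x)))" for n x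
    unfolding it by (simp only: complex_cnj_mult complex_cnj_add complex_cnj_complex_of_real distrib_left mult_ac)
  have fti: "integrable lborel (\<lambda>x. f x * cnj (ift (t n) x))" for n
    unfolding ft by (intro integrable_mult_right Bochner_Integration.integrable_add fw)
  have ft0: "(LINT x|lborel. f x * cnj (ift (t n) x)) = 0" for n
    unfolding ft integral_mult_right_zero
    by (subst Bochner_Integration.integral_add[OF integrable_mult_right[OF fw(1)] integrable_mult_right[OF fw(1)]])
       (simp only: integral_mult_right_zero perp mult_zero_right add_0)
  have ftn: "(LINT x|lborel. cmod (f x * cnj (ift (t n) x))) \<le> \<gamma> n * (c * A)" for n
  proof -
    let ?w = "\<lambda>k x. f x * cnj (wavelet_system psi j k x)"
    have "(LINT x|lborel. cmod (f x * cnj (ift (t n) x))) \<le>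
       (LINT x|lborel. c * (cmod (\<alpha> n) * cmod (?w (int n) x) + cmod (\<beta> n) * cmod (?w (- int (Suc n)) x)))"
    proof (rule integral_mono[OF integrable_norm[OF fti]])
      show "integrable lborel (\<lambda>x. c * (cmod (\<alpha> n) * cmod (?w (int n) x) + cmod (\<beta> n) * cmod (?w (- int (Suc n)) x)))"
        by (intro integrable_mult_right Bochner_Integration.integrable_add integrable_norm fw)
      show "cmod (f x * cnj (ift (t n) x)) \<le> c * (cmod (\<alpha> n) * cmod (?w (int n) x) + cmod (\<beta> n) * cmod (?w (- int (Suc n)) x))" for x
      proof -
        have "cmod (cnj (\<alpha> n) * ?w (int n) x + cnj (\<beta> n) * ?w (- int (Suc n)) x) \<le>
            cmod (\<alpha> n) * cmod (?w (int n) x) + cmod (\<beta> n) * cmod (?w (- int (Suc n)) x)"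
          by (rule order_trans[OF norm_triangle_ineq]) (simp only: norm_mult complex_mod_cnj order_refl)
        from mult_left_mono[OF this less_imp_le[OF c0]] show ?thesis
          unfolding ft norm_mult[of "of_real c"] using c0 by simp
      qed
    qed
    also have "\<dots> = c * (cmod (\<alpha> n) * (LINT x|lborel. cmod (?w (int n) x)) + cmod (\<beta> n) * (LINT x|lborel. cmod (?w (- int (Suc n)) x)))"
      unfolding integral_mult_right_zero
      by (subst Bochner_Integration.integral_add[OF integrable_mult_right[OF integrable_norm[OF fw(1)]] integrable_mult_right[OF integrable_norm[OF fw(1)]]])
         (simp only: integral_mult_right_zero)
    also have "\<dots> \<le> c * (cmod (\<alpha> n) * A + cmod (\<beta> n) * A)"
      using fw(2) c0 by (intro mult_left_mono add_mono) auto
    finally show ?thesis by (simp add: \<gamma>_def algebra_simps)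
  qed
  have sf: "summable (\<lambda>n. LINT x|lborel. norm (f x * cnj (ift (t n) x)))"
    by (rule summable_comparison_test'[OF summable_mult2[OF \<gamma>s, of "c * A"], of 0]) (use ftn in simp)
  have sfp: "summable (\<lambda>n. norm (f x * cnj (ift (t n) x)))" for x
  proof (rule summable_comparison_test'[OF summable_mult2[OF \<gamma>s, of "cmod (f x) * (LINT \<xi>|lborel. e \<xi>)"], of 0])
    fix n :: nat
    have "cmod (f x) * cmod (ift (t n) x) \<le> cmod (f x) * (\<gamma> n * (LINT \<xi>|lborel. e \<xi>))"
      by (intro mult_left_mono order_trans[OF norm_ift_le[OF tint] tn]) simp
    thus "norm (norm (f x * cnj (ift (t n) x))) \<le> \<gamma> n * (cmod (f x) * (LINT \<xi>|lborel. e \<xi>))"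
      by (simp add: norm_mult mult_ac)
  qed
  have fD: "(\<Sum>n. f x * cnj (ift (t n) x)) = f x * cnj (ift D x)" for x
    using sums_mult[OF sums_cnj[THEN iffD2, OF iD], of "f x"] by (simp add: sums_iff)
  have "integrable lborel (\<lambda>x. (\<Sum>n. f x * cnj (ift (t n) x)))"
    by (rule integrable_suminf) (use fti sfp sf in auto)
  thus "integrable lborel (\<lambda>x. f x * cnj (ift D x))" unfolding fD .
  have "(\<lambda>n. LINT x|lborel. f x * cnj (ift (t n) x)) sums (LINT x|lborel. (\<Sum>n. f x * cnj (ift (t n) x)))"
    by (rule sums_integral) (use fti sfp sf in auto)
  thus "(LINT x|lborel. f x * cnj (ift D x)) = 0" unfolding fD ft0 by (simp add: sums_iff)
qed

end

lemma decay_shift: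
  assumes "\<And>x. cmod (\<phi> x) \<le> C / (1 + \<bar>x\<bar>)\<^sup>2"
  shows "cmod (\<phi> (x + a)) \<le> C * (1 + \<bar>a\<bar>)\<^sup>2 / (1 + \<bar>x\<bar>)\<^sup>2"
proof -
  have C: "0 \<le> C" using order_trans[OF norm_ge_zero assms[of 0]] by simp
  have "(1 + \<bar>(x + a) + (- a)\<bar>)\<^sup>2 \<le> (1 + \<bar>x + a\<bar>)\<^sup>2 * (1 + \<bar>- a\<bar>)\<^sup>2"
    using submult_weight_poly unfolding submult_weight_def by blast
  hence "C * (1 + \<bar>x\<bar>)\<^sup>2 \<le> C * ((1 + \<bar>x + a\<bar>)\<^sup>2 * (1 + \<bar>a\<bar>)\<^sup>2)" using C by (intro mult_left_mono) auto
  hence "C / (1 + \<bar>x + a\<bar>)\<^sup>2 \<le> C * (1 + \<bar>a\<bar>)\<^sup>2 / (1 + \<bar>x\<bar>)\<^sup>2"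
    by (simp add: pos_divide_le_eq pos_le_divide_eq add_pos_nonneg mult_ac)
  with assms[of "x + a"] show ?thesis by linarith
qed

lemma ex_dyadic_below: "x > 0 \<Longrightarrow> \<exists>j::int. 2 powr real_of_int j \<le> x"
proof (intro exI)
  assume "x > 0"
  have "2 powr real_of_int \<lfloor>log 2 x\<rfloor> \<le> 2 powr log 2 x" by (intro powr_mono) auto
  thus "2 powr real_of_int \<lfloor>log 2 x\<rfloor> \<le> x" using \<open>x > 0\<close> by simp
qed

lemma ex_dyadic_above: "\<exists>N::nat. x \<le> 2 powr real_of_int (j + int N)"
proof
  define N where "N = nat (\<lceil>log 2 (max x 1)\<rceil> - j)"
  have "x \<le> 2 powr log 2 (max x 1)" by simp
  also have "\<dots> \<le> 2 powr real_of_int (j + int N)" unfolding N_def by (intro powr_mono) linarith+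
  finally show "x \<le> 2 powr real_of_int (j + int N)" .
qed

section \<open>The mollifying kernel\<close>

context meyer
begin

definition K :: "real \<Rightarrow> complex" where "K = ift (\<lambda>\<xi>. of_real (\<kappa> \<xi>))"

lemma K_measurable [measurable]: "K \<in> borel_measurable borel" unfolding K_def by simp

lemma K_decay: "cmod (K x) \<le> C\<kappa> / (1 + \<bar>x\<bar>)\<^sup>2"
proof -
  have C: "0 \<le> C\<kappa>" using order_trans[OF norm_ge_zero ift_\<kappa>[of 0]] by simp
  have "C\<kappa> / (1 + \<bar>x\<bar>) ^ 4 \<le> C\<kappa> / (1 + \<bar>x\<bar>)\<^sup>2"
    using C by (intro divide_left_mono power_increasing mult_pos_pos) (auto simp: add_pos_nonneg)
  thus ?thesis using ift_\<kappa>[of x] unfolding K_def by linarith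
qed

lemma K_integrable: "integrable lborel K" by (rule integrable_decay[OF _ K_decay]) simp

lemma \<kappa>_cont: "continuous_on UNIV (\<lambda>\<xi>. complex_of_real (\<kappa> (s * \<xi>)))"
  by (intro continuous_intros continuous_on_compose2[OF transition_continuous[OF \<kappa>]]) auto

lemma \<kappa>_norm: "cmod (of_real (\<kappa> \<xi>)) \<le> 1"
  using transitionD(1,2)[OF \<kappa>, of \<xi>] by simp

lemma \<kappa>_scaled_integrable: "s \<noteq> 0 \<Longrightarrow> integrable lborel (\<lambda>\<xi>. complex_of_real (\<kappa> (s * \<xi>)))"
  using lborel_integrable_real_affine[OF transition_integrable[OF \<kappa>], of s 0] by simp

text \<open>Inversion at 0. Because \<kappa> 0 = 1, the dilates of K form an approximate
  identity.\<close>

lemma integral_K: "(LINT x|lborel. K x) = 1"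
proof -
  have "(LINT x|lborel. K x) = ift (ift (\<lambda>\<xi>. of_real (\<kappa> \<xi>))) (- 0)" unfolding K_def ift_def[of "ift _"] by simp
  also have "\<dots> = of_real (\<kappa> 0)"
    by (rule ift_inversion[where B=1])
       (use \<kappa>_scaled_integrable[of 1] \<kappa>_cont[of 1] \<kappa>_norm K_integrable in \<open>auto simp: K_def\<close>)
  finally show ?thesis by (simp add: \<kappa>_eq_1)
qed

lemma K_square_integrable: "integrable lborel (\<lambda>x. (cmod (K x))\<^sup>2)"
proof (rule Bochner_Integration.integrable_bound)
  show "integrable lborel (\<lambda>x. C\<kappa> * cmod (K x))" using K_integrable by simp
  show "AE x in lborel. norm ((cmod (K x))\<^sup>2) \<le> norm (C\<kappa> * cmod (K x))"
  proof (intro AE_I2)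
    fix x
    have C: "0 \<le> C\<kappa>" using order_trans[OF norm_ge_zero ift_\<kappa>[of 0]] by simp
    hence "C\<kappa> / (1 + \<bar>x\<bar>)\<^sup>2 \<le> C\<kappa> / 1" by (intro divide_left_mono) (auto simp: add_pos_nonneg)
    hence "cmod (K x) \<le> C\<kappa>" using K_decay[of x] by simp
    from mult_right_mono[OF this norm_ge_zero[of "K x"]] show "norm ((cmod (K x))\<^sup>2) \<le> norm (C\<kappa> * cmod (K x))"
      unfolding power2_eq_square using C by simp
  qed
qed simp

text \<open>\<open>norm_ift_mult_le\<close> with weight (1 + |x|)^2 asks the cutoff to decay by a
  further square, which is where the fourth power of \<open>ift_\<kappa>\<close> enters. The
  constant may depend on s, as only finitely many scales occur.\<close>

lemma decay_scaled_product:
  assumes s: "s > 0"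
  shows "\<exists>C. \<forall>x. cmod (ift (\<lambda>\<xi>. of_real (\<kappa> (s * \<xi>)) * cnj (psihat \<xi>)) x) \<le> C / (1 + \<bar>x\<bar>)\<^sup>2"
proof -
  have C: "0 \<le> C\<kappa>" using order_trans[OF norm_ge_zero ift_\<kappa>[of 0]] by simp
  have 1: "cmod (ift (\<lambda>\<xi>. of_real (\<kappa> (s * \<xi>))) y) \<le> (C\<kappa> * (1 + s) ^ 4 / s) / ((1 + \<bar>y\<bar>)\<^sup>2 * (1 + \<bar>y\<bar>)\<^sup>2)" for y
  proof -
    have cross: "0 < p \<Longrightarrow> 0 < q \<Longrightarrow> c * q \<le> d * p \<Longrightarrow> c / p \<le> d / q" for c d p q :: real
      by (simp add: field_simps)
    have "(1 + s) * (1 + \<bar>y / s\<bar>) = 1 + s + \<bar>y / s\<bar> + \<bar>y\<bar>"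
      using s by (simp add: abs_divide distrib_left distrib_right add_divide_distrib)
    hence "1 + \<bar>y\<bar> \<le> (1 + s) * (1 + \<bar>y / s\<bar>)" using s by simp
    hence "(1 + \<bar>y\<bar>) ^ 4 \<le> ((1 + s) * (1 + \<bar>y / s\<bar>)) ^ 4" by (rule power_mono) simp
    hence "C\<kappa> * (1 + \<bar>y\<bar>) ^ 4 \<le> C\<kappa> * ((1 + s) ^ 4 * (1 + \<bar>y / s\<bar>) ^ 4)"
      unfolding power_mult_distrib using C by (intro mult_left_mono) auto
    hence "C\<kappa> / (1 + \<bar>y / s\<bar>) ^ 4 \<le> C\<kappa> * (1 + s) ^ 4 / (1 + \<bar>y\<bar>) ^ 4"
      by (intro cross zero_less_power add_pos_nonneg) (simp_all only: zero_less_one abs_ge_zero mult.assoc)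
    hence "cmod (K (y / s)) \<le> C\<kappa> * (1 + s) ^ 4 / (1 + \<bar>y\<bar>) ^ 4" using ift_\<kappa>[of "y / s"] unfolding K_def by linarith
    hence "cmod (K (y / s)) / s \<le> C\<kappa> * (1 + s) ^ 4 / (1 + \<bar>y\<bar>) ^ 4 / s" using s by (intro divide_right_mono) auto
    also have "\<dots> = (C\<kappa> * (1 + s) ^ 4 / s) / (1 + \<bar>y\<bar>) ^ 4"
      by (simp only: divide_divide_eq_left mult.commute[of s])
    finally have "cmod (K (y / s)) / s \<le> (C\<kappa> * (1 + s) ^ 4 / s) / (1 + \<bar>y\<bar>) ^ 4" .
    moreover have "cmod (ift (\<lambda>\<xi>. of_real (\<kappa> (s * \<xi>))) y) = cmod (K (y / s)) / s"
      using ift_scale[of s "\<lambda>\<xi>. of_real (\<kappa> \<xi>)" y] s by (simp add: norm_divide K_def)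
    moreover have "(1 + \<bar>y\<bar>) ^ 4 = (1 + \<bar>y\<bar>)\<^sup>2 * (1 + \<bar>y\<bar>)\<^sup>2"
      unfolding power_add[symmetric] by simp
    ultimately show ?thesis by (simp only:)
  qed
  have 2: "cmod (ift (\<lambda>\<xi>. cnj (psihat \<xi>)) x) \<le> 4 * Cb / (1 + \<bar>x\<bar>)\<^sup>2" for x
    using psi_decay[of "- x"] unfolding ift_cnj psi_def by simp
  have 3: "integrable lborel (\<lambda>\<xi>. cnj (psihat \<xi>))" using psihat_integrable by simp
  have "cmod (ift (\<lambda>\<xi>. of_real (\<kappa> (s * \<xi>)) * cnj (psihat \<xi>)) x) \<le>
      (C\<kappa> * (1 + s) ^ 4 / s) * int_inv_sq * (4 * Cb) / (1 + \<bar>x\<bar>)\<^sup>2" for x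
    by (rule norm_ift_mult_le[OF submult_weight_poly \<kappa>_scaled_integrable \<kappa>_cont \<kappa>_norm 1 3 2]) (use s in simp)
  thus ?thesis by blast
qed

text \<open>Up to a phase the difference of the kernels has transform \<kappa> (\<rho> \<xi>) -
  \<kappa> (\<mu> \<xi>), which vanishes near 0 and near infinity and is therefore resolved by
  finitely many scales. A single kernel does not allow this, its transform having modulus 1 at the
  origin.\<close>

lemma kernel_perp:
  fixes f :: "real \<Rightarrow> complex"
  assumes [measurable]: "f \<in> borel_measurable borel" and f2: "integrable lborel (\<lambda>x. (cmod (f x))\<^sup>2)"
    and perp: "\<And>j k. (LINT x|lborel. f x * cnj (wavelet_system psi j k x)) = 0"
    and \<rho>: "0 < \<rho>" "\<rho> < \<mu>"
  shows "(LINT x|lborel. f x * cnj (K ((x - t) / \<rho>) / of_real \<rho>)) = (LINT x|lborel. f x * cnj (K ((x - t) / \<mu>) / of_real \<mu>))"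
proof -
  have \<mu>: "\<mu> > 0" using \<rho> by simp
  define E where "E \<xi> = complex_of_real (\<kappa> (\<rho> * \<xi>)) - complex_of_real (\<kappa> (\<mu> * \<xi>))" for \<xi>
  define G where "G \<xi> = cis (2 * pi * (- t) * \<xi>) * E \<xi>" for \<xi>
  have Econt: "continuous_on UNIV E" unfolding E_def[abs_def] by (intro continuous_intros \<kappa>_cont)
  have [measurable]: "E \<in> borel_measurable borel" by (rule borel_measurable_continuous_onI[OF Econt])
  have Ele: "cmod (E \<xi>) \<le> 2" for \<xi>
    unfolding E_def by (rule order_trans[OF norm_triangle_ineq4]) (use add_mono[OF \<kappa>_norm[of "\<rho> * \<xi>"] \<kappa>_norm[of "\<mu> * \<xi>"]] in simp)
  \<comment> \<open>The bounds 1 / (4 \<mu>) and 2 / \<rho> translate the support hypotheses of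
    \<open>frequency_reconstruction\<close> into |\<mu> \<xi>| \<le> 1/3 and 2/3 \<le> |\<rho>
    \<xi>|.\<close>
  obtain j0 :: int where j0: "2 powr real_of_int j0 \<le> 1 / (4 * \<mu>)" using ex_dyadic_below[of "1 / (4 * \<mu>)"] \<mu> by auto
  obtain N :: nat where N: "2 / \<rho> \<le> 2 powr real_of_int (j0 + int N)" using ex_dyadic_above by blast
  have G0: "G \<xi> = 0" if "\<bar>\<xi>\<bar> \<le> 4/3 * 2 powr real_of_int j0" for \<xi>
  proof -
    have "\<bar>\<xi>\<bar> \<le> 4/3 * (1 / (4 * \<mu>))" using that j0 by linarith
    hence m: "\<bar>\<mu> * \<xi>\<bar> \<le> 1/3" using \<mu> by (simp add: abs_mult field_simps)
    moreover have "\<bar>\<rho> * \<xi>\<bar> \<le> \<bar>\<mu> * \<xi>\<bar>" using \<rho> by (simp add: abs_mult mult_right_mono)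
    ultimately have "\<kappa> (\<rho> * \<xi>) = 1" "\<kappa> (\<mu> * \<xi>) = 1" by (auto intro!: \<kappa>_eq_1)
    thus ?thesis by (simp add: G_def E_def)
  qed
  have G1: "G \<xi> = 0" if "1/3 * 2 powr real_of_int (j0 + int N) \<le> \<bar>\<xi>\<bar>" for \<xi>
  proof -
    have "1/3 * (2 / \<rho>) \<le> \<bar>\<xi>\<bar>" using that N by linarith
    hence m: "2/3 \<le> \<bar>\<rho> * \<xi>\<bar>" using \<rho> by (simp add: abs_mult field_simps)
    moreover have "\<bar>\<rho> * \<xi>\<bar> \<le> \<bar>\<mu> * \<xi>\<bar>" using \<rho> by (simp add: abs_mult mult_right_mono)
    ultimately have "\<kappa> (\<rho> * \<xi>) = 0" "\<kappa> (\<mu> * \<xi>) = 0" by (auto intro!: \<kappa>_eq_0)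
    thus ?thesis by (simp add: G_def E_def)
  qed
  define s where "s n = 2 powr real_of_int (j0 + int n)" for n
  have s0: "s n > 0" for n by (simp add: s_def)
  \<comment> \<open>With this H the summands of \<open>frequency_reconstruction\<close> are exactly
    the functions D of \<open>perp_periodized\<close>.\<close>
  define H where "H n v = G (s n * v) * cnj (psihat v)" for n v
  define D where "D n \<xi> = psihat (\<xi> / s n) * (\<Sum>q\<in>{-3..3}. H n (\<xi> / s n + of_int q))" for n \<xi>
  have GD: "(\<Sum>n<N. D n \<xi>) = G \<xi>" for \<xi>
    unfolding D_def H_def s_def by (rule frequency_reconstruction[OF G0 G1])
  have Hcont: "continuous_on UNIV (H n)" for n
    unfolding H_def[abs_def] G_def
    by (intro continuous_intros continuous_on_compose2[OF Econt] psihat_continuous) auto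
  have Hbd: "cmod (H n v) \<le> 2" for n v
  proof -
    have "cmod (E (s n * v)) * cmod (psihat v) \<le> 2 * 1" using Ele psihat_le_1 by (intro mult_mono) auto
    thus ?thesis unfolding H_def G_def by (simp add: norm_mult)
  qed
  have Hsupp: "H n v = 0" if "4/3 < \<bar>v\<bar>" for n v using b_outer[of v] that by (simp add: H_def psihat_def)
  have Hdec: "\<exists>C. \<forall>x. cmod (ift (H n) x) \<le> C / (1 + \<bar>x\<bar>)\<^sup>2" for n
  proof -
    let ?E = "\<lambda>r \<xi>. complex_of_real (\<kappa> (r * \<xi>)) * cnj (psihat \<xi>)"
    have l: "\<rho> * s n > 0" "\<mu> * s n > 0" using \<rho> \<mu> s0[of n] by auto
    obtain C1 where C1: "\<And>x. cmod (ift (?E (\<rho> * s n)) x) \<le> C1 / (1 + \<bar>x\<bar>)\<^sup>2" using decay_scaled_product[OF l(1)] by blast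
    obtain C2 where C2: "\<And>x. cmod (ift (?E (\<mu> * s n)) x) \<le> C2 / (1 + \<bar>x\<bar>)\<^sup>2" using decay_scaled_product[OF l(2)] by blast
    have i: "integrable lborel (?E r)" for r
      by (rule integrable_bounded_mult[OF _ \<kappa>_norm]) (use psihat_integrable in auto)
    define \<phi> where "\<phi> = ift (\<lambda>\<xi>. ?E (\<rho> * s n) \<xi> - ?E (\<mu> * s n) \<xi>)"
    have "cmod (\<phi> x) \<le> (C1 + C2) / (1 + \<bar>x\<bar>)\<^sup>2" for x
      unfolding \<phi>_def ift_diff[OF i i] add_divide_distrib
      by (rule order_trans[OF norm_triangle_ineq4 add_mono[OF C1 C2]])
    note \<phi> = decay_shift[of \<phi>, OF this]
    have "H n v = cis (2 * pi * (- t * s n) * v) * (?E (\<rho> * s n) v - ?E (\<mu> * s n) v)" for v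
      unfolding H_def G_def E_def by (simp add: algebra_simps)
    hence "H n = (\<lambda>v. cis (2 * pi * (- t * s n) * v) * (?E (\<rho> * s n) v - ?E (\<mu> * s n) v))" by (rule ext)
    hence "ift (H n) x = \<phi> (x + (- t * s n))" for x
      unfolding \<phi>_def by (simp only: ift_modulate)
    thus ?thesis using \<phi> by metis
  qed
  have Dn: "integrable lborel (D n)" "integrable lborel (\<lambda>x. f x * cnj (ift (D n) x))"
     "(LINT x|lborel. f x * cnj (ift (D n) x)) = 0" for n
  proof -
    obtain C where C: "\<And>x. cmod (ift (H n) x) \<le> C / (1 + \<bar>x\<bar>)\<^sup>2" using Hdec[of n] by blast
    note pp = perp_periodized[where j="j0 + int n" and H="H n", OF _ f2 perp Hcont Hbd Hsupp C, folded s_def D_def]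
    show "integrable lborel (D n)" "integrable lborel (\<lambda>x. f x * cnj (ift (D n) x))"
     "(LINT x|lborel. f x * cnj (ift (D n) x)) = 0"
      using pp unfolding D_def[abs_def] by auto
  qed
  have iG: "ift G x = (\<Sum>n<N. ift (D n) x)" for x
    unfolding GD[symmetric, abs_def] by (rule ift_sum) (use Dn in auto)
  have "(LINT x|lborel. f x * cnj (ift G x)) = (LINT x|lborel. (\<Sum>n<N. f x * cnj (ift (D n) x)))"
    unfolding iG by (simp add: sum_distrib_left)
  also have "\<dots> = 0" by (subst Bochner_Integration.integral_sum) (use Dn in auto)
  finally have 0: "(LINT x|lborel. f x * cnj (ift G x)) = 0" .
  have Gk: "ift G x = K ((x - t) / \<rho>) / of_real \<rho> - K ((x - t) / \<mu>) / of_real \<mu>" for x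
  proof -
    have "ift G x = ift E (x + - t)" unfolding G_def[abs_def] by (rule ift_modulate)
    also have "\<dots> = ift (\<lambda>\<xi>. of_real (\<kappa> (\<rho> * \<xi>))) (x + - t) - ift (\<lambda>\<xi>. of_real (\<kappa> (\<mu> * \<xi>))) (x + - t)"
      unfolding E_def[abs_def] by (rule ift_diff) (use \<rho> in \<open>auto intro!: \<kappa>_scaled_integrable simp del: of_real_eq_iff\<close>)
    finally show ?thesis
      using ift_scale[of \<rho> "\<lambda>\<xi>. of_real (\<kappa> \<xi>)" "x - t"] ift_scale[of \<mu> "\<lambda>\<xi>. of_real (\<kappa> \<xi>)" "x - t"] \<rho> \<mu>
      by (simp add: K_def)
  qed
  have ik: "integrable lborel (\<lambda>x. f x * cnj (K ((x - t) / r) / of_real r))" if "r > 0" for r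
  proof (rule square_integrable_mult(1)[OF _ _ f2])
    have "integrable lborel (\<lambda>x. (1 / r\<^sup>2) * (cmod (K (- t / r + 1 / r * x)))\<^sup>2)"
      using that by (intro integrable_mult_right lborel_integrable_real_affine[OF K_square_integrable]) auto
    moreover have "(1 / r\<^sup>2) * (cmod (K (- t / r + 1 / r * x)))\<^sup>2 = (cmod (K ((x - t) / r) / of_real r))\<^sup>2" for x
      using that by (simp add: norm_divide power_divide diff_divide_distrib)
    ultimately show "integrable lborel (\<lambda>x. (cmod (K ((x - t) / r) / of_real r))\<^sup>2)" by simp
  qed auto
  have "0 = (LINT x|lborel. f x * cnj (K ((x - t) / \<rho>) / of_real \<rho>) - f x * cnj (K ((x - t) / \<mu>) / of_real \<mu>))"
    unfolding 0[symmetric] Gk by (simp only: complex_cnj_diff right_diff_distrib)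
  also have "\<dots> = (LINT x|lborel. f x * cnj (K ((x - t) / \<rho>) / of_real \<rho>)) - (LINT x|lborel. f x * cnj (K ((x - t) / \<mu>) / of_real \<mu>))"
    by (rule Bochner_Integration.integral_diff[OF ik[OF \<rho>(1)] ik[OF \<mu>]])
  finally show ?thesis by simp
qed

end

context meyer
begin

text \<open>By \<open>kernel_perp\<close> the pairing does not change with the dilation, while the
  L2 norm of the dilated kernel tends to 0 like \<mu>^(-1/2).\<close>

lemma kernel_zero:
  fixes f :: "real \<Rightarrow> complex"
  assumes [measurable]: "f \<in> borel_measurable borel" and f2: "integrable lborel (\<lambda>x. (cmod (f x))\<^sup>2)"
    and perp: "\<And>j k. (LINT x|lborel. f x * cnj (wavelet_system psi j k x)) = 0"
    and \<rho>: "0 < \<rho>"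
  shows "(LINT y|lborel. f (t + \<rho> * y) * cnj (K y)) = 0"
proof -
  define A where "A = (LINT x|lborel. f x * cnj (K ((x - t) / \<rho>) / of_real \<rho>))"
  have "A = \<bar>\<rho>\<bar> *\<^sub>R (LINT y|lborel. f (t + \<rho> * y) * cnj (K ((t + \<rho> * y - t) / \<rho>) / of_real \<rho>))"
    unfolding A_def using \<rho> by (intro lborel_integral_real_affine) simp
  also have "\<dots> = (LINT y|lborel. f (t + \<rho> * y) * cnj (K y))"
    using \<rho> by (subst integral_scaleR_right[symmetric]) (simp add: scaleR_conv_of_real)
  finally have A: "A = (LINT y|lborel. f (t + \<rho> * y) * cnj (K y))" .
  define Z where "Z = (LINT x|lborel. (cmod (f x))\<^sup>2) + (LINT x|lborel. (cmod (K x))\<^sup>2)"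
  have Z0: "0 \<le> Z" unfolding Z_def by simp
  have bound: "cmod A \<le> Z / sqrt \<mu> / 2" if \<mu>: "\<rho> < \<mu>" for \<mu>
  proof -
    have m0: "0 < \<mu>" using \<mu> \<rho> by simp
    have e: "(cmod (K ((x - t) / \<mu>) / of_real \<mu>))\<^sup>2 = (1 / \<mu>\<^sup>2) * (cmod (K (- t / \<mu> + 1 / \<mu> * x)))\<^sup>2" for x
      using m0 by (simp add: norm_divide power_divide diff_divide_distrib)
    have k2: "integrable lborel (\<lambda>x. (cmod (K ((x - t) / \<mu>) / of_real \<mu>))\<^sup>2)"
      unfolding e using m0 by (intro integrable_mult_right lborel_integrable_real_affine[OF K_square_integrable]) auto
    have k2i: "(LINT x|lborel. (cmod (K ((x - t) / \<mu>) / of_real \<mu>))\<^sup>2) = (LINT x|lborel. (cmod (K x))\<^sup>2) / \<mu>"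
    proof -
      have "(LINT x|lborel. (cmod (K x))\<^sup>2) = \<bar>1 / \<mu>\<bar> *\<^sub>R (LINT x|lborel. (cmod (K (- t / \<mu> + 1 / \<mu> * x)))\<^sup>2)"
        using m0 by (intro lborel_integral_real_affine) simp
      thus ?thesis unfolding e integral_mult_right_zero using m0 by (simp add: power2_eq_square)
    qed
    have "A = (LINT x|lborel. f x * cnj (K ((x - t) / \<mu>) / of_real \<mu>))"
      unfolding A_def by (rule kernel_perp[OF _ f2 perp \<rho> \<mu>]) simp
    hence "cmod A \<le> (LINT x|lborel. cmod (f x * cnj (K ((x - t) / \<mu>) / of_real \<mu>)))"
      by (simp only: integral_norm_bound)
    \<comment> \<open>The choice r = 1 / sqrt \<mu> balances the two terms, since the squared norm
      of the kernel is of order 1 / \<mu>.\<close>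
    also have "\<dots> \<le> (1 / sqrt \<mu> * (LINT x|lborel. (cmod (f x))\<^sup>2) + (LINT x|lborel. (cmod (K x))\<^sup>2) / \<mu> / (1 / sqrt \<mu>)) / 2"
      unfolding k2i[symmetric] by (rule square_integrable_mult(2)[OF _ _ f2 k2]) (use m0 in auto)
    also have "(LINT x|lborel. (cmod (K x))\<^sup>2) / \<mu> / (1 / sqrt \<mu>) = 1 / sqrt \<mu> * (LINT x|lborel. (cmod (K x))\<^sup>2)"
    proof -
      have "c / (q * q) / (1 / q) = 1 / q * c" if "q > 0" for c q :: real using that by simp
      from this[of "sqrt \<mu>"] show ?thesis using m0 by simp
    qed
    finally show ?thesis by (simp add: Z_def add_divide_distrib)
  qed
  have "A = 0"
  proof (rule ccontr)
    assume "A \<noteq> 0"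
    hence a: "0 < cmod A" by simp
    \<comment> \<open>Large enough for Z / sqrt \<mu> \<le> |A|; the factor 1/2 in
      \<open>bound\<close> then gives the contradiction.\<close>
    define \<mu> where "\<mu> = \<rho> + 1 + (Z / cmod A)\<^sup>2"
    have "\<rho> < \<mu>" by (simp add: \<mu>_def add_pos_nonneg)
    have "Z / cmod A \<le> sqrt \<mu>" using \<rho> by (intro real_le_rsqrt) (simp add: \<mu>_def)
    moreover have s0: "0 < sqrt \<mu>" using \<rho> \<open>\<rho> < \<mu>\<close> by simp
    ultimately have "Z / sqrt \<mu> \<le> cmod A" using a by (simp add: pos_divide_le_eq mult.commute)
    hence "Z / sqrt \<mu> / 2 \<le> cmod A / 2" by (rule divide_right_mono) simp
    with bound[OF \<open>\<rho> < \<mu>\<close>] have "cmod A \<le> cmod A / 2" by (rule order_trans)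
    thus False using a by simp
  qed
  with A show ?thesis by simp
qed

text \<open>The vanishing mollifications are integrated over t in [a, b]. This replaces f by \<Phi>,
  which has limit \<Phi> 0 along each sequence \<open>r n * y\<close>; letting the dilation tend to
  0 gives \<Phi> 0 = 0, because K has integral 1.\<close>

lemma complete_lborel:
  fixes f :: "real \<Rightarrow> complex"
  assumes [measurable]: "f \<in> borel_measurable borel" and f2: "integrable lborel (\<lambda>x. (cmod (f x))\<^sup>2)"
    and perp: "\<And>j k. (LINT x|lborel. f x * cnj (wavelet_system psi j k x)) = 0"
  shows "AE x in lborel. f x = 0"
proof (rule AE_zero_of_interval_integrals)
  have bnd: "cmod z \<le> (1 + (cmod z)\<^sup>2) / 2" for z
  proof -
    have "0 \<le> (cmod z - 1)\<^sup>2" by simp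
    thus ?thesis by (simp add: power2_diff)
  qed
  have f2s: "integrable lborel (\<lambda>t. (cmod (f (t + s)))\<^sup>2)" "(LINT t|lborel. (cmod (f (t + s)))\<^sup>2) = (LINT x|lborel. (cmod (f x))\<^sup>2)" for s
    using lborel_integrable_real_affine[OF f2, of 1 s] lborel_integral_real_affine[of 1 "\<lambda>x. (cmod (f x))\<^sup>2" s]
    by (auto simp: add.commute)
  have loc: "integrable lborel (\<lambda>t. indicator {a..b} t *\<^sub>R f (t + s))" for a b s
  proof (rule Bochner_Integration.integrable_bound)
    show "integrable lborel (\<lambda>t. (indicator {a..b} t + (cmod (f (t + s)))\<^sup>2) / 2)"
      by (intro integrable_divide Bochner_Integration.integrable_add integrable_real_indicator f2s)
         (auto simp: emeasure_lborel_Icc_eq)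
    show "AE t in lborel. norm (indicator {a..b} t *\<^sub>R f (t + s)) \<le> norm ((indicator {a..b} t + (cmod (f (t + s)))\<^sup>2) / 2)"
      using bnd by (auto intro!: AE_I2 simp: indicator_def)
  qed simp
  show "integrable lborel (\<lambda>t. indicator {a..b} t *\<^sub>R f t)" for a b using loc[of a b 0] by simp
  fix a b :: real assume ab: "a \<le> b"
  define M where "M = ((b - a) + (LINT x|lborel. (cmod (f x))\<^sup>2)) / 2"
  have M: "(LINT t|lborel. cmod (indicator {a..b} t *\<^sub>R f (t + s))) \<le> M" for s
  proof -
    have "(LINT t|lborel. cmod (indicator {a..b} t *\<^sub>R f (t + s))) \<le> (LINT t|lborel. (indicator {a..b} t + (cmod (f (t + s)))\<^sup>2) / 2)"
    proof (rule integral_mono[OF integrable_norm[OF loc]])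
      show "integrable lborel (\<lambda>t. (indicator {a..b} t + (cmod (f (t + s)))\<^sup>2) / 2)"
        by (intro integrable_divide Bochner_Integration.integrable_add integrable_real_indicator f2s)
           (auto simp: emeasure_lborel_Icc_eq)
      show "norm (indicator {a..b} t *\<^sub>R f (t + s)) \<le> (indicator {a..b} t + (cmod (f (t + s)))\<^sup>2) / 2" for t
        using bnd[of "f (t + s)"] by (simp add: indicator_def)
    qed
    also have "\<dots> = ((LINT t|lborel. indicator {a..b} t) + (LINT t|lborel. (cmod (f (t + s)))\<^sup>2)) / 2"
      unfolding integral_divide_zero
      by (subst Bochner_Integration.integral_add[OF integrable_real_indicator f2s(1)]) (auto simp: emeasure_lborel_Icc_eq)
    also have "\<dots> = M" using ab by (simp add: M_def f2s)
    finally show ?thesis .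
  qed
  define \<Phi> where "\<Phi> s = (LINT t|lborel. indicator {a..b} t *\<^sub>R f (t + s))" for s
  have \<Phi>le: "cmod (\<Phi> s) \<le> M" for s
    unfolding \<Phi>_def by (rule order_trans[OF integral_norm_bound M])
  have [measurable]: "\<Phi> \<in> borel_measurable borel" unfolding \<Phi>_def[abs_def] by measurable
  have zero: "(LINT y|lborel. cnj (K y) * \<Phi> (\<rho> * y)) = 0" if \<rho>: "\<rho> > 0" for \<rho>
  proof -
    let ?F = "\<lambda>y t. cnj (K y) * (indicator {a..b} t *\<^sub>R f (t + \<rho> * y))"
    have int: "integrable (lborel \<Otimes>\<^sub>M lborel) (\<lambda>(y, t). ?F y t)"
    proof (rule lborel_pair.Fubini_integrable)
      have nF: "(LINT t|lborel. norm (case (y, t) of (y, t) \<Rightarrow> ?F y t)) = cmod (K y) * (LINT t|lborel. cmod (indicator {a..b} t *\<^sub>R f (t + \<rho> * y)))" for y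
        by (simp only: prod.case norm_mult complex_mod_cnj integral_mult_right_zero)
      show "integrable lborel (\<lambda>y. LINT t|lborel. norm (case (y, t) of (y, t) \<Rightarrow> ?F y t))"
        unfolding nF
      proof (rule Bochner_Integration.integrable_bound)
        show "integrable lborel (\<lambda>y. cmod (K y) * M)" using K_integrable by simp
        show "AE y in lborel. norm (cmod (K y) * (LINT t|lborel. cmod (indicator {a..b} t *\<^sub>R f (t + \<rho> * y)))) \<le> norm (cmod (K y) * M)"
        proof (intro AE_I2)
          fix y
          have "0 \<le> (LINT t|lborel. cmod (indicator {a..b} t *\<^sub>R f (t + \<rho> * y)))" by simp
          hence "\<bar>LINT t|lborel. cmod (indicator {a..b} t *\<^sub>R f (t + \<rho> * y))\<bar> \<le> \<bar>M\<bar>" using M[of "\<rho> * y"] by linarith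
          thus "norm (cmod (K y) * (LINT t|lborel. cmod (indicator {a..b} t *\<^sub>R f (t + \<rho> * y)))) \<le> norm (cmod (K y) * M)"
            unfolding real_norm_def abs_mult by (intro mult_left_mono) auto
        qed
      qed measurable
      show "AE y in lborel. integrable lborel (\<lambda>t. case (y, t) of (y, t) \<Rightarrow> ?F y t)"
        unfolding prod.case by (intro AE_I2 integrable_mult_right loc)
    qed measurable
    have "(LINT y|lborel. cnj (K y) * \<Phi> (\<rho> * y)) = (LINT y|lborel. LINT t|lborel. ?F y t)"
      unfolding \<Phi>_def integral_mult_right_zero ..
    also have "\<dots> = (LINT t|lborel. LINT y|lborel. ?F y t)"
      by (rule lborel_pair.Fubini_integral[symmetric, OF int])
    also have "\<dots> = (LINT t|lborel. indicator {a..b} t *\<^sub>R (LINT y|lborel. f (t + \<rho> * y) * cnj (K y)))"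
      by (simp only: integral_scaleR_right[symmetric] mult_scaleR_right mult.commute)
    also have "\<dots> = 0" by (simp add: kernel_zero[OF _ f2 perp \<rho>])
    finally show ?thesis .
  qed
  define r where "r n = 1 / real (Suc n)" for n
  have r0: "r n > 0" "r n \<le> 1" for n by (auto simp: r_def)
  have rlim: "r \<longlonglongrightarrow> 0" unfolding r_def using LIMSEQ_Suc[OF lim_1_over_n] by simp
  \<comment> \<open>Moving the shift from f to the interval leaves a convergence of indicators,
    which can fail only at the endpoints a and b.\<close>
  have \<Phi>lim: "(\<lambda>n. \<Phi> (r n * y)) \<longlonglongrightarrow> \<Phi> 0" for y
  proof -
    have e: "\<Phi> s = (LINT x|lborel. indicator {a..b} (x - s) *\<^sub>R f x)" for s
    proof -
      have "(LINT x|lborel. indicator {a..b} (x - s) *\<^sub>R f x) = \<bar>1\<bar> *\<^sub>R (LINT x|lborel. indicator {a..b} (s + 1 * x - s) *\<^sub>R f (s + 1 * x))"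
        by (rule lborel_integral_real_affine) simp
      thus ?thesis by (simp add: \<Phi>_def add.commute)
    qed
    have sl: "(\<lambda>n. x - r n * y) \<longlonglongrightarrow> x - 0 * y" for x by (intro tendsto_intros rlim)
    show ?thesis unfolding e
    proof (rule integral_dominated_convergence[where w="\<lambda>x. cmod (indicator {a - \<bar>y\<bar>..b + \<bar>y\<bar>} x *\<^sub>R f (x + 0))"])
      show "integrable lborel (\<lambda>x. cmod (indicator {a - \<bar>y\<bar>..b + \<bar>y\<bar>} x *\<^sub>R f (x + 0)))" by (rule integrable_norm[OF loc])
      show "AE x in lborel. norm (indicator {a..b} (x - r n * y) *\<^sub>R f x) \<le> cmod (indicator {a - \<bar>y\<bar>..b + \<bar>y\<bar>} x *\<^sub>R f (x + 0))" for n
      proof (intro AE_I2)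
        fix x
        have "\<bar>r n * y\<bar> \<le> \<bar>y\<bar>" using r0[of n] by (simp add: abs_mult mult_left_le_one_le)
        thus "norm (indicator {a..b} (x - r n * y) *\<^sub>R f x) \<le> cmod (indicator {a - \<bar>y\<bar>..b + \<bar>y\<bar>} x *\<^sub>R f (x + 0))"
          by (auto simp: indicator_def)
      qed
      have "AE x in lborel. x \<noteq> a \<and> x \<noteq> b" using AE_lborel_singleton[of a] AE_lborel_singleton[of b] by eventually_elim simp
      thus "AE x in lborel. (\<lambda>n. indicator {a..b} (x - r n * y) *\<^sub>R f x) \<longlonglongrightarrow> indicator {a..b} (x - 0) *\<^sub>R f x"
      proof eventually_elim
        case (elim x)
        consider "x < a" | "a < x" "x < b" | "b < x" using elim by linarith
        hence "\<forall>\<^sub>F n in sequentially. indicator {a..b} (x - r n * y) = (indicator {a..b} (x - 0) :: real)"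
        proof cases
          case 1
          have "\<forall>\<^sub>F n in sequentially. x - r n * y < a" using order_tendstoD(2)[OF sl, of x a] 1 by simp
          thus ?thesis by eventually_elim (use 1 in \<open>auto simp: indicator_def\<close>)
        next
          case 2
          have "\<forall>\<^sub>F n in sequentially. x - r n * y < b" "\<forall>\<^sub>F n in sequentially. a < x - r n * y"
            using order_tendstoD[OF sl, where x1=x] order_tendstoD(2)[OF sl, of x b] order_tendstoD(1)[OF sl, of a x] 2 by auto
          thus ?thesis by eventually_elim (use 2 in \<open>auto simp: indicator_def\<close>)
        next
          case 3
          have "\<forall>\<^sub>F n in sequentially. b < x - r n * y" using order_tendstoD(1)[OF sl, of b x] 3 by simp
          thus ?thesis by eventually_elim (use 3 in \<open>auto simp: indicator_def\<close>)
        qed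
        hence "(\<lambda>n. indicator {a..b} (x - r n * y)) \<longlonglongrightarrow> (indicator {a..b} (x - 0) :: real)" by (rule tendsto_eventually)
        thus ?case by (intro tendsto_intros)
      qed
    qed measurable
  qed
  have "(\<lambda>n. LINT y|lborel. cnj (K y) * \<Phi> (r n * y)) \<longlonglongrightarrow> (LINT y|lborel. cnj (K y) * \<Phi> 0)"
  proof (rule integral_dominated_convergence[where w="\<lambda>y. cmod (K y) * M"])
    show "integrable lborel (\<lambda>y. cmod (K y) * M)" using K_integrable by simp
    show "AE y in lborel. (\<lambda>n. cnj (K y) * \<Phi> (r n * y)) \<longlonglongrightarrow> cnj (K y) * \<Phi> 0"
      by (intro AE_I2 tendsto_intros \<Phi>lim)
    show "AE y in lborel. norm (cnj (K y) * \<Phi> (r n * y)) \<le> cmod (K y) * M" for n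
      unfolding norm_mult complex_mod_cnj by (intro AE_I2 mult_left_mono \<Phi>le norm_ge_zero)
  qed measurable
  hence "(LINT y|lborel. cnj (K y) * \<Phi> 0) = 0"
    unfolding zero[OF r0(1)] by (simp add: LIMSEQ_const_iff)
  moreover have "(LINT y|lborel. cnj (K y) * \<Phi> 0) = \<Phi> 0"
    unfolding integral_mult_left_zero Bochner_Integration.integral_cnj integral_K by simp
  ultimately have "\<Phi> 0 = 0" by (simp only:)
  thus "(LINT x|lborel. indicator {a..b} x *\<^sub>R f x) = 0" by (simp add: \<Phi>_def)
qed simp

lemma orthogonal_wavelet_psi: "orthogonal_wavelet psi"
  unfolding orthogonal_wavelet_def
proof (intro conjI allI impI)
  fix f assume *: "L2 f \<and> (\<forall>j k. L2_inner f (wavelet_system psi j k) = 0)"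
  hence fm: "f \<in> borel_measurable lebesgue" and f2: "integrable lebesgue (\<lambda>x. (cmod (f x))\<^sup>2)"
    and perp: "L2_inner f (wavelet_system psi j k) = 0" for j k
    by (auto simp: L2_def)
  \<comment> \<open>Completeness concerns Lebesgue measurable functions; Borel versions of the real
    and imaginary parts bring f within reach of \<open>complete_lborel\<close>.\<close>
  have "(\<lambda>x. Re (f x)) \<in> borel_measurable lebesgue" "(\<lambda>x. Im (f x)) \<in> borel_measurable lebesgue" using fm by auto
  from this[THEN completion_ex_borel_measurable_real] obtain g h where
    [measurable]: "g \<in> borel_measurable lborel" "h \<in> borel_measurable lborel" and
    gh: "AE x in lborel. Re (f x) = g x" "AE x in lborel. Im (f x) = h x" by auto
  define F where "F x = Complex (g x) (h x)" for x
  have "F = (\<lambda>x. of_real (g x) + \<i> * of_real (h x))" by (auto simp: F_def complex_eq_iff)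
  hence [measurable]: "F \<in> borel_measurable borel" by simp
  have fF: "AE x in lborel. f x = F x" using gh by eventually_elim (simp add: F_def complex_eq_iff)
  hence fF': "AE x in lebesgue. f x = F x" by (rule AE_completion)
  have "integrable lebesgue (\<lambda>x. (cmod (F x))\<^sup>2)"
  proof (rule integrable_cong_AE_imp[OF f2])
    show "(\<lambda>x. (cmod (F x))\<^sup>2) \<in> borel_measurable lebesgue" by (rule measurable_completion) simp
    show "AE x in lebesgue. (cmod (f x))\<^sup>2 = (cmod (F x))\<^sup>2" using fF' by eventually_elim simp
  qed
  hence F2: "integrable lborel (\<lambda>x. (cmod (F x))\<^sup>2)" by (subst (asm) integrable_completion) auto
  have "(LINT x|lborel. F x * cnj (wavelet_system psi j k x)) = 0" for j k
  proof -
    have m: "(\<lambda>x. F x * cnj (wavelet_system psi j k x)) \<in> borel_measurable lborel" by simp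
    have "(LINT x|lborel. F x * cnj (wavelet_system psi j k x)) = (LINT x|lebesgue. F x * cnj (wavelet_system psi j k x))"
      by (rule integral_completion[symmetric, OF m])
    also have "\<dots> = L2_inner f (wavelet_system psi j k)"
      unfolding L2_inner_def
    proof (rule integral_cong_AE)
      show "(\<lambda>x. F x * cnj (wavelet_system psi j k x)) \<in> borel_measurable lebesgue"
        by (rule measurable_completion) simp
      have "(\<lambda>x. cnj (wavelet_system psi j k x)) \<in> borel_measurable lebesgue" by (rule measurable_completion) simp
      thus "(\<lambda>x. f x * cnj (wavelet_system psi j k x)) \<in> borel_measurable lebesgue" using fm by (rule borel_measurable_times[rotated])
      show "AE x in lebesgue. F x * cnj (wavelet_system psi j k x) = f x * cnj (wavelet_system psi j k x)"
        using fF' by eventually_elim simp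
    qed
    finally show ?thesis using perp by simp
  qed
  from complete_lborel[OF _ F2 this] have "AE x in lborel. F x = 0" by simp
  with fF have "AE x in lborel. f x = 0" by eventually_elim simp
  thus "AE x in lebesgue. f x = 0" by (rule AE_completion)
qed (use L2_psi wavelet_orthonormal in auto)

end

text \<open>Monotonicity of \<Theta> makes T subadditive, hence its envelope gives an admissible
  weight V. The locale is entered after V has been bounded below by 1, and the weight returns at the
  end through the decay of the bell.\<close>

lemma wavelet_with_weight:
  fixes \<Theta> :: "real \<Rightarrow> real" and E \<gamma> :: real
  assumes mono: "\<And>x y. 0 \<le> x \<Longrightarrow> x \<le> y \<Longrightarrow> \<Theta> x \<le> \<Theta> y" and ge1: "\<And>x. 0 \<le> x \<Longrightarrow> 1 \<le> \<Theta> x"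
    and E: "0 \<le> E" and \<gamma>: "0 < \<gamma>" "\<gamma> \<le> 1"
    and s: "summable (\<lambda>k. \<gamma> / ((E + real (Suc k)) * \<Theta> (real (Suc k))))"
    and s1: "(\<Sum>k. \<gamma> / ((E + real (Suc k)) * \<Theta> (real (Suc k)))) \<le> 1"
  shows "\<exists>\<psi> C. bandlimited_orthogonal_wavelet \<psi> \<and>
    (\<forall>x. cmod (\<psi> x) \<le> C * exp (- (pi / (12 * exp 1) * \<gamma> * \<bar>x\<bar> / \<Theta> \<bar>x\<bar>)))"
proof -
  define T where "T y = pi / (12 * exp 1) * \<gamma> * y / \<Theta> y" for y
  define c0 where "c0 = pi / (12 * exp 1) * \<gamma>"
  have c0: "0 \<le> c0" using \<gamma> by (simp add: c0_def)
  have th0: "0 < \<Theta> y" if "0 \<le> y" for y using ge1[OF that] by linarith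
  have T0: "0 \<le> T y" if "0 \<le> y" for y unfolding T_def c0_def[symmetric] using c0 th0[OF that] that by simp
  have T1: "T y \<le> c0 * y" if "0 \<le> y" for y
  proof -
    have "c0 * y * 1 \<le> c0 * y * \<Theta> y" using c0 that ge1[OF that] by (intro mult_left_mono) auto
    thus ?thesis unfolding T_def c0_def[symmetric] using th0[OF that] by (simp add: pos_divide_le_eq)
  qed
  have Tsub: "T (y + z) \<le> T y + T z" if "0 \<le> y" "0 \<le> z" for y z
  proof -
    have "T (y + z) = c0 * y / \<Theta> (y + z) + c0 * z / \<Theta> (y + z)"
      unfolding T_def c0_def[symmetric] by (simp add: distrib_left add_divide_distrib)
    also have "\<dots> \<le> c0 * y / \<Theta> y + c0 * z / \<Theta> z"
      using that c0 th0 mono by (intro add_mono divide_left_mono mult_pos_pos) auto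
    finally show ?thesis unfolding T_def c0_def .
  qed
  note env = T0 T1 c0
  define V where "V x = exp (envelope T x)" for x
  have V: "submult_weight V" unfolding V_def[abs_def] by (rule submult_weight_envelope[OF env Tsub])
  have Vmono: "V x \<le> V y" if "\<bar>x\<bar> \<le> \<bar>y\<bar>" for x y unfolding V_def using envelope_mono[OF env that] by simp
  have V1: "1 \<le> V x" for x using V by (simp add: submult_weight_def)
  obtain \<kappa> C where \<kappa>: "transition (1/6) \<kappa>"
    and k: "\<And>x. cmod (ift (\<lambda>\<xi>. of_real (\<kappa> \<xi>)) x) \<le> C / ((1 + \<bar>x\<bar>) ^ 4 * V x)"
    using cutoff_with_weight[of \<Theta>, OF mono ge1 E \<gamma> s s1] unfolding V_def T_def[abs_def] by blast
  obtain C' where b: "\<And>x. cmod (ift (\<lambda>\<xi>. of_real (bell \<kappa> \<xi>)) x) \<le> C' / ((1 + \<bar>x\<bar>)\<^sup>2 * V x)"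
    using bell_decay[OF V Vmono \<kappa> k] by blast
  have C: "0 \<le> C" using order_trans[OF norm_ge_zero k[of 0]] V1[of 0] by (simp add: zero_le_divide_iff)
  have C': "0 \<le> C'" using order_trans[OF norm_ge_zero b[of 0]] V1[of 0] by (simp add: zero_le_divide_iff)
  have dropV: "c / (d * V x) \<le> c / d" if "0 \<le> c" "0 < d" for c d x
    using that V1[of x] mult_left_mono[OF V1[of x], of d] by (intro divide_left_mono) auto
  interpret meyer \<kappa> C C'
  proof
    show "cmod (ift (\<lambda>\<xi>. of_real (\<kappa> \<xi>)) x) \<le> C / (1 + \<bar>x\<bar>) ^ 4" for x
      by (rule order_trans[OF k dropV[OF C]]) (auto simp: add_pos_nonneg)
    show "cmod (ift (\<lambda>\<xi>. of_real (bell \<kappa> \<xi>)) x) \<le> C' / (1 + \<bar>x\<bar>)\<^sup>2" for x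
      by (rule order_trans[OF b dropV[OF C']]) (auto simp: add_pos_nonneg)
  qed (rule \<kappa>)
  have "cmod (psi x) \<le> C' * V (-1/2) * exp (- T \<bar>x\<bar>)" for x
  proof -
    \<comment> \<open>The translation by 1/2 in \<open>psi_eq\<close> costs the fixed factor V
      (-1/2).\<close>
    have "V x \<le> V (x + 1/2) * V (-1/2)"
      using V[unfolded submult_weight_def, THEN conjunct2, rule_format, of "x + 1/2" "-1/2"] by simp
    moreover have "exp (T \<bar>x\<bar>) \<le> V x" unfolding V_def using envelope_upper[OF env, of "\<bar>x\<bar>" x] by simp
    ultimately have e: "exp (T \<bar>x\<bar>) \<le> V (x + 1/2) * V (-1/2)" by linarith
    have "cmod (psi x) \<le> C' / ((1 + \<bar>x + 1/2\<bar>)\<^sup>2 * V (x + 1/2))" unfolding psi_eq by (rule b)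
    also have "\<dots> \<le> C' / (1 * V (x + 1/2))"
      using C' V1[of "x + 1/2"] by (intro divide_left_mono mult_right_mono mult_pos_pos) (auto simp: add_pos_nonneg)
    also have "\<dots> \<le> C' * V (-1/2) * exp (- T \<bar>x\<bar>)"
    proof -
      have "C' * exp (T \<bar>x\<bar>) \<le> C' * (V (x + 1/2) * V (-1/2))" using e C' by (rule mult_left_mono)
      thus ?thesis using V1[of "x + 1/2"] by (simp add: exp_minus field_simps)
    qed
    finally show ?thesis .
  qed
  moreover have "bandlimited_orthogonal_wavelet psi"
    unfolding bandlimited_orthogonal_wavelet_def using bandlimited_psi orthogonal_wavelet_psi by blast
  ultimately show ?thesis unfolding T_def by blast
qed

section \<open>Iterated logarithms\<close>

lemma lnit_simps [simp]: "lnit 0 x = x" "lnit (Suc i) x = ln (lnit i x)"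
  by (simp_all add: lnit_def)

lemma lnit_Suc_ln: "lnit (Suc i) x = lnit i (ln x)"
  by (simp add: lnit_def funpow_swap1)

lemma expit_simps [simp]: "expit 0 x = x" "expit (Suc i) x = exp (expit i x)"
  by (simp_all add: expit_def)

lemma expit_ge_1: "1 \<le> expit i 1"
proof (induction i)
  case (Suc i) thus ?case using exp_ge_add_one_self[of "expit i 1"] by simp
qed simp

lemma expit_mono: "i \<le> j \<Longrightarrow> expit i 1 \<le> expit j 1"
proof (induction rule: dec_induct)
  case (step n) thus ?case using exp_ge_add_one_self[of "expit n 1"] by (simp, linarith)
qed simp

lemma expit_le_ln: "expit (Suc i) 1 \<le> y \<Longrightarrow> expit i 1 \<le> ln y"
  using less_le_trans[OF exp_gt_zero, of "expit i 1" y] by (subst ln_ge_iff) auto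

lemma lnit_ge_1: "expit i 1 \<le> y \<Longrightarrow> 1 \<le> lnit i y"
proof (induction i arbitrary: y)
  case (Suc i) thus ?case unfolding lnit_Suc_ln using expit_le_ln by blast
qed simp

lemma lnit_mono: "expit i 1 \<le> x \<Longrightarrow> x \<le> y \<Longrightarrow> lnit i x \<le> lnit i y"
proof (induction i arbitrary: x y)
  case (Suc i)
  have "0 < x" using Suc.prems(1) less_le_trans[OF exp_gt_zero] by simp
  hence "ln x \<le> ln y" using Suc.prems(2) by simp
  with Suc.IH[OF expit_le_ln[OF Suc.prems(1)]] show ?case unfolding lnit_Suc_ln by blast
qed simp

text \<open>Iterated logarithms are 1-Lipschitz beyond their base point, because ln (1 + D / y)
  \<le> D / y \<le> D for y \<ge> 1. This will compare different shifts of the argument.\<close>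

lemma lnit_add_le: "expit i 1 \<le> y \<Longrightarrow> 0 \<le> D \<Longrightarrow> lnit i (y + D) \<le> lnit i y + D"
proof (induction i arbitrary: y)
  case (Suc i)
  have y: "1 \<le> y" using order_trans[OF expit_ge_1 Suc.prems(1)] .
  note le = expit_le_ln[OF Suc.prems(1)]
  have "ln (y + D) = ln (y * (1 + D / y))" using y by (simp add: distrib_left)
  also have "\<dots> = ln y + ln (1 + D / y)" using y Suc.prems(2) by (intro ln_mult_pos add_pos_nonneg) auto
  also have "\<dots> \<le> ln y + D / y" using y Suc.prems(2) by (intro add_left_mono ln_add_one_self_le_self) auto
  also have "\<dots> \<le> ln y + D" using y Suc.prems(2) mult_left_mono[OF y Suc.prems(2)] by (simp add: divide_le_eq)
  finally have u: "ln (y + D) \<le> ln y + D" .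
  have "expit i 1 \<le> ln (y + D)" using le Suc.prems(2) y by (intro order_trans[OF le]) simp
  from lnit_mono[OF this u] Suc.IH[OF le Suc.prems(2)] show ?case unfolding lnit_Suc_ln by linarith
qed simp

text \<open>Each logarithm contributes the reciprocal of its argument to the chain rule, and the
  arguments are the earlier iterates.\<close>

lemma DERIV_lnit:
  "expit i 1 \<le> y \<Longrightarrow> (lnit i has_real_derivative inverse (\<Prod>q<i. lnit q y)) (at y)"
proof (induction i)
  case 0
  have "lnit 0 = (\<lambda>x. x)" by auto
  thus ?case by simp
next
  case (Suc i)
  have le: "expit i 1 \<le> y" using order_trans[OF expit_mono[of i "Suc i"] Suc.prems] by simp
  have "0 < lnit i y" using lnit_ge_1[OF le] by simp
  hence "((\<lambda>x. ln (lnit i x)) has_real_derivative inverse (\<Prod>q<i. lnit q y) / lnit i y) (at y)"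
    using Suc.IH[OF le] by (intro DERIV_ln_divide[THEN DERIV_chain2, THEN DERIV_cong]) (auto simp: field_simps)
  moreover have "lnit (Suc i) = (\<lambda>x. ln (lnit i x))" by auto
  ultimately show ?case by (simp add: field_simps)
qed

text \<open>All logarithms use the largest shift, so that \<open>\<epsilon> / ((E + x) * log_weight l \<epsilon> x)\<close> is exactly the
  derivative of \<open>- (lnit (l + 1) (E + x)) powr (- \<epsilon>)\<close> with \<open>E = expit (l + 1) 1\<close>.\<close>

definition log_weight :: "nat \<Rightarrow> real \<Rightarrow> real \<Rightarrow> real" where
  "log_weight l \<epsilon> x = (\<Prod>i=1..l. lnit i (expit (l+1) 1 + x)) * lnit (l+1) (expit (l+1) 1 + x) powr (1 + \<epsilon>)"

lemma log_arg:
  assumes "0 \<le> x" "i \<le> l + 1"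
  shows "expit i 1 \<le> expit (l+1) 1 + x"
  using expit_mono[OF assms(2)] assms(1) by linarith

lemma log_weight_mono:
  assumes "0 \<le> x" "x \<le> y" "0 \<le> \<epsilon>"
  shows "log_weight l \<epsilon> x \<le> log_weight l \<epsilon> y"
  unfolding log_weight_def
proof (intro mult_mono prod_mono conjI powr_mono2)
  fix i assume "i \<in> {1..l}"
  hence i: "i \<le> l + 1" by simp
  show "0 \<le> lnit i (expit (l+1) 1 + x)" using lnit_ge_1[OF log_arg[OF assms(1) i]] by simp
  show "lnit i (expit (l+1) 1 + x) \<le> lnit i (expit (l+1) 1 + y)"
    using assms by (intro lnit_mono log_arg i) auto
next
  show "0 \<le> lnit (l+1) (expit (l+1) 1 + x)" using lnit_ge_1[OF log_arg[OF assms(1), of "l+1" l]] by simp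
  show "lnit (l+1) (expit (l+1) 1 + x) \<le> lnit (l+1) (expit (l+1) 1 + y)"
    using assms by (intro lnit_mono log_arg) auto
  have "0 \<le> y" using assms by simp
  thus "0 \<le> (\<Prod>i=1..l. lnit i (expit (l+1) 1 + y))"
    by (intro prod_nonneg ballI order_trans[OF zero_le_one lnit_ge_1[OF log_arg]]) auto
qed (use assms in auto)

lemma log_weight_ge_1:
  assumes "0 \<le> x" "0 \<le> \<epsilon>"
  shows "1 \<le> log_weight l \<epsilon> x"
proof -
  have "1 \<le> (\<Prod>i=1..l. lnit i (expit (l+1) 1 + x))"
    using assms(1) by (intro prod_ge_1 lnit_ge_1 log_arg) auto
  moreover have "1 \<le> lnit (l+1) (expit (l+1) 1 + x) powr (1 + \<epsilon>)"
    using assms lnit_ge_1[OF log_arg[OF assms(1), of "l+1" l]] by (intro ge_one_powr_ge_zero) auto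
  ultimately have "1 * 1 \<le> log_weight l \<epsilon> x" unfolding log_weight_def by (intro mult_mono) auto
  thus ?thesis by simp
qed

text \<open>An integral test: by the mean value theorem and monotonicity of the weight, each term is
  at most a decrement of Z, and Z 0 \<le> 1. The numerator \<epsilon> is the one produced by
  differentiating the power, so the bound is uniform in \<epsilon>.\<close>

lemma log_weight_sum:
  fixes \<epsilon> E :: real and l :: nat
  assumes \<epsilon>: "0 < \<epsilon>"
  defines "E \<equiv> expit (l+1) 1"
  shows "summable (\<lambda>k. \<epsilon> / ((E + real (Suc k)) * log_weight l \<epsilon> (real (Suc k))))"
    and "(\<Sum>k. \<epsilon> / ((E + real (Suc k)) * log_weight l \<epsilon> (real (Suc k)))) \<le> 1"
proof -
  let ?a = "\<lambda>k. \<epsilon> / ((E + real (Suc k)) * log_weight l \<epsilon> (real (Suc k)))"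
  define Z where "Z x = lnit (l+1) (E + x) powr (- \<epsilon>)" for x
  have E1: "1 \<le> E" unfolding E_def by (rule expit_ge_1)
  have DZ: "(Z has_real_derivative - (\<epsilon> / ((E + x) * log_weight l \<epsilon> x))) (at x)" if x: "0 \<le> x" for x
  proof -
    have le: "expit (l+1) 1 \<le> E + x" using x by (simp add: E_def)
    have L1: "1 \<le> lnit (l+1) (E + x)" by (rule lnit_ge_1[OF le])
    have d: "((\<lambda>x. lnit (l+1) (E + x)) has_real_derivative inverse (\<Prod>q<l+1. lnit q (E + x))) (at x)"
    proof -
      have "((\<lambda>x. E + x) has_real_derivative 1) (at x)" by (auto intro!: derivative_eq_intros)
      from DERIV_chain2[OF DERIV_lnit[OF le] this] show ?thesis by (simp only: mult_1_right)
    qed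
    have p: "(\<Prod>q<l+1. lnit q (E + x)) = (E + x) * (\<Prod>i=1..l. lnit i (E + x))"
      unfolding Suc_eq_plus1[symmetric] prod.lessThan_Suc_shift
      by (simp add: prod.atLeast1_atMost_eq)
    have "((\<lambda>x. lnit (l+1) (E + x) powr (- \<epsilon>)) has_real_derivative
        - \<epsilon> * lnit (l+1) (E + x) powr (- \<epsilon> - 1) * inverse (\<Prod>q<l+1. lnit q (E + x))) (at x)"
      by (rule DERIV_chain2[where g="\<lambda>x. lnit (l+1) (E + x)", OF has_real_derivative_powr d]) (use L1 in linarith)
    moreover have "- \<epsilon> - 1 = - (1 + \<epsilon>)" by simp
    hence "lnit (l+1) (E + x) powr (- \<epsilon> - 1) = inverse (lnit (l+1) (E + x) powr (1 + \<epsilon>))"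
      by (simp only: powr_minus)
    ultimately show ?thesis
      unfolding Z_def[abs_def] p log_weight_def E_def[symmetric]
      by (simp only: inverse_eq_divide) (simp only: times_divide_eq_left times_divide_eq_right divide_divide_eq_left mult_1 mult_1_right mult_minus_left minus_divide_left mult_ac)
  qed
  have step: "?a k \<le> Z (real k) - Z (real (Suc k))" for k
  proof -
    obtain z where z: "real k < z" "z < real (Suc k)"
      "Z (real (Suc k)) - Z (real k) = (real (Suc k) - real k) * - (\<epsilon> / ((E + z) * log_weight l \<epsilon> z))"
      using MVT2[of "real k" "real (Suc k)" Z "\<lambda>x. - (\<epsilon> / ((E + x) * log_weight l \<epsilon> x))"] DZ by auto
    have z0: "0 \<le> z" using z(1) by simp
    have "?a k \<le> \<epsilon> / ((E + z) * log_weight l \<epsilon> z)"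
    proof (rule divide_left_mono)
      have w: "0 < log_weight l \<epsilon> z" "0 < log_weight l \<epsilon> (real (Suc k))"
        using log_weight_ge_1[OF z0, of \<epsilon> l] log_weight_ge_1[of "real (Suc k)" \<epsilon> l] \<epsilon> by auto
      show "(E + z) * log_weight l \<epsilon> z \<le> (E + real (Suc k)) * log_weight l \<epsilon> (real (Suc k))"
        using z z0 E1 w \<epsilon> by (intro mult_mono log_weight_mono) auto
      show "0 < (E + real (Suc k)) * log_weight l \<epsilon> (real (Suc k)) * ((E + z) * log_weight l \<epsilon> z)"
        using E1 w z0 by (intro mult_pos_pos) auto
    qed (use \<epsilon> in simp)
    thus ?thesis using z(3) by simp
  qed
  have a0: "0 \<le> ?a k" for k
    using log_weight_ge_1[of "real (Suc k)" \<epsilon> l] \<epsilon> E1 by (intro divide_nonneg_nonneg mult_nonneg_nonneg) auto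
  have "Z 0 \<le> lnit (l+1) (E + 0) powr 0"
    unfolding Z_def using \<epsilon> lnit_ge_1[OF log_arg[of 0 "l+1" l]] by (intro powr_mono) (auto simp: E_def)
  also have "\<dots> \<le> 1" by simp
  finally have Z0: "Z 0 \<le> 1" .
  have part: "(\<Sum>k<n. ?a k) \<le> 1" for n
  proof -
    have "(\<Sum>k<n. ?a k) \<le> (\<Sum>k<n. Z (real k) - Z (real (Suc k)))" by (rule sum_mono[OF step])
    also have "\<dots> = Z 0 - Z (real n)" using sum_lessThan_telescope'[of "\<lambda>k. Z (real k)" n] by simp
    also have "\<dots> \<le> Z 0" by (simp add: Z_def del: lnit_simps)
    also have "\<dots> \<le> 1" by (rule Z0)
    finally show ?thesis .
  qed
  show s: "summable ?a" by (rule summableI_nonneg_bounded[OF a0 part])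
  show "suminf ?a \<le> 1" by (rule suminf_le_const[OF s part])
qed

text \<open>Returning from the common shift E to the individual ones changes each logarithm by at
  most E. As the logarithms are at least 1, each of the l factors costs 1 + E; the factor with the
  power already has the right shift.\<close>

lemma log_weight_le:
  assumes x: "0 \<le> x"
  shows "log_weight l \<epsilon> x \<le> (1 + expit (l+1) 1) ^ l *
    ((\<Prod>i=1..l. lnit i (expit i 1 + x)) * lnit (l+1) (expit (l+1) 1 + x) powr (1 + \<epsilon>))"
proof -
  define E where "E = expit (l+1) 1"
  have E1: "1 \<le> E" unfolding E_def by (rule expit_ge_1)
  have "(\<Prod>i=1..l. lnit i (E + x)) \<le> (\<Prod>i=1..l. (1 + E) * lnit i (expit i 1 + x))"
  proof (rule prod_mono)
    fix i assume "i \<in> {1..l}"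
    hence i: "i \<le> l + 1" by simp
    have iE: "expit i 1 \<le> E" unfolding E_def by (rule expit_mono[OF i])
    have ix: "expit i 1 \<le> expit i 1 + x" using x by simp
    have "lnit i (E + x) = lnit i ((expit i 1 + x) + (E - expit i 1))" by (simp add: algebra_simps)
    also have "\<dots> \<le> lnit i (expit i 1 + x) + (E - expit i 1)" using iE by (intro lnit_add_le ix) simp
    also have "\<dots> \<le> lnit i (expit i 1 + x) + E * 1" using expit_ge_1[of i] by simp
    also have "\<dots> \<le> lnit i (expit i 1 + x) + E * lnit i (expit i 1 + x)"
      using E1 lnit_ge_1[OF ix] by (intro add_left_mono mult_left_mono) auto
    finally show "0 \<le> lnit i (E + x) \<and> lnit i (E + x) \<le> (1 + E) * lnit i (expit i 1 + x)"
      using lnit_ge_1[OF log_arg[OF x i]] by (simp add: E_def distrib_right)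
  qed
  also have "\<dots> = (1 + E) ^ l * (\<Prod>i=1..l. lnit i (expit i 1 + x))" by (simp add: prod.distrib)
  finally show ?thesis
    unfolding log_weight_def E_def[symmetric] mult.assoc[symmetric] by (intro mult_right_mono) auto
qed

text \<open>The rate is pi / (12 e) divided by (1 + E)^l. It depends on l through the change of
  shifts, but not on \<epsilon>. For l = 0 the product is empty and this is the single-logarithm
  estimate.\<close>

lemma iterated_log_wavelet:
  "\<exists>c'>0. \<forall>\<epsilon>::real. 0 < \<epsilon> \<and> \<epsilon> \<le> 1 \<longrightarrow>
     (\<exists>c. \<exists>\<psi>. bandlimited_orthogonal_wavelet \<psi> \<and>
       (\<forall>x. cmod (\<psi> x) \<le> c * exp (- (c' * \<epsilon> * \<bar>x\<bar> /
          ((\<Prod>i=1..l. lnit i (expit i 1 + \<bar>x\<bar>)) *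
           (lnit (l+1) (expit (l+1) 1 + \<bar>x\<bar>)) powr (1 + \<epsilon>))))))"
proof -
  define E where "E = expit (l+1) 1"
  have E1: "1 \<le> E" unfolding E_def by (rule expit_ge_1)
  define c0 :: real where "c0 = pi / (12 * exp 1)"
  have c0: "0 < c0" by (simp add: c0_def)
  have c': "0 < c0 / (1 + E) ^ l" using c0 E1 by simp
  show ?thesis
  proof (rule exI[of _ "c0 / (1 + E) ^ l"], rule conjI[OF c'], intro allI impI)
    fix \<epsilon> :: real assume "0 < \<epsilon> \<and> \<epsilon> \<le> 1"
    hence \<epsilon>: "0 < \<epsilon>" "\<epsilon> \<le> 1" by auto
    obtain \<psi> C where \<psi>: "bandlimited_orthogonal_wavelet \<psi>"
      and dec: "\<And>x. cmod (\<psi> x) \<le> C * exp (- (c0 * \<epsilon> * \<bar>x\<bar> / log_weight l \<epsilon> \<bar>x\<bar>))"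
      using wavelet_with_weight[of "log_weight l \<epsilon>" E \<epsilon>, OF log_weight_mono log_weight_ge_1 _ \<epsilon>
          log_weight_sum[OF \<epsilon>(1), of l, folded E_def]] \<epsilon> E1
      unfolding c0_def[symmetric] by (auto simp: less_imp_le)
    have C: "0 \<le> C" using order_trans[OF norm_ge_zero dec[of 0]] by simp
    have "cmod (\<psi> x) \<le> C * exp (- (c0 / (1 + E) ^ l * \<epsilon> * \<bar>x\<bar> /
        ((\<Prod>i=1..l. lnit i (expit i 1 + \<bar>x\<bar>)) * (lnit (l+1) (expit (l+1) 1 + \<bar>x\<bar>)) powr (1 + \<epsilon>))))" for x
    proof -
      let ?O = "(\<Prod>i=1..l. lnit i (expit i 1 + \<bar>x\<bar>)) * (lnit (l+1) (expit (l+1) 1 + \<bar>x\<bar>)) powr (1 + \<epsilon>)"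
      have w1: "1 \<le> log_weight l \<epsilon> \<bar>x\<bar>" using \<epsilon> by (intro log_weight_ge_1) auto
      have wO: "log_weight l \<epsilon> \<bar>x\<bar> \<le> (1 + E) ^ l * ?O" unfolding E_def by (rule log_weight_le) simp
      have "c0 / (1 + E) ^ l * \<epsilon> * \<bar>x\<bar> / ?O = c0 * \<epsilon> * \<bar>x\<bar> / ((1 + E) ^ l * ?O)" by simp
      also have "\<dots> \<le> c0 * \<epsilon> * \<bar>x\<bar> / log_weight l \<epsilon> \<bar>x\<bar>"
      proof (rule divide_left_mono[OF wO])
        have w0: "0 < log_weight l \<epsilon> \<bar>x\<bar>" using w1 by linarith
        show "0 < (1 + E) ^ l * ?O * log_weight l \<epsilon> \<bar>x\<bar>"
          by (rule mult_pos_pos[OF less_le_trans[OF w0 wO] w0])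
      qed (use c0 \<epsilon> in simp)
      finally have "exp (- (c0 * \<epsilon> * \<bar>x\<bar> / log_weight l \<epsilon> \<bar>x\<bar>)) \<le> exp (- (c0 / (1 + E) ^ l * \<epsilon> * \<bar>x\<bar> / ?O))" by simp
      from mult_left_mono[OF this C] dec[of x]
      show ?thesis by (rule order_trans[rotated])
    qed
    with \<psi> show "\<exists>c \<psi>. bandlimited_orthogonal_wavelet \<psi> \<and>
        (\<forall>x. cmod (\<psi> x) \<le> c * exp (- (c0 / (1 + E) ^ l * \<epsilon> * \<bar>x\<bar> /
        ((\<Prod>i=1..l. lnit i (expit i 1 + \<bar>x\<bar>)) * (lnit (l+1) (expit (l+1) 1 + \<bar>x\<bar>)) powr (1 + \<epsilon>)))))"
      by blast
  qed
qed

theorem theorem2p3: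
  shows "(\<exists>c'>0. \<forall>\<epsilon>::real. 0 < \<epsilon> \<and> \<epsilon> \<le> 1 \<longrightarrow>
            (\<exists>c. \<exists>\<psi>. bandlimited_orthogonal_wavelet \<psi> \<and>
               (\<forall>x. cmod (\<psi> x) \<le> c * exp (- (c' * \<epsilon> * \<bar>x\<bar> / (ln (exp 1 + \<bar>x\<bar>)) powr (1 + \<epsilon>))))))
       \<and> (\<forall>l::nat. l \<ge> 1 \<longrightarrow> (\<exists>c'>0. \<forall>\<epsilon>::real. 0 < \<epsilon> \<and> \<epsilon> \<le> 1 \<longrightarrow>
            (\<exists>c. \<exists>\<psi>. bandlimited_orthogonal_wavelet \<psi> \<and>
               (\<forall>x. cmod (\<psi> x) \<le> c * exp (- (c' * \<epsilon> * \<bar>x\<bar> /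
                   ((\<Prod>i=1..l. lnit i (expit i 1 + \<bar>x\<bar>)) *
                    (lnit (l+1) (expit (l+1) 1 + \<bar>x\<bar>)) powr (1 + \<epsilon>))))))))"
  using iterated_log_wavelet[of 0] iterated_log_wavelet by simp

end
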